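(* Let $m<-1$. For every $a<0$, the boundary value problem $$f'''+\frac{m+1}{2}ff''-mf'^2=0 \text{ on } [0,\infty),\qquad f(0)=a,\quad f'(0)=-1,\quad f'(\infty)=0$$ admits a unique convex-concave solution such that $\lim_{t\to\infty}f(t)=\ell$ for some $\ell<0$, and infinitely many convex-concave solutions such that $\lim_{t\to\infty}f(t)=0$. Moreover, all these solutions are negative and bounded.
   Context: A solution is a three times differentiable function $f:[0,\infty)\to\mathbb{R}$ satisfying the equation on $[0,\infty)$ and the boundary conditions, where $f'(\infty):=\lim_{t\to\infty}f'(t)$. A convex-concave solution is a solution for which there exists $t_0>0$ with $f''>0$ on $[0,t_0)$, $f''(t_0)=0$ and $f''<0$ on $(t_0,\infty)$ (convex on $[0,t_0)$, then concave on $[t_0,\infty)$). *)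

theory Defs
  imports "HOL-Analysis.Analysis"
begin

text \<open>
  A function on \<open>[0,\<infinity>)\<close> is represented by a function of type \<^typ>\<open>real \<Rightarrow> real\<close> lying in
  \<^term>\<open>extensional {0..}\<close> (hence fixed off \<open>[0,\<infinity>)\<close>), so that equality and cardinality refer to
  functions on \<open>[0,\<infinity>)\<close> only. Derivatives are taken within \<open>[0,\<infinity>)\<close>, i.e. one-sided at \<open>0\<close>.
\<close>

definition D :: "(real \<Rightarrow> real) \<Rightarrow> real \<Rightarrow> real" where
  "D f t = vector_derivative f (at t within {0..})"

definition three_times_differentiable :: "(real \<Rightarrow> real) \<Rightarrow> bool" where
  "three_times_differentiable f \<longleftrightarrow>
     f differentiable_on {0..} \<and> D f differentiable_on {0..} \<and> D (D f) differentiable_on {0..}"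

definition bvp_solution :: "real \<Rightarrow> real \<Rightarrow> (real \<Rightarrow> real) \<Rightarrow> bool" where
  "bvp_solution m a f \<longleftrightarrow>
     f \<in> extensional {0..} \<and>
     three_times_differentiable f \<and>
     (\<forall>t\<ge>0. D (D (D f)) t + (m + 1) / 2 * f t * D (D f) t - m * (D f t)\<^sup>2 = 0) \<and>
     f 0 = a \<and> D f 0 = -1 \<and> (D f \<longlongrightarrow> 0) at_top"

definition convex_concave_solution :: "real \<Rightarrow> real \<Rightarrow> (real \<Rightarrow> real) \<Rightarrow> bool" where
  "convex_concave_solution m a f \<longleftrightarrow>
     bvp_solution m a f \<and>
     (\<exists>t\<^sub>0>0. (\<forall>t\<in>{0..<t\<^sub>0}. D (D f) t > 0) \<and> D (D f) t\<^sub>0 = 0 \<and> (\<forall>t>t\<^sub>0. D (D f) t < 0))"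

end

theory Submission
  imports Defs
begin

text \<open>
  Put \<open>k = - (m + 1) / 2\<close>, \<open>g = - f\<close>, \<open>p = g'\<close> and \<open>E = g'' + k g g'\<close>. The equation becomes \<open>g' = p\<close>,
  \<open>p' = E - k g p\<close>, \<open>E' = (3 k + 1) p\<^sup>2\<close>, is invariant under \<open>g(t) \<mapsto> c g(c t)\<close>, and therefore
  projects to the plane of \<open>u = g' / g\<^sup>2\<close>, \<open>v = g'' / g\<^sup>3\<close>, where the origin is a saddle-node. Orbits entering
  it through the nodal sector have \<open>g \<longlonglongrightarrow> 0\<close>; the only orbit from the side \<open>u < 0 < v\<close> on which \<open>g\<close> has a
  positive limit is the strong stable separatrix. Followed backwards, the separatrix and its
  neighbours in the sector cross \<open>v = 0\<close> exactly once and then reach \<open>u = 1 / a\<^sup>2\<close>; scaling turns the initial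
  values there into \<open>g = - a\<close>, \<open>g' = 1\<close>. For uniqueness, the height difference \<open>\<Delta>\<close> between an orbit with
  positive limit and the separatrix over the same \<open>u\<close> makes \<open>\<Delta>\<^sup>2 g\<^sup>-\<^sup>2\<^sup>C\<close> nondecreasing although it tends
  to \<open>0\<close>. Hence \<open>\<Delta> = 0\<close>, and since \<open>u\<close> strictly decreases while \<open>v < 0\<close>, both orbits meet \<open>u = 1 / a\<^sup>2\<close> at
  the same point.
\<close>

section \<open>Differential inequalities and globally Lipschitz fields\<close>

text \<open>The choice of \<open>E\<close> shapes the proof. \<open>E\<close> never decreases,
  \<open>E = 0\<close> is the line \<open>v = - k u\<close>, the strong stable direction at the
  origin, and on a tail with \<open>g > 0 > p\<close> a positive value of \<open>E\<close> would
  give \<open>g'' \<ge> E\<close> and drive \<open>p\<close> above 0. So \<open>E \<le> 0\<close> is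
  necessary for a convex-concave solution whose \<open>g\<close> has a nonnegative limit, and it is
  also the upper wall of the strip in which the separatrix is caught; the lower wall is the node
  region. Instead of invariant manifold theory at this degenerate point, existence comes from
  connectedness between the two walls, and uniqueness from a comparison in which the decay of
  \<open>\<Delta>\<close> is charged to that of \<open>ln g\<close>. The other obstacle is blow-up
  of the quadratic system. Forwards the trapping regions are bounded. Backwards it has to be shown a
  priori that \<open>g\<close> stays bounded until \<open>g'' = 0\<close>, and that
  \<open>u = 1 / a^2\<close> is met before \<open>g\<close> can vanish.\<close>

lemma nondecreasing_within:
  fixes y :: "real \<Rightarrow> real"
  assumes "a \<le> b" "{a..b} \<subseteq> S"
    and der: "\<And>t. t \<in> {a..b} \<Longrightarrow> (y has_real_derivative y' t) (at t within S)"
    and nn: "\<And>t. a < t \<Longrightarrow> t < b \<Longrightarrow> y' t \<ge> 0"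
  shows "y a \<le> y b"
proof (rule DERIV_nonneg_imp_increasing_open[OF \<open>a \<le> b\<close>])
  have d: "(y has_real_derivative y' t) (at t within {a..b})" if "t \<in> {a..b}" for t
    using der[OF that] assms(2) by (rule has_field_derivative_subset)
  show "continuous_on {a..b} y"
    using d by (rule DERIV_continuous_on)
  show "\<exists>z. DERIV y x :> z \<and> 0 \<le> z" if "a < x" "x < b" for x
    using d[of x] nn[of x] that by (metis at_within_Icc_at atLeastAtMost_iff less_imp_le)
qed

lemma increasing_within:
  fixes y :: "real \<Rightarrow> real"
  assumes "a < b" "{a..b} \<subseteq> S"
    and der: "\<And>t. t \<in> {a..b} \<Longrightarrow> (y has_real_derivative y' t) (at t within S)"
    and nn: "\<And>t. a < t \<Longrightarrow> t < b \<Longrightarrow> y' t > 0"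
  shows "y a < y b"
proof (rule DERIV_pos_imp_increasing_open[OF \<open>a < b\<close>])
  have d: "(y has_real_derivative y' t) (at t within {a..b})" if "t \<in> {a..b}" for t
    using der[OF that] assms(2) by (rule has_field_derivative_subset)
  show "continuous_on {a..b} y"
    using d by (rule DERIV_continuous_on)
  show "\<exists>z. DERIV y x :> z \<and> 0 < z" if "a < x" "x < b" for x
    using d[of x] nn[of x] that by (metis at_within_Icc_at atLeastAtMost_iff less_imp_le)
qed

text \<open>Gronwall's inequality from below, by the integrating factor \<open>exp (K * t)\<close>.
  \<open>K\<close> may be negative, and the rate is needed in the open interval only.\<close>

lemma exp_lower_bound_within:
  fixes y :: "real \<Rightarrow> real"
  assumes "a \<le> b" "{a..b} \<subseteq> S"
    and der: "\<And>t. t \<in> {a..b} \<Longrightarrow> (y has_real_derivative y' t) (at t within S)"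
    and nn: "\<And>t. a < t \<Longrightarrow> t < b \<Longrightarrow> y' t \<ge> - K * y t"
  shows "y a * exp (- K * (b - a)) \<le> y b"
proof -
  have "y a * exp (K * a) \<le> y b * exp (K * b)"
  proof (rule nondecreasing_within[OF assms(1,2)])
    show "((\<lambda>t. y t * exp (K * t)) has_real_derivative (y' t + K * y t) * exp (K * t)) (at t within S)"
      if "t \<in> {a..b}" for t
      by (rule derivative_eq_intros der[OF that] refl)+ (simp add: algebra_simps)
    show "(y' t + K * y t) * exp (K * t) \<ge> 0" if "a < t" "t < b" for t
      using nn[OF that] by simp
  qed
  then have "y a * exp (K * a) * exp (- K * b) \<le> y b * exp (K * b) * exp (- K * b)"
    by (rule mult_right_mono) simp
  then show ?thesis
    by (simp add: mult.assoc exp_add[symmetric] algebra_simps)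
qed

text \<open>Exponential decay cannot reach 0, so a strict inequality that holds up to an exit time
  still holds at it. The barriers below are checked in this form.\<close>

lemma positive_within:
  fixes y :: "real \<Rightarrow> real"
  assumes "a \<le> b" "{a..b} \<subseteq> S"
    and "\<And>t. t \<in> {a..b} \<Longrightarrow> (y has_real_derivative y' t) (at t within S)"
    and "\<And>t. a < t \<Longrightarrow> t < b \<Longrightarrow> y' t \<ge> - K * y t"
    and "y a > 0"
  shows "y b > 0"
  using exp_lower_bound_within[of a b S y y' K] assms
  by (metis exp_gt_zero mult_pos_pos order_less_le_trans)

text \<open>Continuous induction: the bad times form a closed set, whose infimum would be a first
  exit time, so only the passage from \<open>[0, T)\<close> to \<open>T\<close> has to be
  checked.\<close>

lemma stays_in_open:
  fixes X :: "real \<Rightarrow> 'a::topological_space"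
  assumes cont: "continuous_on {0..} X" and U: "open U" "X 0 \<in> U"
    and step: "\<And>T. T > 0 \<Longrightarrow> (\<And>t. 0 \<le> t \<Longrightarrow> t < T \<Longrightarrow> X t \<in> U) \<Longrightarrow> X T \<in> U"
    and "t \<ge> 0"
  shows "X t \<in> U"
proof (rule ccontr)
  assume t: "X t \<notin> U"
  define B where "B = {0..} \<inter> X -` (- U)"
  have clB: "closed B"
    unfolding B_def by (rule continuous_closed_preimage[OF cont]) (use U in auto)
  have ne: "B \<noteq> {}" using t \<open>t \<ge> 0\<close> by (auto simp: B_def)
  have bd: "bdd_below B" by (auto simp: B_def intro!: bdd_belowI[of _ 0])
  have inB: "Inf B \<in> B" using closed_contains_Inf[OF ne bd clB] .
  then have T0: "Inf B \<ge> 0" "X (Inf B) \<notin> U" by (auto simp: B_def)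
  have "Inf B \<noteq> 0" using T0 U by auto
  then have "Inf B > 0" using T0 by simp
  moreover have "X s \<in> U" if "0 \<le> s" "s < Inf B" for s
    using that cInf_lower[OF _ bd, of s] by (auto simp: B_def)
  ultimately show False using step[of "Inf B"] T0 by blast
qed

lemma first_exit:
  fixes X :: "real \<Rightarrow> 'a::topological_space"
  assumes cont: "continuous_on {0..} X" and U: "open U" "X 0 \<in> U"
  obtains "\<And>t. t \<ge> 0 \<Longrightarrow> X t \<in> U"
  | T where "T > 0" "\<And>t. 0 \<le> t \<Longrightarrow> t < T \<Longrightarrow> X t \<in> U" "X T \<notin> U"
  using stays_in_open[OF assms] by metis

text \<open>Turns a slope bounded away from 0 into a contradiction with the positivity of
  \<open>g\<close> or of \<open>- p\<close>.\<close>

lemma negative_slope_unbounded_below: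
  fixes g p :: "real \<Rightarrow> real"
  assumes der: "\<And>t. t \<ge> t0 \<Longrightarrow> (g has_real_derivative p t) (at t within S)"
    and S: "{t0..} \<subseteq> S"
    and le: "\<And>t. t \<ge> t0 \<Longrightarrow> p t \<le> - c" and "c > 0"
  shows "\<exists>t\<ge>t0. g t < M"
proof -
  define t where "t = t0 + (\<bar>g t0 - M\<bar> + 1) / c"
  have t: "t \<ge> t0" using \<open>c > 0\<close> by (simp add: t_def)
  have "- g t0 - c * t0 \<le> - g t - c * t"
    by (rule nondecreasing_within[where y = "\<lambda>t. - g t - c * t" and y' = "\<lambda>t. - p t - c" and S = S])
      (use t S le in \<open>auto intro!: derivative_eq_intros der simp: le_minus_iff[of c]\<close>)
  moreover have "c * (t - t0) = \<bar>g t0 - M\<bar> + 1" using \<open>c > 0\<close> by (simp add: t_def)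
  ultimately have "g t \<le> g t0 - \<bar>g t0 - M\<bar> - 1" by (simp add: algebra_simps)
  then have "g t < M" by linarith
  with t show ?thesis by blast
qed

section \<open>Global existence and dependence on initial values for Lipschitz fields\<close>

text \<open>Picard iteration in Bielecki's weighted norm. The unknown is
  \<open>exp (- 2 L t) X t\<close>, for which the integral operator contracts by 1/2 on the whole
  half-line, so no local solutions have to be continued.\<close>

lemma picard_global:
  fixes F :: "'a::banach \<Rightarrow> 'a"
  assumes L: "\<And>x y. norm (F x - F y) \<le> L * norm (x - y)" and "L > 0"
  shows "\<exists>X. X 0 = x0 \<and> (\<forall>t\<ge>0. (X has_vector_derivative F (X t)) (at t within {0..}))"
proof -
  \<comment> \<open>\<open>y\<close> is the weighted unknown and \<open>I y\<close> the unweighted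
    integral. \<open>max 0 t\<close> freezes everything for negative times, so that bounded
    continuous functions on the whole line can be used.\<close>
  define G where "G y s = F (exp (2 * L * s) *\<^sub>R y s)" for y and s :: real
  define I where "I y t = x0 + integral {0..max 0 t} (G y)" for y and t :: real
  define \<Phi> where "\<Phi> y t = exp (- (2 * L * max 0 t)) *\<^sub>R I y t" for y t
  have contF: "continuous_on UNIV F"
  proof (rule continuous_on_iff[THEN iffD2], intro ballI allI impI)
    fix x and e :: real assume "e > 0"
    show "\<exists>d>0. \<forall>x'\<in>UNIV. dist x' x < d \<longrightarrow> dist (F x') (F x) < e"
    proof (intro exI[of _ "e / L"] conjI ballI impI)
      fix x' assume "dist x' x < e / L"
      then have "L * norm (x' - x) < e" using \<open>L > 0\<close> by (simp add: dist_norm field_simps)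
      then show "dist (F x') (F x) < e" using L[of x' x] by (simp add: dist_norm)
    qed (use \<open>e > 0\<close> \<open>L > 0\<close> in simp)
  qed
  have contG: "continuous_on S (G (apply_bcontfun y))" for S y
    unfolding G_def
    by (rule continuous_on_compose2[OF contF]) (auto intro!: continuous_intros)
  have intG: "G (apply_bcontfun y) integrable_on {a..b}" for y a b
    by (rule integrable_continuous_real[OF contG])
  have derI: "(I (apply_bcontfun y) has_vector_derivative G (apply_bcontfun y) t) (at t within {0..})"
    if "t \<ge> 0" for y t
  proof -
    have "((\<lambda>u. integral {0..u} (G y)) has_vector_derivative G y t) (at t within {0..t+1})"
      by (rule integral_has_vector_derivative[OF contG]) (use that in auto)
    then have "((\<lambda>u. x0 + integral {0..u} (G y)) has_vector_derivative G y t) (at t within {0..t+1})"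
      by (auto intro!: derivative_eq_intros)
    then have "(I y has_vector_derivative G y t) (at t within {0..t+1})"
      by (rule has_vector_derivative_transform[rotated 2]) (use that in \<open>auto simp: I_def\<close>)
    moreover have "at t within {0..t+1} = at t within {0..}"
      by (rule at_within_nhd[of _ "{..<t+1}"]) auto
    ultimately show ?thesis by simp
  qed
  have contI: "continuous_on UNIV (I (apply_bcontfun y))" for y
  proof -
    have "continuous_on {0..} (I y)"
      using derI by (intro continuous_on_vector_derivative) auto
    then have "continuous_on UNIV (\<lambda>t. I y (max 0 t))"
      by (rule continuous_on_compose2) (auto intro!: continuous_intros)
    then show ?thesis by (simp add: I_def)
  qed
  have cont\<Phi>: "continuous_on UNIV (\<Phi> (apply_bcontfun y))" for y
    unfolding \<Phi>_def by (intro continuous_intros contI)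
  have expint: "((\<lambda>s. exp (2 * L * s)) has_integral (exp (2 * L * r) - 1) / (2 * L)) {0..r}" if "r \<ge> 0" for r
  proof -
    have "((\<lambda>s. exp (2 * L * s)) has_integral (exp (2 * L * r) / (2 * L) - exp (2 * L * 0) / (2 * L))) {0..r}"
      by (rule fundamental_theorem_of_calculus[OF that])
        (use \<open>L > 0\<close> in \<open>auto intro!: derivative_eq_intros simp: has_real_derivative_iff_has_vector_derivative[symmetric]\<close>)
    then show ?thesis by (simp add: diff_divide_distrib)
  qed
  have key: "norm (\<Phi> (apply_bcontfun y) t - \<Phi> (apply_bcontfun z) t) \<le> 1/2 * dist y z" for y z t
  proof -
    define r where "r = max 0 t"
    have r: "r \<ge> 0" by (simp add: r_def)
    have "norm (integral {0..r} (\<lambda>s. G y s - G z s)) \<le> integral {0..r} (\<lambda>s. L * dist y z * exp (2 * L * s))"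
    proof (rule integral_norm_bound_integral)
      show "(\<lambda>s. G y s - G z s) integrable_on {0..r}" by (intro integrable_diff intG)
      show "(\<lambda>s. L * dist y z * exp (2 * L * s)) integrable_on {0..r}"
        by (intro integrable_continuous_real continuous_intros)
      fix s assume "s \<in> {0..r}"
      have "norm (G y s - G z s) \<le> L * norm (exp (2 * L * s) *\<^sub>R y s - exp (2 * L * s) *\<^sub>R z s)"
        unfolding G_def by (rule L)
      also have "\<dots> = L * (exp (2 * L * s) * dist (y s) (z s))"
        by (simp add: dist_norm flip: scaleR_diff_right)
      also have "\<dots> \<le> L * (exp (2 * L * s) * dist y z)"
        using \<open>L > 0\<close> by (intro mult_left_mono dist_bounded) auto
      finally show "norm (G y s - G z s) \<le> L * dist y z * exp (2 * L * s)" by (simp add: mult_ac)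
    qed
    also have "integral {0..r} (\<lambda>s. L * dist y z * exp (2 * L * s)) = L * dist y z * ((exp (2 * L * r) - 1) / (2 * L))"
      using has_integral_mult_right[OF expint[OF r], of "L * dist y z"] by (rule integral_unique)
    also have "\<dots> = dist y z * (exp (2 * L * r) - 1) / 2" using \<open>L > 0\<close> by simp
    also have "\<dots> \<le> dist y z * exp (2 * L * r) / 2" by (simp add: mult_left_mono)
    finally have *: "norm (I y t - I z t) \<le> dist y z * exp (2 * L * r) / 2"
      by (simp add: I_def r_def Henstock_Kurzweil_Integration.integral_diff intG)
    have "norm (\<Phi> y t - \<Phi> z t) = exp (- (2 * L * r)) * norm (I y t - I z t)"
      by (simp add: \<Phi>_def r_def flip: scaleR_diff_right)
    also have "\<dots> \<le> exp (- (2 * L * r)) * (dist y z * exp (2 * L * r) / 2)"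
      by (rule mult_left_mono[OF *]) simp
    also have "\<dots> = 1/2 * dist y z" by (simp add: exp_minus)
    finally show ?thesis .
  qed
  \<comment> \<open>Boundedness at the zero function and the contraction estimate together make
    every \<open>\<Phi> y\<close> bounded, hence a legitimate argument of
    \<open>Bcontfun\<close>.\<close>
  have bound0: "norm (\<Phi> (apply_bcontfun (0::real \<Rightarrow>\<^sub>C 'a)) t) \<le> norm x0 + norm (F 0) / (2 * L)" for t
  proof -
    define r where "r = max 0 t"
    have r: "r \<ge> 0" by (simp add: r_def)
    have "I (apply_bcontfun 0) t = x0 + r *\<^sub>R F 0"
      using r unfolding I_def r_def[symmetric] G_def by simp
    then have "norm (\<Phi> (apply_bcontfun 0) t) = exp (- (2 * L * r)) * norm (x0 + r *\<^sub>R F 0)"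
      by (simp add: \<Phi>_def r_def)
    also have "\<dots> \<le> exp (- (2 * L * r)) * (norm x0 + r * norm (F 0))"
      using norm_triangle_ineq[of x0 "r *\<^sub>R F 0"] r by (intro mult_left_mono) auto
    also have "\<dots> = exp (- (2 * L * r)) * norm x0 + (exp (- (2 * L * r)) * r) * norm (F 0)"
      by (simp add: algebra_simps)
    also have "\<dots> \<le> 1 * norm x0 + 1 / (2 * L) * norm (F 0)"
    proof (intro add_mono mult_right_mono)
      show "exp (- (2 * L * r)) \<le> 1" using r \<open>L > 0\<close> by simp
      have "2 * L * r \<le> exp (2 * L * r)" using exp_ge_add_one_self[of "2 * L * r"] by linarith
      then show "exp (- (2 * L * r)) * r \<le> 1 / (2 * L)"
        using \<open>L > 0\<close> by (simp add: exp_minus field_simps)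
    qed auto
    finally show ?thesis by simp
  qed
  have bc: "\<Phi> (apply_bcontfun y) \<in> bcontfun" for y
  proof -
    have "norm (\<Phi> (apply_bcontfun y) t) \<le> 1/2 * dist y 0 + (norm x0 + norm (F 0) / (2 * L))" for t
      using key[of y t 0] bound0[of t] norm_triangle_sub[of "\<Phi> (apply_bcontfun y) t" "\<Phi> (apply_bcontfun (0::real \<Rightarrow>\<^sub>C 'a)) t"] by linarith
    then show ?thesis
      using cont\<Phi>[of y] by (auto simp: bcontfun_def bounded_iff)
  qed
  have "\<exists>!y. Bcontfun (\<Phi> (apply_bcontfun y)) = y"
  proof (rule banach_fix_type)
    show "\<forall>x y. dist (Bcontfun (\<Phi> (apply_bcontfun x))) (Bcontfun (\<Phi> (apply_bcontfun y))) \<le> 1/2 * dist x y"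
      by (intro allI dist_bound) (use key in \<open>auto simp: Bcontfun_inverse[OF bc] dist_norm\<close>)
  qed auto
  then obtain y where y: "Bcontfun (\<Phi> (apply_bcontfun y)) = y" by auto
  then have fp: "\<Phi> (apply_bcontfun y) t = y t" for t
    by (metis Bcontfun_inverse[OF bc])
  have yI: "I y t = exp (2 * L * t) *\<^sub>R y t" if "t \<ge> 0" for t
    unfolding fp[of t, symmetric] using that by (simp add: \<Phi>_def exp_minus)
  show ?thesis
  proof (intro exI conjI allI impI)
    show "I y 0 = x0" by (simp add: I_def)
    show "(I y has_vector_derivative F (I y t)) (at t within {0..})" if "t \<ge> 0" for t
      using derI[OF that, of y] yI[OF that] by (simp add: G_def)
  qed
qed

text \<open>By Cauchy-Schwarz the squared distance grows at a rate of at most \<open>2 * L\<close>.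
  It enters \<open>exp_lower_bound_within\<close> with a minus sign, because an upper bound is
  wanted.\<close>

lemma gronwall_lipschitz:
  fixes F :: "'a::real_inner \<Rightarrow> 'a"
  assumes L: "\<And>x y. norm (F x - F y) \<le> L * norm (x - y)"
    and X: "\<And>t. t \<in> {0..T} \<Longrightarrow> (X has_vector_derivative F (X t)) (at t within {0..T})"
    and Y: "\<And>t. t \<in> {0..T} \<Longrightarrow> (Y has_vector_derivative F (Y t)) (at t within {0..T})"
    and "T \<ge> 0"
  shows "norm (X T - Y T) \<le> exp (L * T) * norm (X 0 - Y 0)"
proof -
  define N where "N t = (X t - Y t) \<bullet> (X t - Y t)" for t
  have "- N 0 * exp (- (- 2 * L) * (T - 0)) \<le> - N T"
  proof (rule exp_lower_bound_within[OF \<open>T \<ge> 0\<close> order_refl])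
    fix t assume t: "t \<in> {0..T}"
    show "((\<lambda>t. - N t) has_real_derivative - (2 * ((X t - Y t) \<bullet> (F (X t) - F (Y t))))) (at t within {0..T})"
      unfolding N_def has_real_derivative_iff_has_vector_derivative
      using has_vector_derivative_minus[OF bounded_bilinear.has_vector_derivative[OF bounded_bilinear_inner
        has_vector_derivative_diff[OF X[OF t] Y[OF t]] has_vector_derivative_diff[OF X[OF t] Y[OF t]]]]
      by (simp add: inner_commute)
  next
    fix t
    have "(X t - Y t) \<bullet> (F (X t) - F (Y t)) \<le> norm (X t - Y t) * norm (F (X t) - F (Y t))"
      by (rule norm_cauchy_schwarz)
    also have "\<dots> \<le> norm (X t - Y t) * (L * norm (X t - Y t))"
      by (rule mult_left_mono[OF L]) simp
    also have "\<dots> = L * N t" by (simp add: N_def power2_norm_eq_inner[symmetric] power2_eq_square)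
    finally show "- (2 * ((X t - Y t) \<bullet> (F (X t) - F (Y t)))) \<ge> - (- 2 * L) * - N t" by simp
  qed
  then have "(norm (X T - Y T))\<^sup>2 \<le> (exp (L * T) * norm (X 0 - Y 0))\<^sup>2"
    by (simp add: N_def power2_norm_eq_inner power_mult_distrib exp_double[symmetric] mult_ac)
  then show ?thesis by (rule power2_le_imp_le) simp
qed

section \<open>The autonomous system\<close>

text \<open>
  \<open>E\<close> stands for \<open>g'' + a g g'\<close>. The values \<open>a = k\<close>, \<open>b = 3 k + 1\<close> give \<open>g''' + k g g'' = (2 k + 1) g'\<^sup>2\<close>,
  which is the equation for \<open>g = - f\<close>; negating both parameters reverses time.
\<close>

definition sol :: "real \<Rightarrow> real \<Rightarrow> (real \<Rightarrow> real) \<Rightarrow> (real \<Rightarrow> real) \<Rightarrow> (real \<Rightarrow> real) \<Rightarrow> real set \<Rightarrow> bool" where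
  "sol a b g p E S \<longleftrightarrow> (\<forall>t\<in>S. (g has_real_derivative p t) (at t within S) \<and>
     (p has_real_derivative E t - a * g t * p t) (at t within S) \<and>
     (E has_real_derivative b * (p t)\<^sup>2) (at t within S))"

lemma solD:
  assumes "sol a b g p E S" "t \<in> S"
  shows "(g has_real_derivative p t) (at t within S)"
    and "(p has_real_derivative E t - a * g t * p t) (at t within S)"
    and "(E has_real_derivative b * (p t)\<^sup>2) (at t within S)"
  using assms by (auto simp: sol_def)

lemma sol_subset: "sol a b g p E S \<Longrightarrow> S' \<subseteq> S \<Longrightarrow> sol a b g p E S'"
  unfolding sol_def by (meson has_field_derivative_subset subsetD)

lemma sol_continuous:
  assumes "sol a b g p E S"
  shows "continuous_on S g" "continuous_on S p" "continuous_on S E"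
  by (rule DERIV_continuous_on[OF solD(1)[OF assms]] DERIV_continuous_on[OF solD(2)[OF assms]]
      DERIV_continuous_on[OF solD(3)[OF assms]], assumption)+

section \<open>Symmetries and gluing\<close>

lemma has_real_derivative_affine:
  assumes "(y has_real_derivative y') (at (c * t + d) within S)" "\<And>t. t \<in> S' \<Longrightarrow> c * t + d \<in> S"
  shows "((\<lambda>t. y (c * t + d)) has_real_derivative y' * c) (at t within S')"
proof -
  have "(y has_real_derivative y') (at (c * t + d) within (\<lambda>t. c * t + d) ` S')"
    using assms by (auto intro: has_field_derivative_subset)
  moreover have "((\<lambda>t. c * t + d) has_real_derivative c) (at t within S')"
    by (auto intro!: derivative_eq_intros)
  ultimately show ?thesis
    using DERIV_image_chain[of y y' "\<lambda>t. c * t + d"] by (simp add: o_def)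
qed

text \<open>Time shift (\<open>c = 1\<close>) and scaling in one statement. The weights of
  \<open>g\<close>, \<open>p\<close>, \<open>E\<close> are 1, 2, 3, which is why
  \<open>p / g^2\<close> and \<open>g'' / g^3\<close> are invariant.\<close>

lemma sol_affine:
  assumes s: "sol a b g p E S" and "c \<noteq> 0" and sub: "\<And>t. t \<in> S' \<Longrightarrow> c * t + d \<in> S"
  shows "sol a b (\<lambda>t. c * g (c * t + d)) (\<lambda>t. c\<^sup>2 * p (c * t + d)) (\<lambda>t. c ^ 3 * E (c * t + d)) S'"
proof -
  show ?thesis
    unfolding sol_def
  proof (intro ballI conjI)
    fix t assume t: "t \<in> S'"
    note D = solD[OF s sub[OF t], THEN has_real_derivative_affine, OF sub]
    show "((\<lambda>t. c * g (c * t + d)) has_real_derivative c\<^sup>2 * p (c * t + d)) (at t within S')"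
      using DERIV_cmult[OF D(1), where c = c] by (simp add: power2_eq_square mult_ac)
    show "((\<lambda>t. c\<^sup>2 * p (c * t + d)) has_real_derivative
       c ^ 3 * E (c * t + d) - a * (c * g (c * t + d)) * (c\<^sup>2 * p (c * t + d))) (at t within S')"
      using DERIV_cmult[OF D(2), where c = "c\<^sup>2"] by (simp add: power2_eq_square power3_eq_cube algebra_simps)
    show "((\<lambda>t. c ^ 3 * E (c * t + d)) has_real_derivative b * (c\<^sup>2 * p (c * t + d))\<^sup>2) (at t within S')"
      using DERIV_cmult[OF D(3), where c = "c ^ 3"] by (simp add: power2_eq_square power3_eq_cube algebra_simps)
  qed
qed

text \<open>Lets continuation backwards in time reuse the forward theory: \<open>g\<close> and
  \<open>E\<close> are even under reversal and \<open>p\<close> is odd.\<close>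

lemma sol_reverse:
  assumes s: "sol a b g p E {0..T}"
  shows "sol (- a) (- b) (\<lambda>t. g (T - t)) (\<lambda>t. - p (T - t)) (\<lambda>t. E (T - t)) {0..T}"
proof -
  have *: "((\<lambda>t. y (T - t)) has_real_derivative - y') (at t within {0..T})"
    if "(y has_real_derivative y') (at (T - t) within {0..T})" for y y' t
    using has_real_derivative_affine[of y y' "- 1" t T "{0..T}" "{0..T}"] that by simp
  show ?thesis
    unfolding sol_def
  proof (intro ballI conjI)
    fix t assume "t \<in> {0..T}"
    then have "T - t \<in> {0..T}" by auto
    note D = solD[OF s this, THEN *]
    show "((\<lambda>t. g (T - t)) has_real_derivative - p (T - t)) (at t within {0..T})"
      using D(1) .
    show "((\<lambda>t. - p (T - t)) has_real_derivative E (T - t) - - a * g (T - t) * - p (T - t)) (at t within {0..T})"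
      by (rule derivative_eq_intros D(2) refl)+ simp
    show "((\<lambda>t. E (T - t)) has_real_derivative - b * (- p (T - t))\<^sup>2) (at t within {0..T})"
      using D(3) by simp
  qed
qed

text \<open>The right-hand sides depend on the state alone, so agreement of the three values at
  \<open>T\<close> already matches the one-sided derivatives there.\<close>

lemma sol_glue:
  fixes g1 g2 :: "real \<Rightarrow> real"
  assumes s1: "sol a b g1 p1 E1 {0..T}" and s2: "sol a b g2 p2 E2 S" and "T \<ge> 0"
    and S: "0 \<in> S" "S \<subseteq> {0..}"
    and eq: "g1 T = g2 0" "p1 T = p2 0" "E1 T = E2 0"
  shows "sol a b (\<lambda>t. if t \<le> T then g1 t else g2 (t - T)) (\<lambda>t. if t \<le> T then p1 t else p2 (t - T))
    (\<lambda>t. if t \<le> T then E1 t else E2 (t - T)) ({0..T} \<union> (+) T ` S)"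
proof -
  have *: "((\<lambda>t. if t \<le> T then y1 t else y2 (t - T)) has_real_derivative (if t \<le> T then z1 t else z2 (t - T)))
      (at t within ({0..T} \<union> (+) T ` S))"
    if d1: "\<And>t. t \<in> {0..T} \<Longrightarrow> (y1 has_real_derivative z1 t) (at t within {0..T})"
      and d2: "\<And>t. t \<in> S \<Longrightarrow> (y2 has_real_derivative z2 t) (at t within S)"
      and e: "y1 T = y2 0" "z1 T = z2 0" and t: "t \<in> {0..T} \<union> (+) T ` S" for y1 y2 z1 z2 :: "real \<Rightarrow> real" and t
  proof -
    have d2': "((\<lambda>t. y2 (t - T)) has_real_derivative z2 (t - T)) (at t within (+) T ` S)" if t: "t \<in> (+) T ` S" for t
    proof -
      have "t' - T \<in> S" if "t' \<in> (+) T ` S" for t' using that by auto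
      with t d2[of "t - T"] show ?thesis
        using has_real_derivative_affine[of y2 "z2 (t - T)" 1 t "- T" S "(+) T ` S"] by simp
    qed
    have clS: "T \<le> t" if "t \<in> closure ((+) T ` S)" for t
    proof -
      have "closure ((+) T ` S) \<subseteq> {T..}" by (rule closure_minimal) (use S in auto)
      then show ?thesis using that by auto
    qed
    have TS: "T \<in> (+) T ` S" using S by force
    have "((\<lambda>x. if x \<in> {0..T} then y1 x else y2 (x - T)) has_vector_derivative
        (if t \<in> {0..T} then z1 t else z2 (t - T))) (at t within ({0..T} \<union> (+) T ` S))"
    proof (rule has_vector_derivative_If_within_closures)
      \<comment> \<open>The pieces meet only at \<open>T\<close>, which belongs to both, so the
        closure terms of the gluing rule enlarge neither of them.\<close>
      have profile: "{0..T} \<inter> closure ((+) T ` S) = {T}"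
        using clS TS \<open>T \<ge> 0\<close> by (auto intro!: antisym closure_subset[THEN subsetD])
      have cc2: "{0..T} \<union> (closure {0..T} \<inter> closure ((+) T ` S)) = {0..T}" using profile by auto
      have cc3: "(+) T ` S \<union> (closure {0..T} \<inter> closure ((+) T ` S)) = (+) T ` S" using profile TS by auto
      show "(y1 has_vector_derivative z1 t) (at t within {0..T} \<union> (closure {0..T} \<inter> closure ((+) T ` S)))"
        if "t \<in> {0..T} \<union> (closure {0..T} \<inter> closure ((+) T ` S))"
        using that d1[of t] unfolding cc2 by (simp add: has_real_derivative_iff_has_vector_derivative)
      show "((\<lambda>x. y2 (x - T)) has_vector_derivative z2 (t - T)) (at t within (+) T ` S \<union> (closure {0..T} \<inter> closure ((+) T ` S)))"
        if "t \<in> (+) T ` S \<union> (closure {0..T} \<inter> closure ((+) T ` S))"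
        using that d2'[of t] unfolding cc3 by (simp add: has_real_derivative_iff_has_vector_derivative)
      show "y1 t = y2 (t - T)" "z1 t = z2 (t - T)" if "t \<in> closure {0..T}" "t \<in> closure ((+) T ` S)"
      proof -
        have "t \<in> {0..T}" using that(1) by simp
        with that(2) profile have "t = T" by blast
        then show "y1 t = y2 (t - T)" "z1 t = z2 (t - T)" using e by auto
      qed
    qed (use t in auto)
    then have "((\<lambda>x. if x \<in> {0..T} then y1 x else y2 (x - T)) has_vector_derivative
        (if t \<le> T then z1 t else z2 (t - T))) (at t within ({0..T} \<union> (+) T ` S))"
      using t S \<open>T \<ge> 0\<close> by (auto split: if_splits)
    then have "((\<lambda>x. if x \<le> T then y1 x else y2 (x - T)) has_vector_derivative
        (if t \<le> T then z1 t else z2 (t - T))) (at t within ({0..T} \<union> (+) T ` S))"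
      by (rule has_vector_derivative_transform[rotated 2]) (use t S \<open>T \<ge> 0\<close> in auto)
    then show ?thesis by (simp add: has_real_derivative_iff_has_vector_derivative)
  qed
  note D1 = solD[OF s1] and D2 = solD[OF s2]
  show ?thesis
    unfolding sol_def
  proof (intro ballI conjI)
    fix t assume t: "t \<in> {0..T} \<union> (+) T ` S"
    show "((\<lambda>t. if t \<le> T then g1 t else g2 (t - T)) has_real_derivative (if t \<le> T then p1 t else p2 (t - T)))
       (at t within {0..T} \<union> (+) T ` S)"
      by (rule *[OF D1(1) D2(1) eq(1,2) t])
    have eq2: "E1 T - a * g1 T * p1 T = E2 0 - a * g2 0 * p2 0" using eq by simp
    have eq3: "b * (p1 T)\<^sup>2 = b * (p2 0)\<^sup>2" using eq by simp
    have "((\<lambda>t. if t \<le> T then p1 t else p2 (t - T)) has_real_derivative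
       (if t \<le> T then E1 t - a * g1 t * p1 t else E2 (t - T) - a * g2 (t - T) * p2 (t - T)))
       (at t within {0..T} \<union> (+) T ` S)"
      by (rule *[OF D1(2) D2(2) eq(2) eq2 t])
    then show "((\<lambda>t. if t \<le> T then p1 t else p2 (t - T)) has_real_derivative
       (if t \<le> T then E1 t else E2 (t - T)) - a * (if t \<le> T then g1 t else g2 (t - T)) * (if t \<le> T then p1 t else p2 (t - T)))
       (at t within {0..T} \<union> (+) T ` S)"
      by (simp split: if_splits)
    have "((\<lambda>t. if t \<le> T then E1 t else E2 (t - T)) has_real_derivative
       (if t \<le> T then b * (p1 t)\<^sup>2 else b * (p2 (t - T))\<^sup>2)) (at t within {0..T} \<union> (+) T ` S)"
      by (rule *[OF D1(3) D2(3) eq(3) eq3 t])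
    then show "((\<lambda>t. if t \<le> T then E1 t else E2 (t - T)) has_real_derivative
       b * (if t \<le> T then p1 t else p2 (t - T))\<^sup>2) (at t within {0..T} \<union> (+) T ` S)"
      by (simp split: if_splits)
  qed
qed

text \<open>
  Clipping each coordinate separately, instead of projecting to a ball, keeps \<open>E\<close> monotone along
  every orbit of the clipped field; the disjointness argument in \<open>separatrix_solution\<close> relies on this.
\<close>

definition clip :: "real \<Rightarrow> real \<Rightarrow> real" where
  "clip R x = max (- R) (min R x)"

lemma clip_lipschitz: "\<bar>clip R x - clip R y\<bar> \<le> \<bar>x - y\<bar>"
  by (auto simp: clip_def)

lemma abs_clip: "R \<ge> 0 \<Longrightarrow> \<bar>clip R x\<bar> \<le> R"
  by (auto simp: clip_def)

lemma clip_id: "\<bar>x\<bar> \<le> R \<Longrightarrow> clip R x = x"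
  by (auto simp: clip_def)

lemma abs_mult_diff_le:
  fixes x y z w :: real
  assumes "\<bar>x\<bar> \<le> R" "\<bar>w\<bar> \<le> R"
  shows "\<bar>x * y - z * w\<bar> \<le> R * \<bar>x - z\<bar> + R * \<bar>y - w\<bar>"
proof -
  have "x * y - z * w = x * (y - w) + (x - z) * w" by (simp add: algebra_simps)
  then have "\<bar>x * y - z * w\<bar> \<le> \<bar>x\<bar> * \<bar>y - w\<bar> + \<bar>x - z\<bar> * \<bar>w\<bar>"
    by (metis abs_mult abs_triangle_ineq)
  also have "\<dots> \<le> R * \<bar>y - w\<bar> + \<bar>x - z\<bar> * R"
    using assms by (intro add_mono mult_right_mono mult_left_mono) auto
  finally show ?thesis by (simp add: algebra_simps)
qed

definition clipped_field :: "real \<Rightarrow> real \<Rightarrow> real \<Rightarrow> real \<times> real \<times> real \<Rightarrow> real \<times> real \<times> real" where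
  "clipped_field a b R = (\<lambda>(x, y, z). (clip R y, clip R z - a * (clip R x * clip R y), b * (clip R y * clip R y)))"

definition lip_const :: "real \<Rightarrow> real \<Rightarrow> real \<Rightarrow> real" where
  "lip_const a b R = 2 + 2 * \<bar>a\<bar> * R + 2 * \<bar>b\<bar> * R"

lemma clipped_field_lipschitz:
  assumes "R \<ge> 0"
  shows "norm (clipped_field a b R X - clipped_field a b R Y) \<le> lip_const a b R * norm (X - Y)"
proof -
  obtain x y z where X: "X = (x, y, z)" by (cases X)
  obtain x' y' z' where Y: "Y = (x', y', z')" by (cases Y)
  define n where "n = norm (X - Y)"
  have n1: "\<bar>x - x'\<bar> \<le> n" using norm_fst_le[of "x - x'" "(y - y', z - z')"] by (simp add: n_def X Y)
  have "norm (y - y', z - z') \<le> n" using norm_snd_le[of "(y - y', z - z')" "x - x'"] by (simp add: n_def X Y)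
  then have n2: "\<bar>y - y'\<bar> \<le> n" "\<bar>z - z'\<bar> \<le> n"
    using norm_fst_le[of "y - y'" "z - z'"] norm_snd_le[of "z - z'" "y - y'"] by auto
  have c: "\<bar>clip R x - clip R x'\<bar> \<le> n" "\<bar>clip R y - clip R y'\<bar> \<le> n" "\<bar>clip R z - clip R z'\<bar> \<le> n"
    using n1 n2 clip_lipschitz order_trans by blast+
  have m1: "\<bar>clip R x * clip R y - clip R x' * clip R y'\<bar> \<le> R * n + R * n"
    using abs_mult_diff_le[of "clip R x" R "clip R y'" "clip R y" "clip R x'"] abs_clip[OF assms] c
      mult_left_mono[OF c(1) assms] mult_left_mono[OF c(2) assms] by fastforce
  have m2: "\<bar>clip R y * clip R y - clip R y' * clip R y'\<bar> \<le> R * n + R * n"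
    using abs_mult_diff_le[of "clip R y" R "clip R y'" "clip R y" "clip R y'"] abs_clip[OF assms]
      mult_left_mono[OF c(2) assms] by fastforce
  have "norm (clipped_field a b R X - clipped_field a b R Y) \<le> \<bar>clip R y - clip R y'\<bar> +
      (\<bar>(clip R z - a * (clip R x * clip R y)) - (clip R z' - a * (clip R x' * clip R y'))\<bar> +
       \<bar>b * (clip R y * clip R y) - b * (clip R y' * clip R y')\<bar>)"
    unfolding X Y clipped_field_def
    by (simp, rule order_trans[OF norm_Pair_le]) (simp add: norm_Pair_le[THEN order_trans])
  also have "\<dots> \<le> n + ((n + \<bar>a\<bar> * (R * n + R * n)) + \<bar>b\<bar> * (R * n + R * n))"
  proof (intro add_mono c)
    have "(clip R z - a * (clip R x * clip R y)) - (clip R z' - a * (clip R x' * clip R y')) =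
        (clip R z - clip R z') - a * (clip R x * clip R y - clip R x' * clip R y')" by (simp add: algebra_simps)
    also have "\<bar>\<dots>\<bar> \<le> \<bar>clip R z - clip R z'\<bar> + \<bar>a\<bar> * \<bar>clip R x * clip R y - clip R x' * clip R y'\<bar>"
      by (metis abs_mult abs_triangle_ineq4)
    also have "\<dots> \<le> n + \<bar>a\<bar> * (R * n + R * n)"
      using m1 by (intro add_mono c mult_left_mono) auto
    finally show "\<bar>(clip R z - a * (clip R x * clip R y)) - (clip R z' - a * (clip R x' * clip R y'))\<bar> \<le> n + \<bar>a\<bar> * (R * n + R * n)" .
    show "\<bar>b * (clip R y * clip R y) - b * (clip R y' * clip R y')\<bar> \<le> \<bar>b\<bar> * (R * n + R * n)"
      unfolding right_diff_distrib[symmetric] abs_mult using m2 by (intro mult_left_mono) auto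
  qed
  also have "\<dots> = lip_const a b R * n" by (simp add: lip_const_def algebra_simps)
  finally show ?thesis by (simp add: n_def)
qed

lemma lip_const_pos: "R \<ge> 0 \<Longrightarrow> lip_const a b R > 0"
  by (simp add: lip_const_def add_pos_nonneg)

text \<open>A trajectory of the clipped field, defined for all \<open>t \<ge> 0\<close> from any
  initial point. It solves the original system as long as it stays in \<open>cube R\<close>.\<close>

definition flow :: "real \<Rightarrow> real \<Rightarrow> real \<Rightarrow> real \<times> real \<times> real \<Rightarrow> real \<Rightarrow> real \<times> real \<times> real" where
  "flow a b R X0 = (SOME X. X 0 = X0 \<and> (\<forall>t\<ge>0. (X has_vector_derivative clipped_field a b R (X t)) (at t within {0..})))"

lemma
  assumes "R \<ge> 0"
  shows flow_0 [simp]: "flow a b R X0 0 = X0"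
    and flow_deriv: "\<And>t. t \<ge> 0 \<Longrightarrow> (flow a b R X0 has_vector_derivative clipped_field a b R (flow a b R X0 t)) (at t within {0..})"
  using someI_ex[OF picard_global[OF clipped_field_lipschitz[OF assms] lip_const_pos[OF assms]]]
  unfolding flow_def[symmetric] by blast+

lemma flow_continuous: "R \<ge> 0 \<Longrightarrow> continuous_on {0..} (flow a b R X0)"
  by (rule continuous_on_vector_derivative[OF flow_deriv]) auto

lemma flow_dependence:
  assumes "R \<ge> 0" "T \<ge> 0"
  shows "norm (flow a b R X0 T - flow a b R Y0 T) \<le> exp (lip_const a b R * T) * norm (X0 - Y0)"
proof -
  have "(flow a b R Z0 has_vector_derivative clipped_field a b R (flow a b R Z0 t)) (at t within {0..T})"
    if "t \<in> {0..T}" for Z0 t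
    by (rule has_vector_derivative_within_subset[OF flow_deriv[OF assms(1)]]) (use that in auto)
  then show ?thesis
    using gronwall_lipschitz[OF clipped_field_lipschitz[OF assms(1)] _ _ assms(2), of "flow a b R X0" a b "flow a b R Y0"]
    by (simp add: assms(1))
qed

text \<open>This makes the two shooting sets in \<open>separatrix_solution\<close> open.\<close>

lemma flow_continuous_initial:
  assumes "R \<ge> 0" "T \<ge> 0"
  shows "continuous_on UNIV (\<lambda>X0. flow a b R X0 T)"
proof (rule continuous_on_iff[THEN iffD2], intro ballI allI impI)
  fix X0 and e :: real assume "e > 0"
  let ?C = "exp (lip_const a b R * T)"
  show "\<exists>d>0. \<forall>Y0\<in>UNIV. dist Y0 X0 < d \<longrightarrow> dist (flow a b R Y0 T) (flow a b R X0 T) < e"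
  proof (intro exI[of _ "e / ?C"] conjI ballI impI)
    fix Y0 assume "dist Y0 X0 < e / ?C"
    then have "?C * norm (Y0 - X0) < e" by (simp add: dist_norm field_simps)
    then show "dist (flow a b R Y0 T) (flow a b R X0 T) < e"
      using flow_dependence[OF assms, of a b Y0 X0] by (simp add: dist_norm)
  qed (use \<open>e > 0\<close> in simp)
qed

lemma flow_components:
  fixes a b :: real and X0
  assumes "R \<ge> 0" "t \<ge> 0"
  defines "g \<equiv> \<lambda>t. fst (flow a b R X0 t)" and "p \<equiv> \<lambda>t. fst (snd (flow a b R X0 t))"
    and "E \<equiv> \<lambda>t. snd (snd (flow a b R X0 t))"
  shows "(g has_real_derivative clip R (p t)) (at t within {0..})"
    and "(p has_real_derivative clip R (E t) - a * (clip R (g t) * clip R (p t))) (at t within {0..})"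
    and "(E has_real_derivative b * (clip R (p t) * clip R (p t))) (at t within {0..})"
proof -
  note d = flow_deriv[OF assms(1,2), of a b X0]
  note d2 = bounded_linear.has_vector_derivative[OF bounded_linear_snd d]
  show "(g has_real_derivative clip R (p t)) (at t within {0..})"
    using bounded_linear.has_vector_derivative[OF bounded_linear_fst d]
    by (simp add: has_real_derivative_iff_has_vector_derivative g_def p_def clipped_field_def case_prod_beta)
  show "(p has_real_derivative clip R (E t) - a * (clip R (g t) * clip R (p t))) (at t within {0..})"
    using bounded_linear.has_vector_derivative[OF bounded_linear_fst d2]
    by (simp add: has_real_derivative_iff_has_vector_derivative g_def p_def E_def clipped_field_def case_prod_beta)
  show "(E has_real_derivative b * (clip R (p t) * clip R (p t))) (at t within {0..})"
    using bounded_linear.has_vector_derivative[OF bounded_linear_snd d2]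
    by (simp add: has_real_derivative_iff_has_vector_derivative p_def E_def clipped_field_def case_prod_beta)
qed

definition cube :: "real \<Rightarrow> (real \<times> real \<times> real) set" where
  "cube R = {- R..R} \<times> {- R..R} \<times> {- R..R}"

lemma flow_sol:
  assumes "R \<ge> 0" "S \<subseteq> {0..}" "\<And>t. t \<in> S \<Longrightarrow> flow a b R X0 t \<in> cube R"
  shows "sol a b (\<lambda>t. fst (flow a b R X0 t)) (\<lambda>t. fst (snd (flow a b R X0 t))) (\<lambda>t. snd (snd (flow a b R X0 t))) S"
  unfolding sol_def
proof (intro ballI)
  fix t assume t: "t \<in> S"
  then have t0: "t \<ge> 0" using assms by auto
  have c: "clip R (fst (flow a b R X0 t)) = fst (flow a b R X0 t)"
    "clip R (fst (snd (flow a b R X0 t))) = fst (snd (flow a b R X0 t))"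
    "clip R (snd (snd (flow a b R X0 t))) = snd (snd (flow a b R X0 t))"
    using assms(3)[OF t] by (auto simp: cube_def mem_Times_iff intro!: clip_id)
  note D = flow_components[OF assms(1) t0, of a b X0, unfolded c, THEN has_field_derivative_subset[OF _ assms(2)]]
  show "((\<lambda>t. fst (flow a b R X0 t)) has_real_derivative fst (snd (flow a b R X0 t))) (at t within S) \<and>
    ((\<lambda>t. fst (snd (flow a b R X0 t))) has_real_derivative
     snd (snd (flow a b R X0 t)) - a * fst (flow a b R X0 t) * fst (snd (flow a b R X0 t))) (at t within S) \<and>
    ((\<lambda>t. snd (snd (flow a b R X0 t))) has_real_derivative b * (fst (snd (flow a b R X0 t)))\<^sup>2) (at t within S)"
    using D by (simp add: power2_eq_square mult.assoc)
qed

lemma cube_closure: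
  fixes X :: "real \<Rightarrow> real \<times> real \<times> real"
  assumes "continuous_on {0..} X" "T > 0" "\<And>t. 0 \<le> t \<Longrightarrow> t < T \<Longrightarrow> X t \<in> cube R"
  shows "X T \<in> cube R"
proof -
  have "X ` closure {0..<T} \<subseteq> cube R"
  proof (rule image_closure_subset)
    show "continuous_on (closure {0..<T}) X" by (rule continuous_on_subset[OF assms(1)]) (use assms(2) in auto)
    show "closed (cube R)" unfolding cube_def by (intro closed_Times) auto
  qed (use assms(3) in auto)
  then show ?thesis using assms(2) by (auto simp: image_subset_iff)
qed

section \<open>Continuation and uniqueness for the original system\<close>

text \<open>Inside the bounded set \<open>U\<close> the clipping is inactive, and since the cube is
  closed this extends to the exit time. So either the orbit is global or it really leaves
  \<open>U\<close>; blow-up inside \<open>U\<close> is impossible.\<close>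

lemma sol_continuation:
  assumes U: "open U" "(g0, p0, E0) \<in> U" "U \<subseteq> cube R"
  obtains
    (global) g p E where "sol a b g p E {0..}" "g 0 = g0" "p 0 = p0" "E 0 = E0"
      "\<And>t. t \<ge> 0 \<Longrightarrow> (g t, p t, E t) \<in> U"
  | (exit) g p E T where "T > 0" "sol a b g p E {0..T}" "g 0 = g0" "p 0 = p0" "E 0 = E0"
      "\<And>t. 0 \<le> t \<Longrightarrow> t < T \<Longrightarrow> (g t, p t, E t) \<in> U" "(g T, p T, E T) \<notin> U"
proof -
  have R: "R \<ge> 0" using U by (force simp: cube_def)
  let ?X = "flow a b R (g0, p0, E0)"
  note c = flow_continuous[OF R, of a b "(g0, p0, E0)"]
  show thesis
  proof (rule first_exit[OF c U(1)])
    show "?X 0 \<in> U" using U R by simp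
    assume "\<And>t. 0 \<le> t \<Longrightarrow> ?X t \<in> U"
    then show thesis
      using U(3) R by (intro global[OF flow_sol[OF R]]) auto
  next
    fix T assume T: "T > 0" "\<And>t. 0 \<le> t \<Longrightarrow> t < T \<Longrightarrow> ?X t \<in> U" "?X T \<notin> U"
    have "?X T \<in> cube R" by (rule cube_closure[OF c T(1)]) (use T U in blast)
    then have "?X t \<in> cube R" if "t \<in> {0..T}" for t
      using T(2)[of t] U(3) that by (cases "t = T") auto
    then show thesis
      using T R by (intro exit[OF T(1) flow_sol[OF R]]) auto
  qed
qed

text \<open>The field is only locally Lipschitz, but by compactness both orbits lie in a common
  cube, where it agrees with a clipped field.\<close>

lemma sol_unique:
  assumes s1: "sol a b g1 p1 E1 {0..T}" and s2: "sol a b g2 p2 E2 {0..T}" and "T \<ge> 0"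
    and eq: "g1 0 = g2 0" "p1 0 = p2 0" "E1 0 = E2 0"
  shows "g1 T = g2 T \<and> p1 T = p2 T \<and> E1 T = E2 T"
proof -
  have bd: "\<exists>R. \<forall>t\<in>{0..T}. (g t, p t, E t) \<in> cube R" if s: "sol a b g p E {0..T}" for g p E
  proof -
    have "\<exists>R. \<forall>t\<in>{0..T}. \<bar>y t\<bar> \<le> R" if "continuous_on {0..T} y" for y :: "real \<Rightarrow> real"
      using compact_imp_bounded[OF compact_continuous_image[OF that compact_Icc]]
      by (auto simp: bounded_iff)
    then obtain r1 r2 r3 where "\<forall>t\<in>{0..T}. \<bar>g t\<bar> \<le> r1" "\<forall>t\<in>{0..T}. \<bar>p t\<bar> \<le> r2" "\<forall>t\<in>{0..T}. \<bar>E t\<bar> \<le> r3"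
      using sol_continuous[OF s] by meson
    then show ?thesis
      by (intro exI[of _ "max r1 (max r2 r3)"]) (fastforce simp: cube_def abs_le_iff)
  qed
  obtain R1 R2 where R12: "\<forall>t\<in>{0..T}. (g1 t, p1 t, E1 t) \<in> cube R1" "\<forall>t\<in>{0..T}. (g2 t, p2 t, E2 t) \<in> cube R2"
    using bd[OF s1] bd[OF s2] by blast
  define R where "R = max 0 (max R1 R2)"
  have R: "R \<ge> 0" by (simp add: R_def)
  have b1: "(g1 t, p1 t, E1 t) \<in> cube R" if "t \<in> {0..T}" for t
    using R12(1) that unfolding R_def cube_def by fastforce
  have b2: "(g2 t, p2 t, E2 t) \<in> cube R" if "t \<in> {0..T}" for t
    using R12(2) that unfolding R_def cube_def by fastforce
  have vd: "((\<lambda>t. (g t, p t, E t)) has_vector_derivative clipped_field a b R (g t, p t, E t)) (at t within {0..T})"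
    if s: "sol a b g p E {0..T}" and "(g t, p t, E t) \<in> cube R" "t \<in> {0..T}" for g p E t
  proof -
    have "clipped_field a b R (g t, p t, E t) = (p t, E t - a * g t * p t, b * (p t)\<^sup>2)"
      using that(2) by (auto simp: clipped_field_def cube_def clip_id abs_le_iff power2_eq_square)
    moreover have "((\<lambda>t. (g t, p t, E t)) has_vector_derivative (p t, E t - a * g t * p t, b * (p t)\<^sup>2)) (at t within {0..T})"
      using solD[OF s that(3)]
      unfolding has_real_derivative_iff_has_vector_derivative
      by (intro has_vector_derivative_Pair) auto
    ultimately show ?thesis by simp
  qed
  have "norm ((g1 T, p1 T, E1 T) - (g2 T, p2 T, E2 T)) \<le> exp (lip_const a b R * T) * norm ((g1 0, p1 0, E1 0) - (g2 0, p2 0, E2 0))"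
    using gronwall_lipschitz[OF clipped_field_lipschitz[OF R] vd[OF s1 b1] vd[OF s2 b2] \<open>T \<ge> 0\<close>] by simp
  then show ?thesis using eq by (simp add: zero_prod_def)
qed

lemma sol_unique_backward:
  assumes s1: "sol a b g1 p1 E1 {0..T}" and s2: "sol a b g2 p2 E2 {0..T}" and "T \<ge> 0"
    and eq: "g1 T = g2 T" "p1 T = p2 T" "E1 T = E2 T"
  shows "g1 0 = g2 0 \<and> p1 0 = p2 0 \<and> E1 0 = E2 0"
  using sol_unique[OF sol_reverse[OF s1] sol_reverse[OF s2] \<open>T \<ge> 0\<close>] eq by simp

section \<open>The saddle-node sector\<close>

text \<open>
  In the scale-invariant variables \<open>u = p / g\<^sup>2\<close> and \<open>v = g'' / g\<^sup>3\<close> the two regions below read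
  \<open>u > - \<beta>\<close>, \<open>v > 2 u\<^sup>2\<close> and, for the second one, also \<open>v < - (k / 2) u\<close>. The line \<open>v = - k u\<close> is the
  strong stable direction of the origin, so \<open>k / 2\<close> could be any number below \<open>k\<close>; the value of
  \<open>\<beta>\<close> makes the derivative of \<open>- (k / 2) u - v\<close> point inwards.
\<close>

definition beta :: "real \<Rightarrow> real" where
  "beta k = k\<^sup>2 / (10 * k + 4)"

lemma beta_pos: "k > 0 \<Longrightarrow> beta k > 0"
  by (simp add: beta_def)

lemma beta_mult: "k > 0 \<Longrightarrow> (10 * k + 4) * beta k = k\<^sup>2"
  by (simp add: beta_def)

lemma beta_small: "k > 0 \<Longrightarrow> beta k < k / 10"
  by (simp add: beta_def field_simps power2_eq_square)

definition core_region :: "real \<Rightarrow> (real \<times> real \<times> real) set" where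
  "core_region k = {x. 0 < fst x \<and> fst x < 2 \<and> 0 < fst (snd x) + beta k * (fst x)\<^sup>2 \<and>
     0 < fst x * (snd (snd x) - k * fst x * fst (snd x)) - 2 * (fst (snd x))\<^sup>2}"

definition node_region :: "real \<Rightarrow> (real \<times> real \<times> real) set" where
  "node_region k = {x. x \<in> core_region k \<and> 0 < - (k / 2) * fst x * fst (snd x) - (snd (snd x) - k * fst x * fst (snd x))}"

lemma core_region_iff: "(g, p, E) \<in> core_region k \<longleftrightarrow>
    0 < g \<and> g < 2 \<and> 0 < p + beta k * g\<^sup>2 \<and> 0 < g * (E - k * g * p) - 2 * p\<^sup>2"
  by (simp add: core_region_def)

lemma node_region_iff: "(g, p, E) \<in> node_region k \<longleftrightarrow> (g, p, E) \<in> core_region k \<and> 0 < - (k / 2) * g * p - (E - k * g * p)"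
  unfolding node_region_def mem_Collect_eq fst_conv snd_conv ..

lemma open_core_region: "open (core_region k)"
  unfolding core_region_def by (intro open_Collect_conj open_Collect_less continuous_intros)

lemma open_node_region: "open (node_region k)"
proof -
  have "node_region k = core_region k \<inter> {x. 0 < - (k / 2) * fst x * fst (snd x) - (snd (snd x) - k * fst x * fst (snd x))}"
    by (auto simp: node_region_def)
  moreover have "open {x::real\<times>real\<times>real. 0 < - (k / 2) * fst x * fst (snd x) - (snd (snd x) - k * fst x * fst (snd x))}"
    by (intro open_Collect_less continuous_intros)
  ultimately show ?thesis using open_core_region by auto
qed

lemma core_region_acc_pos:
  assumes "(g, p, E) \<in> core_region k"
  shows "0 < E - k * g * p"
proof -
  have "0 < g * (E - k * g * p)" using assms zero_le_power2[of p] unfolding core_region_iff by linarith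
  then show ?thesis using assms by (simp add: core_region_iff zero_less_mult_iff)
qed

text \<open>\<open>0 < v < - (k / 2) u\<close> forces \<open>u < 0\<close>, and its right half reads
  \<open>E < (k / 2) g p\<close>.\<close>

lemma node_region_signs:
  assumes "k > 0" "(g, p, E) \<in> node_region k"
  shows "p < 0" "E < 0"
proof -
  have C: "(g, p, E) \<in> core_region k" using assms by (simp add: node_region_iff)
  then have q: "0 < E - k * g * p" and g: "g > 0" by (rule core_region_acc_pos) (use C in \<open>simp add: core_region_iff\<close>)
  have S: "0 < - (k / 2) * g * p - (E - k * g * p)" using assms(2) unfolding node_region_iff by blast
  with q have "0 < - (k / 2) * g * p" by linarith
  then have "0 < (k / 2 * g) * (- p)" by simp
  then have "0 < - p" using g assms(1) by (metis zero_less_mult_pos mult_pos_pos half_gt_zero)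
  then show "p < 0" by simp
  have "k * g * p < 0" using \<open>p < 0\<close> g assms(1) by (simp add: mult_pos_neg)
  moreover have "E < (k * g * p) / 2" using S by (simp add: field_simps)
  ultimately show "E < 0" by linarith
qed

text \<open>In the core region \<open>g < 2\<close> and
  \<open>- p < beta k * g^2 < 4 * beta k\<close>; for \<open>p \<le> 0\<close> and
  \<open>E \<le> 0\<close>, the inequality \<open>g'' > 0\<close> adds
  \<open>- E < 8 * k * beta k\<close>. The radius dominates all three.\<close>

definition radius :: "real \<Rightarrow> real" where
  "radius k = 2 + 4 * beta k + 8 * k * beta k"

lemma radius_nonneg: "k > 0 \<Longrightarrow> radius k \<ge> 0"
  using beta_pos[of k] by (simp add: radius_def)

lemma core_region_slope_bound:
  assumes "k > 0" "(g, p, E) \<in> core_region k"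
  shows "- p < beta k * g\<^sup>2" "- p < 4 * beta k"
proof -
  have g: "0 < g" "g < 2" using assms by (auto simp: core_region_iff)
  show 1: "- p < beta k * g\<^sup>2" using assms by (simp add: core_region_iff)
  have "g\<^sup>2 \<le> 2\<^sup>2" using g by (intro power_mono) auto
  then have "beta k * g\<^sup>2 \<le> beta k * 4" using beta_pos[OF assms(1)] by (intro mult_left_mono) auto
  with 1 show "- p < 4 * beta k" by linarith
qed

lemma core_region_cube:
  assumes "k > 0" "(g, p, E) \<in> core_region k" "p \<le> 0" "E \<le> 0"
  shows "(g, p, E) \<in> cube (radius k)"
proof -
  have g: "0 < g" "g < 2" using assms by (auto simp: core_region_iff)
  note P = core_region_slope_bound[OF assms(1,2)]
  have b: "beta k > 0" using beta_pos[OF assms(1)] .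
  have "g * - p \<le> 2 * (4 * beta k)" using g P assms(3) by (intro mult_mono) auto
  then have "k * (g * - p) \<le> k * (2 * (4 * beta k))" using assms(1) by (intro mult_left_mono) auto
  then have "- (8 * k * beta k) \<le> k * g * p" by (simp add: algebra_simps)
  then have "- (8 * k * beta k) \<le> E" using core_region_acc_pos[OF assms(2)] by linarith
  moreover have "8 * k * beta k > 0" using b assms(1) by simp
  ultimately show ?thesis
    using g P b assms(3,4) by (auto simp: cube_def radius_def)
qed

lemma node_region_cube: "k > 0 \<Longrightarrow> node_region k \<subseteq> cube (radius k)"
proof clarify
  fix g p E assume "k > 0" "(g, p, E) \<in> node_region k"
  then show "(g, p, E) \<in> cube (radius k)"
    by (intro core_region_cube less_imp_le node_region_signs) (auto simp: node_region_iff)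
qed

section \<open>Forward invariance of the two regions\<close>

text \<open>The third-order equation for \<open>g\<close>, recovered from the system.\<close>

lemma acc_deriv:
  assumes "sol k (3 * k + 1) g p E S" "t \<in> S"
  shows "((\<lambda>t. E t - k * g t * p t) has_real_derivative
     - k * g t * (E t - k * g t * p t) + (2 * k + 1) * (p t)\<^sup>2) (at t within S)"
  by (rule derivative_eq_intros solD[OF assms] refl)+ (simp add: algebra_simps power2_eq_square)

text \<open>The barriers produce rates such as \<open>k * g t\<close>, whereas
  \<open>positive_within\<close> wants a constant; bounds on \<open>g\<close> provide it.\<close>

lemma weaken_rate:
  fixes c d r K :: real
  assumes "d \<ge> - c * r" "c \<le> K" "r \<ge> 0"
  shows "d \<ge> - K * r"
  using assms(1) mult_right_mono[OF assms(2,3)] by simp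

text \<open>While \<open>p < 0\<close>, each inequality defining the region either is monotone or
  decays at most exponentially, so none fails at \<open>T\<close>. The sign of \<open>p\<close> is
  assumed here because it has two sources: the node inequality in one application,
  \<open>E \<le> 0\<close> in the other.\<close>

lemma core_region_step:
  assumes k: "k > 0" and s: "sol k (3 * k + 1) g p E {0..T}" and T: "T > 0"
    and C: "\<And>t. 0 \<le> t \<Longrightarrow> t < T \<Longrightarrow> (g t, p t, E t) \<in> core_region k \<and> p t < 0"
  shows "(g T, p T, E T) \<in> core_region k"
proof -
  note D = solD[OF s] and Dq = acc_deriv[OF s]
  have b: "beta k > 0" by (rule beta_pos[OF k])
  have c: "0 < g t" "g t < 2" "0 < p t + beta k * (g t)\<^sup>2" "0 < E t - k * g t * p t"
    "0 < g t * (E t - k * g t * p t) - 2 * (p t)\<^sup>2" "p t < 0" "- p t < beta k * (g t)\<^sup>2"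
    if "0 < t" "t < T" for t
    using C[of t] that core_region_acc_pos core_region_slope_bound[OF k] by (auto simp: core_region_iff)
  have c0: "(g 0, p 0, E 0) \<in> core_region k" using C[of 0] T by auto
  have g: "g T > 0"
  proof (rule positive_within[of 0 T "{0..T}" g p "2 * beta k"])
    fix t assume t: "0 < t" "t < T"
    have "beta k * (g t)\<^sup>2 \<le> beta k * (2 * g t)"
      using b c[OF t] by (intro mult_left_mono) (auto simp: power2_eq_square)
    then show "p t \<ge> - (2 * beta k) * g t" using c[OF t] by simp
  qed (use T D(1) c0 in \<open>auto simp: core_region_iff\<close>)
  have "- g 0 \<le> - g T"
    by (rule nondecreasing_within[of 0 T "{0..T}" _ "\<lambda>t. - p t"])
      (use T c in \<open>auto intro!: derivative_eq_intros D simp: less_imp_le\<close>)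
  then have g2: "g T < 2" using c0 by (simp add: core_region_iff)
  \<comment> \<open>In phase coordinates: \<open>u' = g (v - 2 u^2)\<close> is positive in the
    region, so \<open>u\<close> cannot fall to \<open>- beta k\<close>.\<close>
  have r: "p T + beta k * (g T)\<^sup>2 > 0"
  proof (rule positive_within[of 0 T "{0..T}" "\<lambda>t. p t + beta k * (g t)\<^sup>2"
        "\<lambda>t. (E t - k * g t * p t) + beta k * (2 * g t * p t)" "4 * beta k"])
    fix t assume t: "0 < t" "t < T"
    note ct = c[OF t]
    let ?R = "p t + beta k * (g t)\<^sup>2" and ?q = "E t - k * g t * p t"
    have "g t * (?q + beta k * (2 * g t * p t)) \<ge> 2 * p t * ?R"
      using ct(5) by (simp add: algebra_simps power2_eq_square)
    moreover have "p t * ?R \<ge> - (beta k * (g t)\<^sup>2) * ?R"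
      using ct by (intro mult_right_mono) auto
    ultimately have "g t * (?q + beta k * (2 * g t * p t)) \<ge> g t * (- (2 * beta k * g t) * ?R)"
      by (simp add: algebra_simps power2_eq_square)
    then have "?q + beta k * (2 * g t * p t) \<ge> - (2 * beta k * g t) * ?R"
      using ct(1) by (simp only: mult_le_cancel_left_pos)
    then show "?q + beta k * (2 * g t * p t) \<ge> - (4 * beta k) * ?R"
      by (rule weaken_rate) (use ct b in auto)
  qed (use T c0 in \<open>auto intro!: derivative_eq_intros D simp: core_region_iff algebra_simps\<close>)
  \<comment> \<open>\<open>P = g g'' - 2 p^2\<close> satisfies
    \<open>P' = - k g P + g p^2 - 3 p g''\<close>, and the last two terms are nonnegative for
    \<open>p < 0\<close>.\<close>
  have q: "g T * (E T - k * g T * p T) - 2 * (p T)\<^sup>2 > 0"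
  proof (rule positive_within[of 0 T "{0..T}" "\<lambda>t. g t * (E t - k * g t * p t) - 2 * (p t)\<^sup>2"
        "\<lambda>t. p t * (E t - k * g t * p t) + g t * (- k * g t * (E t - k * g t * p t) + (2 * k + 1) * (p t)\<^sup>2)
          - 4 * p t * (E t - k * g t * p t)" "2 * k"])
    fix t assume t: "t \<in> {0..T}"
    show "((\<lambda>t. g t * (E t - k * g t * p t) - 2 * (p t)\<^sup>2) has_real_derivative
      p t * (E t - k * g t * p t) + g t * (- k * g t * (E t - k * g t * p t) + (2 * k + 1) * (p t)\<^sup>2)
          - 4 * p t * (E t - k * g t * p t)) (at t within {0..T})"
      by (rule derivative_eq_intros D[OF t] Dq[OF t] refl)+ (simp add: algebra_simps)
  next
    fix t assume t: "0 < t" "t < T"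
    note ct = c[OF t]
    let ?q = "E t - k * g t * p t"
    let ?P = "g t * ?q - 2 * (p t)\<^sup>2"
    have "p t * ?q + g t * (- k * g t * ?q + (2 * k + 1) * (p t)\<^sup>2) - 4 * p t * ?q
        = - (k * g t) * ?P + g t * (p t)\<^sup>2 + 3 * (- p t) * ?q"
      by (simp add: algebra_simps power2_eq_square)
    moreover have "g t * (p t)\<^sup>2 \<ge> 0" "3 * (- p t) * ?q \<ge> 0"
      using ct(1) mult_nonneg_nonneg[of "3 * (- p t)" ?q] ct(4,6) by auto
    ultimately have "p t * ?q + g t * (- k * g t * ?q + (2 * k + 1) * (p t)\<^sup>2) - 4 * p t * ?q \<ge> - (k * g t) * ?P"
      by linarith
    then show "p t * ?q + g t * (- k * g t * ?q + (2 * k + 1) * (p t)\<^sup>2) - 4 * p t * ?q \<ge> - (2 * k) * ?P"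
      by (rule weaken_rate) (use ct k in auto)
  qed (use T c0 in \<open>auto simp: core_region_iff\<close>)
  show ?thesis using g g2 r q by (simp add: core_region_iff)
qed

lemma node_region_step:
  assumes k: "k > 0" and s: "sol k (3 * k + 1) g p E {0..T}" and T: "T > 0"
    and C: "\<And>t. 0 \<le> t \<Longrightarrow> t < T \<Longrightarrow> (g t, p t, E t) \<in> node_region k"
  shows "(g T, p T, E T) \<in> node_region k"
proof -
  note D = solD[OF s] and Dq = acc_deriv[OF s]
  have "(g T, p T, E T) \<in> core_region k"
  proof (rule core_region_step[OF k s T])
    show "(g t, p t, E t) \<in> core_region k \<and> p t < 0" if "0 \<le> t" "t < T" for t
      using C[OF that] node_region_signs(1)[OF k C[OF that]] by (simp add: node_region_iff)
  qed
  moreover have "- (k / 2) * g T * p T - (E T - k * g T * p T) > 0"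
  proof (rule positive_within[of 0 T "{0..T}" "\<lambda>t. - (k / 2) * g t * p t - (E t - k * g t * p t)"
        "\<lambda>t. - (k / 2) * (p t * p t + g t * (E t - k * g t * p t)) -
          (- k * g t * (E t - k * g t * p t) + (2 * k + 1) * (p t)\<^sup>2)" k])
    fix t assume t: "t \<in> {0..T}"
    show "((\<lambda>t. - (k / 2) * g t * p t - (E t - k * g t * p t)) has_real_derivative
       - (k / 2) * (p t * p t + g t * (E t - k * g t * p t)) -
          (- k * g t * (E t - k * g t * p t) + (2 * k + 1) * (p t)\<^sup>2)) (at t within {0..T})"
      by (rule derivative_eq_intros D[OF t] Dq[OF t] refl)+ (simp add: algebra_simps)
  next
    fix t assume t: "0 < t" "t < T"
    have om: "(g t, p t, E t) \<in> node_region k" using C[of t] t by auto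
    then have co: "(g t, p t, E t) \<in> core_region k" by (simp add: node_region_iff)
    have ct: "0 < g t" "g t < 2" "p t < 0" "- p t < beta k * (g t)\<^sup>2"
      "0 < - (k / 2) * g t * p t - (E t - k * g t * p t)"
      using om node_region_signs[OF k om] core_region_slope_bound[OF k co] by (auto simp: node_region_iff core_region_iff)
    let ?q = "E t - k * g t * p t"
    let ?S = "- (k / 2) * g t * p t - ?q"
    \<comment> \<open>The origin of \<open>beta\<close>: the derivative of \<open>S\<close> is
      \<open>- (k / 2) g S\<close> plus \<open>(- p) (k^2 g^2 - (10 k + 4) (- p)) / 4\<close>, and
      this remainder is nonnegative when \<open>- p \<le> beta k * g^2\<close>.\<close>
    have "(10 * k + 4) * (- p t) \<le> (10 * k + 4) * (beta k * (g t)\<^sup>2)"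
      using ct k by (intro mult_left_mono) auto
    also have "\<dots> = k\<^sup>2 * (g t)\<^sup>2" using beta_mult[OF k] by (simp only: mult.assoc[symmetric])
    finally have "0 \<le> k\<^sup>2 * (g t)\<^sup>2 - (10 * k + 4) * (- p t)" by simp
    then have "0 \<le> (- p t) * (k\<^sup>2 * (g t)\<^sup>2 - (10 * k + 4) * (- p t)) / 4"
      using ct by (intro divide_nonneg_nonneg mult_nonneg_nonneg) auto
    moreover have "- (k / 2) * (p t * p t + g t * ?q) - (- k * g t * ?q + (2 * k + 1) * (p t)\<^sup>2)
       = - (k / 2 * g t) * ?S + (- p t) * (k\<^sup>2 * (g t)\<^sup>2 - (10 * k + 4) * (- p t)) / 4"
      by (simp add: field_simps power2_eq_square)
    ultimately have "- (k / 2) * (p t * p t + g t * ?q) - (- k * g t * ?q + (2 * k + 1) * (p t)\<^sup>2) \<ge> - (k / 2 * g t) * ?S"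
      by simp
    then show "- (k / 2) * (p t * p t + g t * ?q) - (- k * g t * ?q + (2 * k + 1) * (p t)\<^sup>2) \<ge> - k * ?S"
      by (rule weaken_rate) (use ct k in auto)
  qed (use T C[of 0] in \<open>auto simp: node_region_iff\<close>)
  ultimately show ?thesis by (simp add: node_region_iff)
qed

text \<open>Invariance is stated for the clipped flow and from any time \<open>t0\<close> on,
  because the shooting argument follows clipped orbits that may enter the region late.\<close>

lemma node_region_flow:
  assumes k: "k > 0" and X0: "flow k (3 * k + 1) (radius k) X0 t0 \<in> node_region k" and t: "0 \<le> t0" "t0 \<le> t"
  shows "flow k (3 * k + 1) (radius k) X0 t \<in> node_region k"
proof -
  let ?F = "flow k (3 * k + 1) (radius k) X0"
  note R = radius_nonneg[OF k]
  have "?F (t0 + s) \<in> node_region k" if "s \<ge> 0" for s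
  proof (rule stays_in_open[of "\<lambda>s. ?F (t0 + s)", OF _ open_node_region _ _ that])
    show c: "continuous_on {0..} (\<lambda>s. ?F (t0 + s))"
      by (rule continuous_on_compose2[OF flow_continuous[OF R]]) (use t in \<open>auto intro!: continuous_intros\<close>)
    show "?F (t0 + 0) \<in> node_region k" using X0 by simp
    fix T :: real assume T: "T > 0" "\<And>t. 0 \<le> t \<Longrightarrow> t < T \<Longrightarrow> ?F (t0 + t) \<in> node_region k"
    have "?F (t0 + T) \<in> cube (radius k)"
      by (rule cube_closure[OF c T(1)]) (use T(2) node_region_cube[OF k] in blast)
    then have b: "?F (t0 + t) \<in> cube (radius k)" if "t \<in> {0..T}" for t
      using T(2)[of t] node_region_cube[OF k] that by (cases "t = T") auto
    have "?F t \<in> cube (radius k)" if "t \<in> {t0..t0 + T}" for t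
      using b[of "t - t0"] that by simp
    then have "sol k (3*k+1) (\<lambda>t. fst (?F t)) (\<lambda>t. fst (snd (?F t))) (\<lambda>t. snd (snd (?F t))) {t0..t0 + T}"
      using t by (intro flow_sol[OF R]) auto
    from sol_affine[OF this, of 1 "{0..T}" t0]
    have "sol k (3*k+1) (\<lambda>t. fst (?F (t + t0))) (\<lambda>t. fst (snd (?F (t + t0)))) (\<lambda>t. snd (snd (?F (t + t0)))) {0..T}"
      by simp
    from node_region_step[OF k this T(1)] T(2) show "?F (t0 + T) \<in> node_region k"
      by (simp add: add.commute)
  qed
  from this[of "t - t0"] t show ?thesis by simp
qed

lemma flow_energy_mono:
  assumes "R \<ge> 0" "b \<ge> 0" "0 \<le> s" "s \<le> t"
  shows "snd (snd (flow a b R X0 s)) \<le> snd (snd (flow a b R X0 t))"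
  by (rule nondecreasing_within[of s t "{0..}" _ "\<lambda>t. b * (clip R (fst (snd (flow a b R X0 t))) * clip R (fst (snd (flow a b R X0 t))))"])
    (use assms flow_components(3)[OF assms(1)] in auto)

section \<open>Limits of the orbits in the sector and on its boundary\<close>

lemma decreasing_bounded_below_limit:
  fixes g :: "real \<Rightarrow> real"
  assumes mono: "\<And>s t. s0 \<le> s \<Longrightarrow> s \<le> t \<Longrightarrow> g t \<le> g s" and bd: "\<And>t. t \<ge> s0 \<Longrightarrow> g t \<ge> c"
  obtains l where "(g \<longlongrightarrow> l) at_top" "l \<ge> c" "\<And>t. t \<ge> s0 \<Longrightarrow> l \<le> g t"
proof -
  define l where "l = Inf (g ` {s0..})"
  have bb: "bdd_below (g ` {s0..})" using bd by (auto intro!: bdd_belowI[of _ c])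
  have lg: "l \<le> g t" if "t \<ge> s0" for t
    unfolding l_def by (rule cInf_lower[OF _ bb]) (use that in auto)
  have "(g \<longlongrightarrow> l) at_top"
  proof (rule order_tendstoI)
    fix a assume a: "a < l"
    show "\<forall>\<^sub>F t in at_top. a < g t"
      using eventually_ge_at_top[of s0] by eventually_elim (use lg a in force)
  next
    fix a assume "l < a"
    then obtain s where s: "s \<ge> s0" "g s < a"
      using cInf_lessD[of "g ` {s0..}" a] by (auto simp: l_def)
    show "\<forall>\<^sub>F t in at_top. g t < a"
      using eventually_ge_at_top[of s] by eventually_elim (use mono[OF s(1)] s(2) in force)
  qed
  moreover have "l \<ge> c" unfolding l_def by (rule cInf_greatest) (use bd in auto)
  ultimately show thesis using lg that by blast
qed

text \<open>The orbit starts on \<open>g = 1\<close>, \<open>u = - beta k / 2\<close> at a height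
  \<open>v\<close> within the node region and is trapped there. Once \<open>g\<close> is known to
  vanish at infinity, \<open>- beta k * g^2 < p < 0\<close> forces \<open>p\<close> to do the
  same.\<close>

lemma node_solution:
  assumes k: "k > 0" and v: "2 * (beta k / 2)\<^sup>2 < v" "v < k / 2 * (beta k / 2)"
  obtains g p E where "sol k (3 * k + 1) g p E {0..}" "g 0 = 1" "p 0 = - (beta k / 2)" "E 0 = v - k * (beta k / 2)"
    "\<And>t. t \<ge> 0 \<Longrightarrow> (g t, p t, E t) \<in> node_region k" "(g \<longlongrightarrow> 0) at_top" "(p \<longlongrightarrow> 0) at_top"
proof -
  define X0 where "X0 = (1::real, - (beta k / 2), v - k * (beta k / 2))"
  note b = beta_pos[OF k] and R = radius_nonneg[OF k]
  define F where "F = flow k (3 * k + 1) (radius k) X0"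
  have "X0 \<in> node_region k" using v b by (simp add: X0_def node_region_iff core_region_iff)
  then have om: "F t \<in> node_region k" if "t \<ge> 0" for t
    unfolding F_def using node_region_flow[OF k, of X0 0 t] that R by simp
  define g p E where "g = (\<lambda>t. fst (F t))" and "p = (\<lambda>t. fst (snd (F t)))" and "E = (\<lambda>t. snd (snd (F t)))"
  have s: "sol k (3 * k + 1) g p E {0..}"
    unfolding g_def p_def E_def F_def
    by (rule flow_sol[OF R]) (use om node_region_cube[OF k] in \<open>auto simp: F_def\<close>)
  have om': "(g t, p t, E t) \<in> node_region k" if "t \<ge> 0" for t
    using om[OF that] by (simp add: g_def p_def E_def)
  note D = solD[OF s]
  have f: "0 < g t" "g t < 2" "p t < 0" "E t < 0" "0 < E t - k * g t * p t" "E t < k / 2 * g t * p t"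
    "- p t < beta k * (g t)\<^sup>2" if "t \<ge> 0" for t
    using om'[OF that] node_region_signs[OF k om'[OF that]] core_region_acc_pos core_region_slope_bound[OF k]
    by (auto simp: node_region_iff core_region_iff)
  have gm: "g t \<le> g s" if "0 \<le> s" "s \<le> t" for s t
  proof -
    have "- g s \<le> - g t"
      by (rule nondecreasing_within[of s t "{0..}" _ "\<lambda>t. - p t"])
        (use that f(3) in \<open>auto intro!: derivative_eq_intros D simp: less_imp_le\<close>)
    then show ?thesis by simp
  qed
  obtain l where l: "(g \<longlongrightarrow> l) at_top" "l \<ge> 0" "\<And>t. t \<ge> 0 \<Longrightarrow> l \<le> g t"
    using decreasing_bounded_below_limit[of 0 g 0] gm f(1) by (metis less_imp_le)
  have "l = 0"
  proof (rule ccontr)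
    assume "l \<noteq> 0"
    then have lp: "l > 0" using l by simp
    \<comment> \<open>In the node region \<open>- E > (k / 2) g (- p)\<close>. This turns
      \<open>E' = (3 k + 1) p^2\<close> into \<open>E' \<le> C (- E) (- p / g)\<close>, so
      \<open>- E\<close> shrinks no faster than \<open>g ^ C\<close>.\<close>
    define C where "C = 2 * (3 * k + 1) / k"
    have C: "C > 0" using k by (simp add: C_def)
    \<comment> \<open>\<open>\<bar>E\<bar> g\<^sup>-\<^sup>C\<close> is nondecreasing, so a positive limit of \<open>g\<close> would keep \<open>p\<close> away from \<open>0\<close>.\<close>
    define W where "W t = - E t * exp (- C * ln (g t))" for t
    have W: "W 0 \<le> W t" if "t \<ge> 0" for t
    proof (rule nondecreasing_within[of 0 t "{0..}" W
          "\<lambda>t. (- ((3 * k + 1) * (p t)\<^sup>2) - E t * (- C * (p t / g t))) * exp (- C * ln (g t))"])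
      show "(W has_real_derivative (- ((3 * k + 1) * (p t)\<^sup>2) - E t * (- C * (p t / g t))) * exp (- C * ln (g t))) (at t within {0..})"
        if "t \<in> {0..u}" for t u
        unfolding W_def using D[of t] f(1)[of t] that by (auto intro!: derivative_eq_intros simp: algebra_simps)
    next
      fix t :: real assume t: "0 < t"
      then have ft: "0 < g t" "p t < 0" "E t < k / 2 * g t * p t" using f[of t] by auto
      have "(3 * k + 1) * (p t)\<^sup>2 = (C * (- p t) / g t) * (k / 2 * g t * (- p t))"
        using ft k by (simp add: C_def field_simps power2_eq_square)
      also have "\<dots> \<le> (C * (- p t) / g t) * (- E t)"
        using ft C by (intro mult_left_mono divide_nonneg_nonneg mult_nonneg_nonneg) auto
      finally have "(- ((3 * k + 1) * (p t)\<^sup>2) - E t * (- C * (p t / g t))) \<ge> 0"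
        by (simp add: algebra_simps)
      then show "(- ((3 * k + 1) * (p t)\<^sup>2) - E t * (- C * (p t / g t))) * exp (- C * ln (g t)) \<ge> 0"
        by simp
    qed (use that in auto)
    define c where "c = W 0 * exp (C * ln l)"
    have W0: "W 0 > 0" using f(4)[of 0] by (simp add: W_def mult_neg_pos)
    then have c: "c > 0" by (simp add: c_def)
    have El: "- E t \<ge> c" if "t \<ge> 0" for t
    proof -
      have "exp (C * ln l) \<le> exp (C * ln (g t))"
        using l(3)[OF that] lp C by simp
      then have "W 0 * exp (C * ln l) \<le> W t * exp (C * ln (g t))"
        using W[OF that] W0 by (intro mult_mono) auto
      also have "\<dots> = - E t" by (simp add: W_def exp_minus)
      finally show ?thesis by (simp add: c_def)
    qed
    have "p t \<le> - (c / (2 * k))" if "t \<ge> 0" for t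
    proof -
      have "c < k * g t * (- p t)" using f(5)[OF that] El[OF that] by simp
      also have "\<dots> \<le> k * 2 * (- p t)" using f[OF that] k by (intro mult_right_mono mult_left_mono) auto
      finally show ?thesis using k by (simp add: field_simps)
    qed
    then obtain t where "t \<ge> 0" "g t < 0"
      using negative_slope_unbounded_below[of 0 g p "{0..}" "c / (2 * k)" 0] D(1) c k by auto
    then show False using f(1)[of t] by simp
  qed
  then have g0: "(g \<longlongrightarrow> 0) at_top" using l by simp
  have "(p \<longlongrightarrow> 0) at_top"
  proof (rule tendsto_sandwich)
    show "\<forall>\<^sub>F t in at_top. - (beta k * (g t)\<^sup>2) \<le> p t"
      using eventually_ge_at_top[of 0] by eventually_elim (use f(7) in force)
    show "\<forall>\<^sub>F t in at_top. p t \<le> 0"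
      using eventually_ge_at_top[of 0] by eventually_elim (use f(3) in force)
    show "((\<lambda>t. - (beta k * (g t)\<^sup>2)) \<longlongrightarrow> 0) at_top"
      using g0 by (auto intro!: tendsto_eq_intros)
  qed auto
  moreover have "g 0 = 1" "p 0 = - (beta k / 2)" "E 0 = v - k * (beta k / 2)"
    using R by (auto simp: g_def p_def E_def F_def X0_def)
  ultimately show thesis using that[OF s] om' g0 by blast
qed


text \<open>
  Start on \<open>g = 1\<close>, \<open>p = - \<beta> / 2\<close> and vary \<open>v\<close>. The orbits that reach \<open>E > 0\<close> and those that reach the
  node region form disjoint nonempty open sets, so some orbit does neither; it satisfies
  \<open>v \<ge> - (k / 2) u\<close> forever, which keeps \<open>g\<close> away from \<open>0\<close>.
\<close>

lemma separatrix_solution: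
  assumes k: "k > 0"
  obtains g p E l where "sol k (3 * k + 1) g p E {0..}" "g 0 = 1" "p 0 = - (beta k / 2)" "E 0 < 0"
    "0 < E 0 + k * (beta k / 2)"
    "\<And>t. t \<ge> 0 \<Longrightarrow> (g t, p t, E t) \<in> core_region k \<and> p t < 0 \<and> E t \<le> 0 \<and> - (k / 2) * g t * p t \<le> E t - k * g t * p t"
    "l > 0" "(g \<longlongrightarrow> l) at_top" "(p \<longlongrightarrow> 0) at_top"
proof -
  define d where "d = beta k / 2"
  note b = beta_pos[OF k] and R = radius_nonneg[OF k]
  have d: "d > 0" "20 * d < k" using b beta_small[OF k] by (auto simp: d_def)
  define X0 where "X0 v = (1::real, - d, v - k * d)" for v
  define F where "F v = flow k (3 * k + 1) (radius k) (X0 v)" for v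
  define g p E where "g v = (\<lambda>t. fst (F v t))" and "p v = (\<lambda>t. fst (snd (F v t)))"
    and "E v = (\<lambda>t. snd (snd (F v t)))" for v
  define A where "A = {v. \<exists>t\<ge>0. 0 < E v t}"
  define B where "B = {v. \<exists>t\<ge>0. F v t \<in> node_region k}"
  have contv: "continuous_on UNIV (\<lambda>v. F v t)" if "t \<ge> 0" for t
    unfolding F_def
    by (rule continuous_on_compose2[OF flow_continuous_initial[OF R that]])
      (auto simp: X0_def intro!: continuous_intros)
  have "open A"
  proof -
    have "A = (\<Union>t\<in>{0..}. {v. 0 < E v t})" by (auto simp: A_def)
    moreover have "open {v. 0 < E v t}" if "t \<ge> 0" for t
      unfolding E_def by (intro open_Collect_less continuous_intros contv that)
    ultimately show ?thesis by auto
  qed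
  moreover have "open B"
  proof -
    have "B = (\<Union>t\<in>{0..}. (\<lambda>v. F v t) -` node_region k)" by (auto simp: B_def)
    moreover have "open ((\<lambda>v. F v t) -` node_region k)" if "t \<ge> 0" for t
      by (rule open_vimage[OF open_node_region contv[OF that]])
    ultimately show ?thesis by auto
  qed
  moreover have "A \<inter> B = {}"
  proof (rule ccontr)
    assume "A \<inter> B \<noteq> {}"
    then obtain v s t where st: "s \<ge> 0" "0 < E v s" "t \<ge> 0" "F v t \<in> node_region k"
      by (auto simp: A_def B_def)
    define r where "r = max s t"
    have "F v r \<in> node_region k"
      unfolding F_def by (rule node_region_flow[OF k, of _ t]) (use st in \<open>auto simp: r_def F_def\<close>)
    then have "(g v r, p v r, E v r) \<in> node_region k" by (simp add: g_def p_def E_def)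
    then have "E v r < 0" using node_region_signs(2)[OF k] by blast
    moreover have "E v s \<le> E v r"
      unfolding E_def F_def by (rule flow_energy_mono[OF R]) (use k st in \<open>auto simp: r_def\<close>)
    ultimately show False using st by simp
  qed
  \<comment> \<open>The lower endpoint starts in the node region:
    \<open>2 d^2 < 3 d^2 < (k / 2) d\<close>, because \<open>20 d < k\<close>.\<close>
  moreover have "3 * d\<^sup>2 \<in> B"
  proof -
    have "X0 (3 * d\<^sup>2) \<in> node_region k"
      using d mult_strict_right_mono[OF d(2) d(1)]
      by (simp add: X0_def node_region_iff core_region_iff d_def[symmetric] power2_eq_square) (simp add: d_def)
    then show ?thesis using R by (auto simp: B_def F_def intro!: exI[of _ 0])
  qed
  \<comment> \<open>At the upper endpoint \<open>E\<close> starts at 0 with slope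
    \<open>(3 k + 1) d^2 > 0\<close>.\<close>
  moreover have "k * d \<in> A"
  proof -
    have "(E (k * d) has_real_derivative (3 * k + 1) * (clip (radius k) (- d) * clip (radius k) (- d))) (at 0 within {0..})"
      using flow_components(3)[OF R order_refl, of k "3 * k + 1" "X0 (k * d)"] R
      by (simp add: E_def F_def X0_def)
    moreover have "clip (radius k) (- d) = - d"
      using b k by (intro clip_id) (simp add: radius_def d_def)
    ultimately have "(E (k * d) has_real_derivative (3 * k + 1) * (d * d)) (at 0 within {0..})"
      by simp
    moreover have "(3 * k + 1) * (d * d) > 0" using k d by simp
    ultimately obtain e where e: "e > 0" "\<And>h. h > 0 \<Longrightarrow> 0 + h \<in> {0..} \<Longrightarrow> h < e \<Longrightarrow> E (k * d) 0 < E (k * d) (0 + h)"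
      using has_real_derivative_pos_inc_right by blast
    have "E (k * d) 0 = 0" using R by (simp add: E_def F_def X0_def)
    then have "0 < E (k * d) (e / 2)" using e(2)[of "e / 2"] e(1) by simp
    then show ?thesis using e(1) by (auto simp: A_def intro!: exI[of _ "e / 2"])
  qed
  moreover have "3 * d\<^sup>2 \<le> k * d"
    using mult_strict_right_mono[OF d(2) d(1)] d by (simp add: power2_eq_square)
  ultimately have "\<not> {3 * d\<^sup>2..k * d} \<subseteq> A \<union> B"
    using connectedD[OF connected_Icc[of "3 * d\<^sup>2" "k * d"], of A B] by fastforce
  then obtain v where "v \<in> {3 * d\<^sup>2..k * d}" and nA: "v \<notin> A" and nB: "v \<notin> B" by blast
  then have v: "3 * d\<^sup>2 \<le> v" "v \<le> k * d" by auto
  have E0: "E v t \<le> 0" if "t \<ge> 0" for t using nA that by (auto simp: A_def not_less)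
  have init: "g v 0 = 1" "p v 0 = - d" "E v 0 = v - k * d"
    using R by (auto simp: g_def p_def E_def F_def X0_def)
  have dd: "d * d > 0" using d by simp
  note Fc = flow_continuous[OF R, of k "3 * k + 1" "X0 v", folded F_def]
  let ?U = "core_region k \<inter> {x. fst (snd x) < 0}"
  have "F v t \<in> ?U" if "t \<ge> 0" for t
  proof (rule stays_in_open[OF Fc _ _ _ that])
    have "open {x::real\<times>real\<times>real. fst (snd x) < 0}"
      by (intro open_Collect_less continuous_intros)
    then show "open ?U" using open_core_region by blast
    have "2 * d\<^sup>2 < v" using v(1) dd by (simp add: power2_eq_square)
    then show "F v 0 \<in> ?U"
      using d v R by (simp add: F_def X0_def core_region_iff) (simp add: d_def)
    fix T :: real assume T: "T > 0" "\<And>t. 0 \<le> t \<Longrightarrow> t < T \<Longrightarrow> F v t \<in> ?U"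
    have C: "(g v t, p v t, E v t) \<in> core_region k \<and> p v t < 0" if "0 \<le> t" "t < T" for t
      using T(2)[OF that] by (simp add: g_def p_def E_def)
    have bx: "F v t \<in> cube (radius k)" if "0 \<le> t" "t < T" for t
      using core_region_cube[OF k, of "g v t" "p v t" "E v t"] C[OF that] E0[of t] that
      by (simp add: g_def p_def E_def)
    have "F v T \<in> cube (radius k)" by (rule cube_closure[OF Fc T(1) bx])
    then have "F v t \<in> cube (radius k)" if "t \<in> {0..T}" for t
      using bx[of t] that by (cases "t = T") auto
    then have s: "sol k (3 * k + 1) (g v) (p v) (E v) {0..T}"
      unfolding g_def p_def E_def F_def by (intro flow_sol[OF R]) auto
    have "(g v T, p v T, E v T) \<in> core_region k" by (rule core_region_step[OF k s T(1) C])
    \<comment> \<open>Outside \<open>A\<close> one has \<open>E \<le> 0\<close>, hence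
      \<open>(- p)' = - E - k g (- p) \<ge> - k g (- p)\<close>, and \<open>p\<close> cannot reach
      0.\<close>
    moreover have "- p v T > 0"
    proof (rule positive_within[of 0 T "{0..T}" "\<lambda>t. - p v t" "\<lambda>t. - (E v t - k * g v t * p v t)" "2 * k"])
      fix t assume t: "0 < t" "t < T"
      have "- (E v t - k * g v t * p v t) \<ge> - (k * g v t) * - p v t" using E0[of t] t by simp
      then show "- (E v t - k * g v t * p v t) \<ge> - (2 * k) * - p v t"
        by (rule weaken_rate) (use C[of t] t k in \<open>auto simp: core_region_iff\<close>)
    next
      show "((\<lambda>t. - p v t) has_real_derivative - (E v t - k * g v t * p v t)) (at t within {0..T})"
        if "t \<in> {0..T}" for t
        by (rule DERIV_minus[OF solD(2)[OF s that]])
    qed (use T(1) init d in auto)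
    ultimately show "F v T \<in> ?U" by (simp add: g_def p_def E_def)
  qed
  then have C: "(g v t, p v t, E v t) \<in> core_region k" "p v t < 0" if "t \<ge> 0" for t
    using that by (auto simp: g_def p_def E_def)
  have s: "sol k (3 * k + 1) (g v) (p v) (E v) {0..}"
  proof -
    have "F v t \<in> cube (radius k)" if "t \<ge> 0" for t
      using core_region_cube[OF k C(1)[OF that] _ E0[OF that]] C(2)[OF that]
      by (simp add: g_def p_def E_def)
    then show ?thesis
      unfolding g_def p_def E_def F_def by (intro flow_sol[OF R]) auto
  qed
  note D = solD[OF s]
  have f: "0 < g v t" "g v t < 2" "0 < E v t - k * g v t * p v t" if "t \<ge> 0" for t
    using C(1)[OF that] core_region_acc_pos[OF C(1)[OF that]] by (auto simp: core_region_iff)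
  have qb: "- (k / 2) * g v t * p v t \<le> E v t - k * g v t * p v t" if "t \<ge> 0" for t
  proof -
    have "F v t \<notin> node_region k" using nB that by (auto simp: B_def)
    then have "(g v t, p v t, E v t) \<notin> node_region k" by (simp add: g_def p_def E_def)
    then have "\<not> 0 < - (k / 2) * g v t * p v t - (E v t - k * g v t * p v t)"
      unfolding node_region_iff using C(1)[OF that] by blast
    then show ?thesis by linarith
  qed
  have gm: "g v t \<le> g v s" if "0 \<le> s" "s \<le> t" for s t
  proof -
    have "- g v s \<le> - g v t"
      by (rule nondecreasing_within[of s t "{0..}" _ "\<lambda>t. - p v t"])
        (use that C(2) in \<open>auto intro!: derivative_eq_intros D simp: less_imp_le\<close>)
    then show ?thesis by simp
  qed
  have pm: "- p v t \<le> - p v s" if "0 \<le> s" "s \<le> t" for s t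
  proof -
    have "p v s \<le> p v t"
      by (rule nondecreasing_within[of s t "{0..}" _ "\<lambda>t. E v t - k * g v t * p v t"])
        (use that f(3) in \<open>auto intro!: D simp: less_imp_le\<close>)
    then show ?thesis by simp
  qed
  \<comment> \<open>\<open>c\<close> is the initial value of \<open>p + (k / 4) g^2\<close>, whose
    derivative \<open>g'' + (k / 2) g p\<close> is nonnegative because the orbit avoids the node
    region. With \<open>p < 0\<close> this keeps \<open>(k / 4) g^2\<close> above
    \<open>c\<close>.\<close>
  define c where "c = k / 4 - d"
  have c: "c > 0" using d by (simp add: c_def)
  have gl: "g v t \<ge> min 1 (4 * c / k)" if "t \<ge> 0" for t
  proof -
    have "p v 0 + k / 4 * (g v 0)\<^sup>2 \<le> p v t + k / 4 * (g v t)\<^sup>2"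
    proof (rule nondecreasing_within[of 0 t "{0..}" _ "\<lambda>t. (E v t - k * g v t * p v t) + k / 2 * g v t * p v t"])
      show "((\<lambda>t. p v t + k / 4 * (g v t)\<^sup>2) has_real_derivative (E v u - k * g v u * p v u) + k / 2 * g v u * p v u) (at u within {0..})"
        if "u \<in> {0..t}" for u
        using D[of u] that by (auto intro!: derivative_eq_intros simp: field_simps)
      show "0 \<le> (E v u - k * g v u * p v u) + k / 2 * g v u * p v u" if "0 < u" for u
        using qb[of u] that by simp
    qed (use that in auto)
    then have "c \<le> k / 4 * (g v t)\<^sup>2" using C(2)[OF that] init by (simp add: c_def)
    also have "\<dots> \<le> k / 4 * g v t"
      using k f(1)[OF that] gm[of 0 t] that init
      by (intro mult_left_mono) (auto simp: power2_eq_square mult_left_le_one_le)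
    finally have "4 * c / k \<le> g v t" using k by (simp add: field_simps)
    then show ?thesis by simp
  qed
  obtain l where l: "(g v \<longlongrightarrow> l) at_top" "l \<ge> min 1 (4 * c / k)"
    using decreasing_bounded_below_limit[of 0 "g v" "min 1 (4 * c / k)"] gm gl by metis
  have "0 < min 1 (4 * c / k)" using c k by simp
  then have lp: "l > 0" using l(2) by linarith
  obtain r where r: "((\<lambda>t. - p v t) \<longlongrightarrow> r) at_top" "r \<ge> 0" "\<And>t. t \<ge> 0 \<Longrightarrow> r \<le> - p v t"
    using decreasing_bounded_below_limit[of 0 "\<lambda>t. - p v t" 0] pm C(2) by (metis less_imp_le neg_0_le_iff_le)
  have "r = 0"
  proof (rule ccontr)
    assume "r \<noteq> 0"
    then have "r > 0" using r by simp
    then obtain t where "t \<ge> 0" "g v t < 0"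
      using negative_slope_unbounded_below[of 0 "g v" "p v" "{0..}" r 0] D(1) r(3) by force
    then show False using f(1)[of t] by simp
  qed
  then have p0: "(p v \<longlongrightarrow> 0) at_top" using tendsto_minus[OF r(1)] by simp
  \<comment> \<open>The backward continuation starts from a strict \<open>E 0 < 0\<close>; it holds
    because \<open>E\<close> increases strictly and is still nonpositive at time 1.\<close>
  have Estrict: "E v 0 < E v 1"
  proof (rule increasing_within[of 0 1 "{0..}" _ "\<lambda>t. (3 * k + 1) * (p v t)\<^sup>2"])
    show "0 < (3 * k + 1) * (p v t)\<^sup>2" if "0 < t" for t
      using C(2)[of t] that k by (intro mult_pos_pos) auto
  qed (auto intro!: D)
  show thesis
  proof (rule that[OF s])
    show "E v 0 < 0" using Estrict E0[of 1] by simp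
    show "0 < E v 0 + k * (beta k / 2)" using f(3)[of 0] init by (simp add: d_def)
    show "g v 0 = 1" "p v 0 = - (beta k / 2)" using init by (auto simp: d_def)
    show "(g v t, p v t, E v t) \<in> core_region k \<and> p v t < 0 \<and> E v t \<le> 0 \<and>
        - (k / 2) * g v t * p v t \<le> E v t - k * g v t * p v t" if "t \<ge> 0" for t
      using C[OF that] E0[OF that] qb[OF that] by blast
  qed (fact lp l(1) p0)+
qed

section \<open>Continuation backwards in time\<close>

lemma nonneg_at_end:
  fixes y :: "real \<Rightarrow> real"
  assumes "continuous_on {0..T} y" "T > 0" "\<And>t. 0 \<le> t \<Longrightarrow> t < T \<Longrightarrow> y t \<ge> 0"
  shows "y T \<ge> 0"
proof -
  have "y ` closure {0..<T} \<subseteq> {0..}"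
    by (rule image_closure_subset) (use assms in auto)
  then show ?thesis using assms(2) by (auto simp: image_subset_iff)
qed

text \<open>In reversed time \<open>h\<close>, \<open>y\<close>, \<open>e\<close> stand for
  \<open>g\<close>, \<open>- p\<close>, \<open>E\<close>, so \<open>e + k h y\<close> is
  \<open>g''\<close>.\<close>

lemma backward_acc_deriv:
  assumes "sol (- k) (- (3 * k + 1)) h y e S" "t \<in> S"
  shows "((\<lambda>t. e t + k * h t * y t) has_real_derivative
     k * h t * (e t + k * h t * y t) - (2 * k + 1) * (y t)\<^sup>2) (at t within S)"
  by (rule derivative_eq_intros solD[OF assms] refl)+ (simp add: algebra_simps power2_eq_square)

lemma backward_energy_deriv:
  assumes "sol (- k) (- (3 * k + 1)) h y e S" "t \<in> S"
  shows "((\<lambda>t. - e t) has_real_derivative (3 * k + 1) * (y t)\<^sup>2) (at t within S)"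
  using DERIV_minus[OF solD(3)[OF assms]] by (simp only: minus_mult_left minus_minus)

section \<open>Backwards to the inflection point\<close>

text \<open>A priori bounds while \<open>g''\<close> stays positive. Since \<open>y \<ge> d\<close>,
  \<open>h\<close> grows at least linearly, yet it is capped independently of \<open>T\<close>, so
  this phase must end; the caps leave \<open>g'' = 0\<close> as the only way out.\<close>

lemma backward_inflection_bounds:
  assumes k: "k > 0" and d: "0 < d" "d \<le> k / 2" and e0: "e0 < 0"
    and s: "sol (- k) (- (3 * k + 1)) h y e {0..T}" and T: "T > 0"
    and i: "h 0 = 1" "y 0 = d" "e 0 = e0"
    and C: "\<And>t. 0 \<le> t \<Longrightarrow> t < T \<Longrightarrow> 0 < h t \<and> 0 < y t \<and> 0 < e t + k * h t * y t"
  shows "y T \<ge> d" "h T \<ge> 1 + d * T" "e T \<le> e0" "y T \<le> k / 2 * (h T)\<^sup>2" "h T \<le> exp (k ^ 3 / (2 * - e0))"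
    "- e T \<le> k * h T * y T"
proof -
  note D = solD[OF s]
  have yd: "d \<le> y t" if "0 \<le> t" "t \<le> T" for t
    unfolding i(2)[symmetric]
  proof (rule nondecreasing_within[of 0 t "{0..T}" y "\<lambda>t. e t + k * h t * y t"])
    show "(y has_real_derivative e u + k * h u * y u) (at u within {0..T})" if "u \<in> {0..t}" for u
      using D(2)[of u] that \<open>t \<le> T\<close> by simp
  qed (use that C in \<open>auto intro: less_imp_le\<close>)
  then show "y T \<ge> d" using T by (simp add: less_imp_le)
  have hd: "1 + d * t \<le> h t" if "0 \<le> t" "t \<le> T" for t
  proof -
    have "h 0 - d * 0 \<le> h t - d * t"
      by (rule nondecreasing_within[of 0 t "{0..T}" "\<lambda>t. h t - d * t" "\<lambda>t. y t - d"])
        (use that yd in \<open>auto intro!: derivative_eq_intros D\<close>)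
    then show ?thesis using i by simp
  qed
  then show "h T \<ge> 1 + d * T" using T by (simp add: less_imp_le)
  have h1: "1 \<le> h t" if "0 \<le> t" "t \<le> T" for t
    using hd[OF that] mult_nonneg_nonneg[of d t] that d by linarith
  have ed: "e t \<le> e0" if "0 \<le> t" "t \<le> T" for t
  proof -
    have "- e 0 \<le> - e t"
    proof (rule nondecreasing_within[of 0 t "{0..T}" _ "\<lambda>t. (3 * k + 1) * (y t)\<^sup>2"])
      show "((\<lambda>t. - e t) has_real_derivative (3 * k + 1) * (y u)\<^sup>2) (at u within {0..T})" if "u \<in> {0..t}" for u
        by (rule backward_energy_deriv[OF s]) (use that \<open>t \<le> T\<close> in auto)
    qed (use that k in auto)
    then show ?thesis using i by simp
  qed
  then show "e T \<le> e0" using T by (simp add: less_imp_le)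
  \<comment> \<open>\<open>(k / 2) h^2 - y\<close> has the derivative \<open>- e\<close>, positive
    here, and starts nonnegative because \<open>d \<le> k / 2\<close>.\<close>
  have yU: "y t \<le> k / 2 * (h t)\<^sup>2" if t: "0 \<le> t" "t \<le> T" for t
  proof -
    have "k / 2 * (h 0)\<^sup>2 - y 0 \<le> k / 2 * (h t)\<^sup>2 - y t"
    proof (rule nondecreasing_within[of 0 t "{0..T}" _ "\<lambda>t. - e t"])
      show "((\<lambda>t. k / 2 * (h t)\<^sup>2 - y t) has_real_derivative - e u) (at u within {0..T})" if "u \<in> {0..t}" for u
        using D[of u] that t by (auto intro!: derivative_eq_intros simp: algebra_simps)
      show "0 \<le> - e u" if "0 < u" "u < t" for u using ed[of u] e0 that t by simp
    qed (use t in auto)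
    then show ?thesis using i d by simp
  qed
  then show "y T \<le> k / 2 * (h T)\<^sup>2" using T by (simp add: less_imp_le)
  have "0 \<le> e T + k * h T * y T"
    using C by (intro nonneg_at_end[OF _ T, where y = "\<lambda>t. e t + k * h t * y t"])
      (auto intro!: continuous_intros sol_continuous[OF s] less_imp_le)
  then show eT: "- e T \<le> k * h T * y T" by simp
  \<comment> \<open>\<open>e / h\<^sup>3 + (c / k) ln h\<close> with \<open>c = - e0\<close> is nonincreasing, which bounds \<open>h\<close>.\<close>
  define Z' where "Z' t = - (y t * (y t * h t + 3 * (e t + k * h t * y t))) / (h t) ^ 4" for t
  have DZ: "((\<lambda>t. e t / (h t) ^ 3) has_real_derivative Z' t) (at t within {0..T})" if t: "t \<in> {0..T}" for t
  proof -
    have "h t > 0" using h1[of t] t by simp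
    then have "((\<lambda>t. e t / (h t) ^ 3) has_real_derivative
        ((- (3 * k + 1) * (y t)\<^sup>2) * (h t) ^ 3 - e t * (3 * (h t)\<^sup>2 * y t)) / ((h t) ^ 3 * (h t) ^ 3)) (at t within {0..T})"
      using D[OF t] by (auto intro!: derivative_eq_intros)
    moreover have "((- (3 * k + 1) * (y t)\<^sup>2) * (h t) ^ 3 - e t * (3 * (h t)\<^sup>2 * y t)) / ((h t) ^ 3 * (h t) ^ 3) = Z' t"
      using \<open>h t > 0\<close> by (simp add: Z'_def divide_simps) (simp add: algebra_simps power_numeral_reduce)
    ultimately show ?thesis by simp
  qed
  have Zd: "e t / (h t) ^ 3 \<le> e0" if t: "0 \<le> t" "t \<le> T" for t
  proof -
    have "- (e 0 / (h 0) ^ 3) \<le> - (e t / (h t) ^ 3)"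
    proof (rule nondecreasing_within[of 0 t "{0..T}" _ "\<lambda>t. - Z' t"])
      show "0 \<le> - Z' u" if "0 < u" "u < t" for u
        using C[of u] that t by (auto simp: Z'_def intro!: divide_nonneg_nonneg mult_nonneg_nonneg add_nonneg_nonneg less_imp_le)
    qed (use t DZ in \<open>auto intro!: DERIV_minus\<close>)
    then show ?thesis using i by simp
  qed
  define c where "c = - e0"
  have c: "c > 0" using e0 by (simp add: c_def)
  have yl: "c / k \<le> y t / (h t)\<^sup>2" if t: "0 < t" "t < T" for t
  proof -
    have h: "h t > 0" using C[of t] t by simp
    then have "e t \<le> - c * (h t) ^ 3" using Zd[of t] t by (simp add: c_def divide_le_eq)
    then have "c * (h t) ^ 3 \<le> k * h t * y t" using C[of t] t by simp
    then have "h t * (c * (h t)\<^sup>2) \<le> h t * (k * y t)" by (simp add: algebra_simps power2_eq_square power3_eq_cube)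
    then have "c * (h t)\<^sup>2 \<le> k * y t" using h by (simp only: mult_le_cancel_left_pos)
    then show ?thesis using h k by (simp add: field_simps)
  qed
  have "- (e 0 / (h 0) ^ 3) - c / k * ln (h 0) \<le> - (e T / (h T) ^ 3) - c / k * ln (h T)"
  proof (rule nondecreasing_within[of 0 T "{0..T}" _ "\<lambda>t. - Z' t - c / k * (y t / h t)"])
    show "((\<lambda>t. - (e t / (h t) ^ 3) - c / k * ln (h t)) has_real_derivative - Z' t - c / k * (y t / h t)) (at t within {0..T})"
      if t: "t \<in> {0..T}" for t
    proof -
      have "((\<lambda>t. ln (h t)) has_real_derivative y t / h t) (at t within {0..T})"
        using D(1)[OF t] h1[of t] t by (auto intro!: derivative_eq_intros)
      then show ?thesis by (intro DERIV_diff DERIV_minus DERIV_cmult DZ t)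
    qed
    show "0 \<le> - Z' t - c / k * (y t / h t)" if t: "0 < t" "t < T" for t
    proof -
      have p: "h t > 0" "y t > 0" "0 < e t + k * h t * y t" using C[of t] t by auto
      have "c / k * (y t / h t) \<le> y t / (h t)\<^sup>2 * (y t / h t)"
        using yl[OF t] p by (intro mult_right_mono) auto
      also have "\<dots> = (y t * (y t * h t)) / (h t) ^ 4"
        using p by (simp add: divide_simps) (simp add: power2_eq_square power4_eq_xxxx)
      also have "\<dots> \<le> - Z' t"
        using p by (auto simp: Z'_def intro!: divide_right_mono mult_left_mono)
      finally show ?thesis by simp
    qed
  qed (use T in auto)
  then have "c + c / k * ln (h T) \<le> - e T / (h T) ^ 3" using i by (simp add: c_def)
  also have hT: "h T > 0" using h1[of T] T by simp
  \<comment> \<open>From \<open>g'' \<ge> 0\<close> comes \<open>- e \<le> k h y\<close>, and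
    \<open>y \<le> (k / 2) h^2\<close> then caps \<open>- e / h^3\<close> by \<open>k^2 / 2\<close>.
    The left-hand side contains \<open>ln h\<close>, which is thereby bounded.\<close>
  have "- e T / (h T) ^ 3 \<le> k * h T * (k / 2 * (h T)\<^sup>2) / (h T) ^ 3"
    using eT yU[of T] T k hT by (intro divide_right_mono order_trans[OF eT] mult_left_mono) auto
  also have "\<dots> = k\<^sup>2 / 2" using hT by (simp add: power2_eq_square power3_eq_cube)
  finally have "c / k * ln (h T) \<le> k\<^sup>2 / 2" using c by simp
  then have "ln (h T) \<le> k ^ 3 / (2 * c)"
    using c k by (simp add: field_simps power2_eq_square power3_eq_cube)
  then show "h T \<le> exp (k ^ 3 / (2 * - e0))"
    using hT exp_ln[OF hT] exp_le_cancel_iff[of "ln (h T)"] by (simp add: c_def)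
qed

lemma backward_to_inflection:
  assumes k: "k > 0" and d: "0 < d" "d \<le> k / 2" and e0: "e0 < 0" "0 < e0 + k * d"
  obtains h y e T where "T > 0" "sol (- k) (- (3 * k + 1)) h y e {0..T}" "h 0 = 1" "y 0 = d" "e 0 = e0"
    "\<And>t. 0 \<le> t \<Longrightarrow> t < T \<Longrightarrow> 0 < e t + k * h t * y t" "e T + k * h T * y T = 0"
    "\<And>t. 0 \<le> t \<Longrightarrow> t \<le> T \<Longrightarrow> 0 < h t \<and> 0 < y t"
proof -
  define H where "H = exp (k ^ 3 / (2 * - e0))"
  have H: "H > 0" by (simp add: H_def)
  \<comment> \<open>The walls \<open>H + 1\<close>, \<open>Y\<close> and \<open>e = 0\<close> lie
    strictly beyond the a priori bounds, so the orbit can leave \<open>U\<close> only through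
    \<open>e + k h y = 0\<close>.\<close>
  define Y where "Y = k / 2 * (H + 1)\<^sup>2 + d"
  have Y: "Y > 0" using k d by (simp add: Y_def add_nonneg_pos)
  define L where "L = k * (H + 1) * Y"
  have L: "L > 0" using k H Y by (simp add: L_def)
  define U where "U = {x::real\<times>real\<times>real. 0 < fst x \<and> fst x < H + 1 \<and> 0 < fst (snd x) \<and> fst (snd x) < Y \<and>
      snd (snd x) < 0 \<and> 0 < snd (snd x) + k * fst x * fst (snd x)}"
  have U_iff: "(h, y, e) \<in> U \<longleftrightarrow> 0 < h \<and> h < H + 1 \<and> 0 < y \<and> y < Y \<and> e < 0 \<and> 0 < e + k * h * y" for h y e
    by (simp add: U_def)
  have oU: "open U" unfolding U_def by (intro open_Collect_conj open_Collect_less continuous_intros)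
  have U0: "(1, d, e0) \<in> U" using d e0 H k by (simp add: U_iff Y_def)
  have bU: "U \<subseteq> cube (H + 1 + Y + L)"
  proof
    fix x assume x: "x \<in> U"
    obtain h y e where xe: "x = (h, y, e)" by (cases x)
    have b: "0 < h" "h < H + 1" "0 < y" "y < Y" "e < 0" "0 < e + k * h * y" using x by (auto simp: xe U_iff)
    then have "k * h * y \<le> L" unfolding L_def using k by (intro mult_mono mult_left_mono) auto
    then show "x \<in> cube (H + 1 + Y + L)" using b L Y H by (auto simp: xe cube_def)
  qed
  show thesis
  proof (rule sol_continuation[OF oU U0 bU, where a = "- k" and b = "- (3 * k + 1)"])
    fix h y e assume s: "sol (- k) (- (3 * k + 1)) h y e {0..}" and i: "h 0 = 1" "y 0 = d" "e 0 = e0"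
      and C: "\<And>t. 0 \<le> t \<Longrightarrow> (h t, y t, e t) \<in> U"
    \<comment> \<open>By this time the lower bound \<open>1 + d T\<close> for \<open>h\<close>
      exceeds the cap \<open>H\<close>.\<close>
    define T where "T = H / d"
    have T: "T > 0" using H d by (simp add: T_def)
    have "sol (- k) (- (3 * k + 1)) h y e {0..T}" by (rule sol_subset[OF s]) auto
    from backward_inflection_bounds(2,5)[OF k d e0(1) this T i] C
    have "1 + d * T \<le> H" by (force simp: U_iff H_def)
    then have False using d by (simp add: T_def)
    then show thesis ..
  next
    fix h y e T assume T: "T > 0" and s: "sol (- k) (- (3 * k + 1)) h y e {0..T}" and i: "h 0 = 1" "y 0 = d" "e 0 = e0"
      and C: "\<And>t. 0 \<le> t \<Longrightarrow> t < T \<Longrightarrow> (h t, y t, e t) \<in> U" and nT: "(h T, y T, e T) \<notin> U"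
    have C': "0 < h t \<and> 0 < y t \<and> 0 < e t + k * h t * y t" if "0 \<le> t" "t < T" for t
      using C[OF that] by (simp add: U_iff)
    note B = backward_inflection_bounds[OF k d e0(1) s T i C', folded H_def]
    have hT: "h T > 0" using B(2) mult_pos_pos[OF d(1) T] by linarith
    have "y T \<le> k / 2 * (h T)\<^sup>2" by (rule B(4))
    also have "\<dots> \<le> k / 2 * (H + 1)\<^sup>2" using k hT B(5) by (intro mult_left_mono power_mono) auto
    finally have "y T < Y" using d by (simp add: Y_def)
    then have "\<not> 0 < e T + k * h T * y T"
      using nT hT B d e0 by (auto simp: U_iff)
    then have qT: "e T + k * h T * y T = 0" using B(6) by linarith
    have "0 < h t \<and> 0 < y t" if "0 \<le> t" "t \<le> T" for t
      using C'[of t] that hT B(1) d by (cases "t = T") auto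
    then show thesis by (intro that[OF T s i _ qT]) (use C' in auto)
  qed
qed

text \<open>The inflection point lies on the boundary of the open region used for the descent. There
  \<open>g''\<close> has the reversed-time derivative \<open>- (2 k + 1) y0^2 < 0\<close>, so a
  short step leads inside.\<close>

lemma backward_small_step:
  assumes k: "k > 0" and h0: "h0 > 0" and y0: "y0 > 0" and q0: "e0 + k * h0 * y0 = 0"
  obtains h y e T where "T > 0" "sol (- k) (- (3 * k + 1)) h y e {0..T}" "h 0 = h0" "y 0 = y0" "e 0 = e0"
    "\<And>t. 0 < t \<Longrightarrow> t \<le> T \<Longrightarrow> e t + k * h t * y t < 0"
    "\<And>t. 0 \<le> t \<Longrightarrow> t \<le> T \<Longrightarrow> 0 < h t \<and> 0 < y t"
proof -
  define U where "U = {x::real\<times>real\<times>real. 0 < fst x \<and> fst x < h0 + 1 \<and> 0 < fst (snd x) \<and> fst (snd x) < y0 + 1 \<and>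
      e0 - 1 < snd (snd x) \<and> snd (snd x) < e0 + 1}"
  have U_iff: "(h, y, e) \<in> U \<longleftrightarrow> 0 < h \<and> h < h0 + 1 \<and> 0 < y \<and> y < y0 + 1 \<and> e0 - 1 < e \<and> e < e0 + 1" for h y e
    by (simp add: U_def)
  have oU: "open U" unfolding U_def by (intro open_Collect_conj open_Collect_less continuous_intros)
  have U0: "(h0, y0, e0) \<in> U" using h0 y0 by (simp add: U_iff)
  have bU: "U \<subseteq> cube (h0 + 1 + (y0 + 1) + \<bar>e0\<bar> + 1)"
    using h0 y0 by (auto simp: U_def cube_def)
  obtain h y e T1 where s: "sol (- k) (- (3 * k + 1)) h y e {0..T1}" and i: "h 0 = h0" "y 0 = y0" "e 0 = e0" and T1: "T1 > 0"
    and C: "\<And>t. 0 \<le> t \<Longrightarrow> t < T1 \<Longrightarrow> (h t, y t, e t) \<in> U"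
  proof (rule sol_continuation[OF oU U0 bU, where a = "- k" and b = "- (3 * k + 1)"])
    fix h y e assume s: "sol (- k) (- (3 * k + 1)) h y e {0..}" and i: "h 0 = h0" "y 0 = y0" "e 0 = e0"
      and C: "\<And>t. 0 \<le> t \<Longrightarrow> (h t, y t, e t) \<in> U"
    have "sol (- k) (- (3 * k + 1)) h y e {0..1}" by (rule sol_subset[OF s]) auto
    then show thesis using that[of h y e 1] i C by auto
  qed blast
  have "((\<lambda>t. e t + k * h t * y t) has_real_derivative - ((2 * k + 1) * y0\<^sup>2)) (at 0 within {0..T1})"
    using backward_acc_deriv[OF s, of 0] T1 q0 by (simp add: i)
  moreover have "- ((2 * k + 1) * y0\<^sup>2) < 0" using k y0 by simp
  ultimately obtain r where r: "r > 0" "\<And>t. t > 0 \<Longrightarrow> 0 + t \<in> {0..T1} \<Longrightarrow> t < r \<Longrightarrow>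
      e (0 + t) + k * h (0 + t) * y (0 + t) < e 0 + k * h 0 * y 0"
    using has_real_derivative_neg_dec_right by blast
  define T where "T = min (T1 / 2) (r / 2)"
  have T: "T > 0" "T < T1" "T < r" using r T1 by (auto simp: T_def)
  show thesis
  proof (rule that[OF T(1) sol_subset[OF s] i])
    show "e t + k * h t * y t < 0" if "0 < t" "t \<le> T" for t
      using r(2)[of t] that T q0 by (simp add: i)
    show "0 < h t \<and> 0 < y t" if "0 \<le> t" "t \<le> T" for t
      using C[of t] that T by (simp add: U_iff)
  qed (use T in auto)
qed

section \<open>Backwards from the inflection point to a prescribed \<open>u\<close>\<close>

text \<open>Past the inflection \<open>g''\<close> keeps decreasing in reversed time, so it stays
  below \<open>- c\<close> and \<open>h\<close> lies under the parabola
  \<open>h0 + \<bar>y0\<bar> t - c t^2 / 2\<close>. Positivity of \<open>h\<close> therefore limits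
  the time to \<open>B\<close>. The target is \<open>y = - u h^2\<close>, that is
  \<open>p / g^2 = u\<close>.\<close>

lemma backward_descent_bounds:
  assumes k: "k > 0" and h0: "h0 > 0" and u: "u > 0" and q0: "e0 + k * h0 * y0 = - c" "c > 0"
    and s: "sol (- k) (- (3 * k + 1)) h y e {0..T}" and T: "T > 0"
    and i: "h 0 = h0" "y 0 = y0" "e 0 = e0"
    and C: "\<And>t. 0 \<le> t \<Longrightarrow> t < T \<Longrightarrow> 0 < h t \<and> - u * (h t)\<^sup>2 < y t \<and> e t + k * h t * y t < 0"
  defines "B \<equiv> 1 + 2 * (h0 + \<bar>y0\<bar>) / c"
  defines "H \<equiv> h0 + \<bar>y0\<bar> * B"
  shows "e T + k * h T * y T \<le> - c" "y T \<le> \<bar>y0\<bar>" "T \<le> B" "h T \<le> H" "e T \<le> e0"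
    "e0 - (3 * k + 1) * (\<bar>y0\<bar> + u * H\<^sup>2)\<^sup>2 * B \<le> e T" "- u * (h T)\<^sup>2 \<le> y T" "h T > 0"
proof -
  note D = solD[OF s] and Dq = backward_acc_deriv[OF s]
  have q: "e t + k * h t * y t \<le> - c" if t: "t \<in> {0..T}" for t
  proof -
    have "- (e 0 + k * h 0 * y 0) \<le> - (e t + k * h t * y t)"
    proof (rule nondecreasing_within[of 0 t "{0..T}" _ "\<lambda>t. - (k * h t * (e t + k * h t * y t) - (2 * k + 1) * (y t)\<^sup>2)"])
      show "0 \<le> - (k * h r * (e r + k * h r * y r) - (2 * k + 1) * (y r)\<^sup>2)" if r: "0 < r" "r < t" for r
      proof -
        have "k * h r * (e r + k * h r * y r) \<le> 0"
          using C[of r] r t k by (intro mult_nonneg_nonpos) auto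
        moreover have "0 \<le> (2 * k + 1) * (y r)\<^sup>2" using k by simp
        ultimately show ?thesis by linarith
      qed
      show "((\<lambda>t. - (e t + k * h t * y t)) has_real_derivative
          - (k * h r * (e r + k * h r * y r) - (2 * k + 1) * (y r)\<^sup>2)) (at r within {0..T})" if "r \<in> {0..t}" for r
        by (rule DERIV_minus[OF Dq]) (use that t in auto)
    qed (use t in auto)
    then show ?thesis using i q0 by simp
  qed
  then show "e T + k * h T * y T \<le> - c" using T by simp
  have yd: "y t \<le> y0 - c * t" if t: "t \<in> {0..T}" for t
  proof -
    have "- y 0 - c * 0 \<le> - y t - c * t"
    proof (rule nondecreasing_within[of 0 t "{0..T}" _ "\<lambda>t. - (e t + k * h t * y t) - c"])
      show "((\<lambda>t. - y t - c * t) has_real_derivative - (e r + k * h r * y r) - c) (at r within {0..T})"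
        if "r \<in> {0..t}" for r
        using D(2)[of r] that t by (auto intro!: derivative_eq_intros)
      show "0 \<le> - (e r + k * h r * y r) - c" if "0 < r" "r < t" for r using q[of r] that t by simp
    qed (use t in auto)
    then show ?thesis using i by simp
  qed
  have y0d: "y t \<le> \<bar>y0\<bar>" if t: "t \<in> {0..T}" for t
  proof -
    have "0 \<le> c * t" using q0(2) t by simp
    then show ?thesis using yd[OF t] by linarith
  qed
  then show "y T \<le> \<bar>y0\<bar>" using T by simp
  have hd: "h t \<le> h0 + \<bar>y0\<bar> * t - c * t\<^sup>2 / 2" if t: "t \<in> {0..T}" for t
  proof -
    have "\<bar>y0\<bar> * 0 - c * 0\<^sup>2 / 2 - h 0 \<le> \<bar>y0\<bar> * t - c * t\<^sup>2 / 2 - h t"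
    proof (rule nondecreasing_within[of 0 t "{0..T}" _ "\<lambda>t. \<bar>y0\<bar> - c * t - y t"])
      show "((\<lambda>t. \<bar>y0\<bar> * t - c * t\<^sup>2 / 2 - h t) has_real_derivative \<bar>y0\<bar> - c * r - y r) (at r within {0..T})"
        if "r \<in> {0..t}" for r
        using D(1)[of r] that t by (auto intro!: derivative_eq_intros)
      show "0 \<le> \<bar>y0\<bar> - c * r - y r" if "0 < r" "r < t" for r using yd[of r] that t by simp
    qed (use t in auto)
    then show ?thesis using i by simp
  qed
  have "0 \<le> h T"
    by (rule nonneg_at_end[OF sol_continuous(1)[OF s] T]) (use C in force)
  show TB: "T \<le> B"
  proof (rule ccontr)
    assume "\<not> T \<le> B"
    moreover have "0 \<le> 2 * (h0 + \<bar>y0\<bar>) / c" using h0 q0 by simp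
    \<comment> \<open>The summand 1 in \<open>B\<close> gives \<open>T > 1\<close>, which absorbs
      \<open>h0\<close> into \<open>h0 * T\<close>; the parabola is then negative at
      \<open>T\<close>.\<close>
    ultimately have T1: "T > 1" "T > 2 * (h0 + \<bar>y0\<bar>) / c" by (auto simp: B_def)
    then have "2 * (h0 + \<bar>y0\<bar>) < c * T" using q0 by (simp add: field_simps)
    then have "T * (2 * (h0 + \<bar>y0\<bar>)) < T * (c * T)" using T by (rule mult_strict_left_mono)
    moreover have "h0 * 1 \<le> h0 * T" using T1 h0 by (intro mult_left_mono) auto
    ultimately have "h0 + \<bar>y0\<bar> * T - c * T\<^sup>2 / 2 < 0" by (simp add: algebra_simps power2_eq_square)
    then show False using hd[of T] T \<open>0 \<le> h T\<close> by simp
  qed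
  have B: "B \<ge> 0" using TB T by simp
  have hH: "h t \<le> H" if t: "t \<in> {0..T}" for t
  proof -
    have "\<bar>y0\<bar> * t \<le> \<bar>y0\<bar> * B" using t TB by (intro mult_left_mono) auto
    moreover have "0 \<le> c * t\<^sup>2 / 2" using q0 by simp
    ultimately show ?thesis unfolding H_def using hd[OF t] by linarith
  qed
  then show "h T \<le> H" using T by simp
  have "- e 0 \<le> - e T"
    by (rule nondecreasing_within[of 0 T "{0..T}" _ "\<lambda>t. (3 * k + 1) * (y t)\<^sup>2"])
      (use T k backward_energy_deriv[OF s] in auto)
  then show "e T \<le> e0" using i by simp
  define M where "M = \<bar>y0\<bar> + u * H\<^sup>2"
  have H: "H \<ge> 0" using h0 B by (simp add: H_def)
  have yM: "(y t)\<^sup>2 \<le> M\<^sup>2" if t: "0 < t" "t < T" for t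
  proof -
    have "u * (h t)\<^sup>2 \<le> u * H\<^sup>2"
      using C[of t] hH[of t] t u by (intro mult_left_mono power_mono) auto
    moreover have "- (u * (h t)\<^sup>2) < y t" using C[of t] t by simp
    moreover have "0 \<le> u * H\<^sup>2" using u by simp
    ultimately have "- M \<le> y t" "y t \<le> M"
      using y0d[of t] t unfolding M_def by (linarith, simp)
    then show ?thesis by (simp add: abs_le_square_iff[symmetric] abs_le_iff)
  qed
  have "e 0 + (3 * k + 1) * M\<^sup>2 * 0 \<le> e T + (3 * k + 1) * M\<^sup>2 * T"
  proof (rule nondecreasing_within[of 0 T "{0..T}" _ "\<lambda>t. - (3 * k + 1) * (y t)\<^sup>2 + (3 * k + 1) * M\<^sup>2"])
    show "0 \<le> - (3 * k + 1) * (y t)\<^sup>2 + (3 * k + 1) * M\<^sup>2" if t: "0 < t" "t < T" for t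
      using mult_left_mono[OF yM[OF t], of "3 * k + 1"] k unfolding minus_mult_left[symmetric] by simp
  qed (use T in \<open>auto intro!: derivative_eq_intros D\<close>)
  moreover have "(3 * k + 1) * M\<^sup>2 * T \<le> (3 * k + 1) * M\<^sup>2 * B"
    using TB k by (intro mult_left_mono) auto
  ultimately show "e0 - (3 * k + 1) * (\<bar>y0\<bar> + u * H\<^sup>2)\<^sup>2 * B \<le> e T"
    using i by (simp add: M_def)
  have "0 \<le> y T + u * (h T)\<^sup>2"
  proof (rule nonneg_at_end[where y = "\<lambda>t. y t + u * (h t)\<^sup>2", OF _ T])
    show "continuous_on {0..T} (\<lambda>t. y t + u * (h t)\<^sup>2)"
      by (intro continuous_intros sol_continuous[OF s])
    show "0 \<le> y t + u * (h t)\<^sup>2" if "0 \<le> t" "t < T" for t using C[OF that] by simp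
  qed
  then show "- u * (h T)\<^sup>2 \<le> y T" by simp
  \<comment> \<open>Before the target is met, \<open>y > - u h^2\<close> gives
    \<open>h' \<ge> - u H h\<close>. So \<open>h\<close> cannot vanish first.\<close>
  show "h T > 0"
  proof (rule positive_within[of 0 T "{0..T}" h y "u * H"])
    fix t assume t: "0 < t" "t < T"
    have "- (u * h t) * h t \<le> y t" using C[of t] t by (simp add: power2_eq_square mult.assoc)
    then show "- (u * H) * h t \<le> y t"
      by (rule weaken_rate) (use C[of t] hH[of t] t u in auto)
  qed (use T D h0 i in auto)
qed

lemma backward_descent:
  assumes k: "k > 0" and h0: "h0 > 0" and u: "u > 0" and q0: "e0 + k * h0 * y0 < 0" and y0: "y0 > - u * h0\<^sup>2"
  obtains h y e T where "T > 0" "sol (- k) (- (3 * k + 1)) h y e {0..T}" "h 0 = h0" "y 0 = y0" "e 0 = e0"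
    "\<And>t. 0 \<le> t \<Longrightarrow> t \<le> T \<Longrightarrow> 0 < h t \<and> e t + k * h t * y t < 0" "y T = - u * (h T)\<^sup>2"
proof -
  define c where "c = - (e0 + k * h0 * y0)"
  have c: "e0 + k * h0 * y0 = - c" "c > 0" using q0 by (auto simp: c_def)
  define B where "B = 1 + 2 * (h0 + \<bar>y0\<bar>) / c"
  define H where "H = h0 + \<bar>y0\<bar> * B"
  define L where "L = e0 - (3 * k + 1) * (\<bar>y0\<bar> + u * H\<^sup>2)\<^sup>2 * B"
  have B: "B > 0" using h0 c by (simp add: B_def add_pos_nonneg)
  have H: "H > 0" using h0 B by (simp add: H_def add_pos_nonneg)
  have L: "L \<le> e0" using B k by (simp add: L_def)
  define U where "U = {x::real\<times>real\<times>real. 0 < fst x \<and> fst x < H + 1 \<and> - u * (fst x)\<^sup>2 < fst (snd x) \<and> fst (snd x) < \<bar>y0\<bar> + 1 \<and>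
      L - 1 < snd (snd x) \<and> snd (snd x) < e0 + 1 \<and> snd (snd x) + k * fst x * fst (snd x) < 0}"
  have U_iff: "(h, y, e) \<in> U \<longleftrightarrow> 0 < h \<and> h < H + 1 \<and> - u * h\<^sup>2 < y \<and> y < \<bar>y0\<bar> + 1 \<and> L - 1 < e \<and> e < e0 + 1 \<and> e + k * h * y < 0" for h y e
    by (simp add: U_def)
  have oU: "open U" unfolding U_def by (intro open_Collect_conj open_Collect_less continuous_intros)
  have "h0 \<le> H" using B by (simp add: H_def)
  then have U0: "(h0, y0, e0) \<in> U" using h0 y0 q0 L by (simp add: U_iff)
  define R where "R = H + 1 + u * (H + 1)\<^sup>2 + \<bar>y0\<bar> + 1 + \<bar>L\<bar> + 1 + \<bar>e0\<bar> + 1"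
  have bU: "U \<subseteq> cube R"
  proof
    fix x assume x: "x \<in> U"
    obtain h y e where xe: "x = (h, y, e)" by (cases x)
    have b: "0 < h" "h < H + 1" "- u * h\<^sup>2 < y" "y < \<bar>y0\<bar> + 1" "L - 1 < e" "e < e0 + 1" using x by (auto simp: xe U_iff)
    then have "u * h\<^sup>2 \<le> u * (H + 1)\<^sup>2" using u by (intro mult_left_mono power_mono) auto
    moreover have "0 \<le> u * (H + 1)\<^sup>2" using u by simp
    ultimately show "x \<in> cube R" using b H unfolding xe cube_def R_def mem_Times_iff atLeastAtMost_iff fst_conv snd_conv
      by (intro conjI) (linarith | simp)+
  qed
  show thesis
  proof (rule sol_continuation[OF oU U0 bU, where a = "- k" and b = "- (3 * k + 1)"])
    fix h y e assume s: "sol (- k) (- (3 * k + 1)) h y e {0..}" and i: "h 0 = h0" "y 0 = y0" "e 0 = e0"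
      and C: "\<And>t. 0 \<le> t \<Longrightarrow> (h t, y t, e t) \<in> U"
    have "sol (- k) (- (3 * k + 1)) h y e {0..B + 1}" by (rule sol_subset[OF s]) auto
    from backward_descent_bounds(3)[OF k h0 u c this _ i] C B
    have "B + 1 \<le> B" by (force simp: U_iff B_def)
    then show thesis by simp
  next
    fix h y e T assume T: "T > 0" and s: "sol (- k) (- (3 * k + 1)) h y e {0..T}" and i: "h 0 = h0" "y 0 = y0" "e 0 = e0"
      and C: "\<And>t. 0 \<le> t \<Longrightarrow> t < T \<Longrightarrow> (h t, y t, e t) \<in> U" and nT: "(h T, y T, e T) \<notin> U"
    have C': "0 < h t \<and> - u * (h t)\<^sup>2 < y t \<and> e t + k * h t * y t < 0" if "0 \<le> t" "t < T" for t
      using C[OF that] by (simp add: U_iff)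
    note X = backward_descent_bounds[OF k h0 u c s T i C', folded B_def, folded H_def, folded L_def]
    have "\<not> - u * (h T)\<^sup>2 < y T" using nT X c by (auto simp: U_iff)
    then have "y T = - u * (h T)\<^sup>2" using X(7) by linarith
    moreover have "0 < h t \<and> e t + k * h t * y t < 0" if "0 \<le> t" "t \<le> T" for t
      using C'[of t] that X(1,8) c by (cases "t = T") auto
    ultimately show thesis by (intro that[OF T s i]) auto
  qed
qed

text \<open>Replaces the case distinctions of \<open>sol_glue\<close> by pointwise equations, so
  that gluing can be iterated.\<close>

lemma sol_glue_ex:
  assumes s1: "sol a b g1 p1 E1 {0..T}" and s2: "sol a b g2 p2 E2 S" and T: "T \<ge> 0"
    and S: "0 \<in> S" "S \<subseteq> {0..}" and S': "{0..T} \<union> (+) T ` S = S'"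
    and eq: "g2 0 = g1 T" "p2 0 = p1 T" "E2 0 = E1 T"
  obtains g p E where "sol a b g p E S'"
    "\<And>t. t \<in> {0..T} \<Longrightarrow> g t = g1 t \<and> p t = p1 t \<and> E t = E1 t"
    "\<And>t. t \<in> S \<Longrightarrow> g (T + t) = g2 t \<and> p (T + t) = p2 t \<and> E (T + t) = E2 t"
proof (rule that[OF sol_glue[OF s1 s2 T S eq[symmetric], unfolded S']])
  fix t assume "t \<in> S"
  then have "t = 0 \<or> t > 0" using S by force
  then show "(if T + t \<le> T then g1 (T + t) else g2 (T + t - T)) = g2 t \<and>
    (if T + t \<le> T then p1 (T + t) else p2 (T + t - T)) = p2 t \<and>
    (if T + t \<le> T then E1 (T + t) else E2 (T + t - T)) = E2 t"
    using eq by auto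
qed auto

lemma image_add_Icc_Un: "0 \<le> T \<Longrightarrow> 0 \<le> T' \<Longrightarrow> {0..T} \<union> (+) T ` {0..T'} = {0..T + (T'::real)}"
  by auto

lemma image_add_Ici_Un: "0 \<le> T \<Longrightarrow> {0..T} \<union> (+) T ` {0..} = {0::real..}"
  by auto

text \<open>Glues the way to the inflection, the short step across it and the descent;
  \<open>\<tau>\<close> is the inflection time counted backwards.\<close>

lemma backward_phase:
  assumes k: "k > 0" and d: "0 < d" "d \<le> k / 2" and e0: "e0 < 0" "0 < e0 + k * d" and u: "u > 0"
  obtains h y e \<tau> T where "0 < \<tau>" "\<tau> < T" "sol (- k) (- (3 * k + 1)) h y e {0..T}" "h 0 = 1" "y 0 = d" "e 0 = e0"
    "\<And>t. 0 \<le> t \<Longrightarrow> t < \<tau> \<Longrightarrow> 0 < e t + k * h t * y t" "e \<tau> + k * h \<tau> * y \<tau> = 0"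
    "\<And>t. \<tau> < t \<Longrightarrow> t \<le> T \<Longrightarrow> e t + k * h t * y t < 0"
    "\<And>t. 0 \<le> t \<Longrightarrow> t \<le> T \<Longrightarrow> 0 < h t" "y T = - u * (h T)\<^sup>2"
proof -
  obtain h1 y1 e1 T1 where 1: "T1 > 0" "sol (- k) (- (3 * k + 1)) h1 y1 e1 {0..T1}" "h1 0 = 1" "y1 0 = d" "e1 0 = e0"
    "\<And>t. 0 \<le> t \<Longrightarrow> t < T1 \<Longrightarrow> 0 < e1 t + k * h1 t * y1 t" "e1 T1 + k * h1 T1 * y1 T1 = 0"
    "\<And>t. 0 \<le> t \<Longrightarrow> t \<le> T1 \<Longrightarrow> 0 < h1 t \<and> 0 < y1 t"
    by (rule backward_to_inflection[OF k d e0]) (rule that; assumption)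
  have p1: "h1 T1 > 0" "y1 T1 > 0" using 1(8)[of T1] 1(1) by auto
  obtain h2 y2 e2 T2 where 2: "T2 > 0" "sol (- k) (- (3 * k + 1)) h2 y2 e2 {0..T2}" "h2 0 = h1 T1" "y2 0 = y1 T1" "e2 0 = e1 T1"
    "\<And>t. 0 < t \<Longrightarrow> t \<le> T2 \<Longrightarrow> e2 t + k * h2 t * y2 t < 0"
    "\<And>t. 0 \<le> t \<Longrightarrow> t \<le> T2 \<Longrightarrow> 0 < h2 t \<and> 0 < y2 t"
    by (rule backward_small_step[OF k p1 1(7)]) (rule that; assumption)
  have p2: "h2 T2 > 0" "y2 T2 > 0" "e2 T2 + k * h2 T2 * y2 T2 < 0" using 2(6)[of T2] 2(7)[of T2] 2(1) by auto
  have "0 \<le> u * (h2 T2)\<^sup>2" using u by simp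
  then have p2': "y2 T2 > - u * (h2 T2)\<^sup>2" using p2(2) unfolding minus_mult_left[symmetric] by linarith
  obtain h3 y3 e3 T3 where 3: "T3 > 0" "sol (- k) (- (3 * k + 1)) h3 y3 e3 {0..T3}" "h3 0 = h2 T2" "y3 0 = y2 T2" "e3 0 = e2 T2"
    "\<And>t. 0 \<le> t \<Longrightarrow> t \<le> T3 \<Longrightarrow> 0 < h3 t \<and> e3 t + k * h3 t * y3 t < 0" "y3 T3 = - u * (h3 T3)\<^sup>2"
    by (rule backward_descent[OF k p2(1) u p2(3) p2']) (rule that; assumption)
  obtain ha ya ea where a: "sol (- k) (- (3 * k + 1)) ha ya ea {0..T1 + T2}"
    "\<And>t. t \<in> {0..T1} \<Longrightarrow> ha t = h1 t \<and> ya t = y1 t \<and> ea t = e1 t"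
    "\<And>t. t \<in> {0..T2} \<Longrightarrow> ha (T1 + t) = h2 t \<and> ya (T1 + t) = y2 t \<and> ea (T1 + t) = e2 t"
    by (rule sol_glue_ex[OF 1(2) 2(2) _ _ _ image_add_Icc_Un 2(3,4,5)]) (use 1(1) 2(1) in auto)
  obtain h y e where b: "sol (- k) (- (3 * k + 1)) h y e {0..T1 + T2 + T3}"
    "\<And>t. t \<in> {0..T1 + T2} \<Longrightarrow> h t = ha t \<and> y t = ya t \<and> e t = ea t"
    "\<And>t. t \<in> {0..T3} \<Longrightarrow> h (T1 + T2 + t) = h3 t \<and> y (T1 + T2 + t) = y3 t \<and> e (T1 + T2 + t) = e3 t"
    by (rule sol_glue_ex[OF a(1) 3(2) _ _ _ image_add_Icc_Un]) (use a(3)[of T2] 1(1) 2(1) 3(1,3,4,5) in auto)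
  have first: "h t = h1 t \<and> y t = y1 t \<and> e t = e1 t" if "0 \<le> t" "t \<le> T1" for t
    using a(2)[of t] b(2)[of t] that 2(1) by auto
  have second: "h t = h2 (t - T1) \<and> y t = y2 (t - T1) \<and> e t = e2 (t - T1)" if "T1 \<le> t" "t \<le> T1 + T2" for t
    using a(3)[of "t - T1"] b(2)[of t] that 1(1) by auto
  have third: "h t = h3 (t - (T1 + T2)) \<and> y t = y3 (t - (T1 + T2)) \<and> e t = e3 (t - (T1 + T2))"
    if "T1 + T2 \<le> t" "t \<le> T1 + T2 + T3" for t
    using b(3)[of "t - (T1 + T2)"] that by auto
  show thesis
  proof (rule that[OF 1(1) _ b(1)])
    show "T1 < T1 + T2 + T3" using 2 3 by simp
    show "h 0 = 1" "y 0 = d" "e 0 = e0" using first[of 0] 1 by auto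
    show "0 < e t + k * h t * y t" if "0 \<le> t" "t < T1" for t using 1(6)[OF that] first[of t] that by simp
    show "e T1 + k * h T1 * y T1 = 0" using 1(1,7) first[of T1] by simp
    show "e t + k * h t * y t < 0" if "T1 < t" "t \<le> T1 + T2 + T3" for t
    proof (cases "t \<le> T1 + T2")
      case True
      then show ?thesis using second[of t] 2(6)[of "t - T1"] that by simp
    next
      case False
      then show ?thesis using third[of t] 3(6)[of "t - (T1 + T2)"] that by simp
    qed
    show "0 < h t" if "0 \<le> t" "t \<le> T1 + T2 + T3" for t
    proof (cases "t \<le> T1")
      case True
      then show ?thesis using first[of t] 1(8)[of t] that by simp
    next
      case F: False
      show ?thesis
      proof (cases "t \<le> T1 + T2")
        case True
        then show ?thesis using second[of t] 2(7)[of "t - T1"] F by simp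
      next
        case False
        then show ?thesis using third[of t] 3(6)[of "t - (T1 + T2)"] that by simp
      qed
    qed
    show "y (T1 + T2 + T3) = - u * (h (T1 + T2 + T3))\<^sup>2"
      using third[of "T1 + T2 + T3"] 3(1,7) by simp
  qed
qed

section \<open>Convex-concave solutions\<close>

text \<open>A convex-concave solution in the variables of the system. As \<open>g = - f\<close>, the
  signs of the second derivative are interchanged and \<open>A\<close> is
  \<open>- a\<close>.\<close>

definition profile :: "real \<Rightarrow> real \<Rightarrow> (real \<Rightarrow> real) \<Rightarrow> (real \<Rightarrow> real) \<Rightarrow> (real \<Rightarrow> real) \<Rightarrow> bool" where
  "profile k A g p E \<longleftrightarrow> sol k (3 * k + 1) g p E {0..} \<and> g 0 = A \<and> p 0 = 1 \<and> (p \<longlongrightarrow> 0) at_top \<and>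
     (\<exists>t0>0. (\<forall>t\<in>{0..<t0}. E t - k * g t * p t < 0) \<and> E t0 - k * g t0 * p t0 = 0 \<and>
       (\<forall>t>t0. 0 < E t - k * g t * p t))"

lemma tendsto_affine_rescale:
  fixes x y :: "real \<Rightarrow> real"
  assumes "\<And>s. s \<ge> 0 \<Longrightarrow> y (t1 + s) = a * x (c * s)" "c > 0" "(x \<longlongrightarrow> l) at_top"
  shows "(y \<longlongrightarrow> a * l) at_top"
proof -
  have "filterlim (\<lambda>t. t - t1) at_top at_top"
    unfolding diff_conv_add_uminus add.commute[of _ "- t1"]
    by (rule filterlim_tendsto_add_at_top[OF tendsto_const filterlim_ident])
  then have "filterlim (\<lambda>t. c * (t - t1)) at_top at_top"
    by (rule filterlim_tendsto_pos_mult_at_top[OF tendsto_const assms(2)])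
  then have "((\<lambda>t. a * x (c * (t - t1))) \<longlongrightarrow> a * l) at_top"
    by (intro tendsto_mult tendsto_const filterlim_compose[OF assms(3)])
  moreover have "\<forall>\<^sub>F t in at_top. a * x (c * (t - t1)) = y t"
    using eventually_ge_at_top[of t1] by eventually_elim (use assms(1)[of "_ - t1"] in force)
  ultimately show ?thesis by (rule Lim_transform_eventually)
qed

lemma extend_to_profile:
  assumes k: "k > 0" and A: "A > 0" and d: "0 < d" "d \<le> k / 2"
    and s: "sol k (3 * k + 1) gf pf Ef {0..}" and i: "gf 0 = 1" "pf 0 = - d" "Ef 0 < 0" "0 < Ef 0 + k * d"
    and q: "\<And>t. t \<ge> 0 \<Longrightarrow> 0 < Ef t - k * gf t * pf t" and pf: "(pf \<longlongrightarrow> 0) at_top"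
  obtains g p E c t1 where "c > 0" "t1 \<ge> 0" "profile k A g p E"
    "\<And>s. s \<ge> 0 \<Longrightarrow> g (t1 + s) = c * gf (c * s) \<and> p (t1 + s) = c\<^sup>2 * pf (c * s) \<and> E (t1 + s) = c ^ 3 * Ef (c * s)"
proof -
  have u: "1 / A\<^sup>2 > 0" using A by simp
  obtain h y e \<tau> T where b: "0 < \<tau>" "\<tau> < T" "sol (- k) (- (3 * k + 1)) h y e {0..T}" "h 0 = 1" "y 0 = d" "e 0 = Ef 0"
    "\<And>t. 0 \<le> t \<Longrightarrow> t < \<tau> \<Longrightarrow> 0 < e t + k * h t * y t" "e \<tau> + k * h \<tau> * y \<tau> = 0"
    "\<And>t. \<tau> < t \<Longrightarrow> t \<le> T \<Longrightarrow> e t + k * h t * y t < 0"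
    "\<And>t. 0 \<le> t \<Longrightarrow> t \<le> T \<Longrightarrow> 0 < h t" "y T = - (1 / A\<^sup>2) * (h T)\<^sup>2"
    by (rule backward_phase[OF k d i(3,4) u]) (rule that; assumption)
  have T: "T > 0" using b by simp
  have r: "sol k (3 * k + 1) (\<lambda>t. h (T - t)) (\<lambda>t. - y (T - t)) (\<lambda>t. e (T - t)) {0..T}"
    using sol_reverse[OF b(3)] unfolding minus_minus .
  obtain G P Q where G: "sol k (3 * k + 1) G P Q {0..}"
    "\<And>t. t \<in> {0..T} \<Longrightarrow> G t = h (T - t) \<and> P t = - y (T - t) \<and> Q t = e (T - t)"
    "\<And>t. t \<in> {0..} \<Longrightarrow> G (T + t) = gf t \<and> P (T + t) = pf t \<and> Q (T + t) = Ef t"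
    by (rule sol_glue_ex[OF r s _ _ _ image_add_Ici_Un]) (use T b i in auto)
  have hT: "h T > 0" using b(10)[of T] T by simp
  \<comment> \<open>\<open>u\<close> is invariant under scaling and already equals
    \<open>1 / A^2\<close> at the left end, so the single factor \<open>c\<close> adjusts both
    \<open>g 0 = A\<close> and \<open>p 0 = 1\<close>.\<close>
  define c where "c = A / h T"
  have c: "c > 0" using A hT by (simp add: c_def)
  define g p E where "g = (\<lambda>t. c * G (c * t))" and "p = (\<lambda>t. c\<^sup>2 * P (c * t))" and "E = (\<lambda>t. c ^ 3 * Q (c * t))"
  have S: "sol k (3 * k + 1) g p E {0..}"
    using sol_affine[OF G(1), of c "{0..}" 0] c by (simp add: g_def p_def E_def)
  have tail: "g (T / c + s) = c * gf (c * s) \<and> p (T / c + s) = c\<^sup>2 * pf (c * s) \<and> E (T / c + s) = c ^ 3 * Ef (c * s)"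
    if "s \<ge> 0" for s
  proof -
    have "c * (T / c + s) = T + c * s" using c by (simp add: field_simps)
    then show ?thesis using G(3)[of "c * s"] that c by (simp add: g_def p_def E_def)
  qed
  have acc: "E t - k * g t * p t = c ^ 3 * (Q (c * t) - k * G (c * t) * P (c * t))" for t
    by (simp add: g_def p_def E_def power2_eq_square power3_eq_cube algebra_simps)
  have "profile k A g p E"
    unfolding profile_def
  proof (intro conjI exI[of _ "(T - \<tau>) / c"])
    show "sol k (3 * k + 1) g p E {0..}" by (rule S)
    show "g 0 = A" using G(2)[of 0] T hT by (simp add: g_def c_def)
    show "p 0 = 1" using G(2)[of 0] T hT A b(11) by (simp add: p_def c_def field_simps power2_eq_square)
    have "(p \<longlongrightarrow> c\<^sup>2 * 0) at_top" by (rule tendsto_affine_rescale[OF _ c pf]) (use tail in blast)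
    then show "(p \<longlongrightarrow> 0) at_top" by simp
    show "0 < (T - \<tau>) / c" using b c by simp
    show "\<forall>t\<in>{0..<(T - \<tau>) / c}. E t - k * g t * p t < 0"
    proof
      fix t assume "t \<in> {0..<(T - \<tau>) / c}"
      then have t: "0 \<le> c * t" "c * t < T - \<tau>" using c by (auto simp: field_simps)
      then have "Q (c * t) - k * G (c * t) * P (c * t) < 0"
        using G(2)[of "c * t"] b(9)[of "T - c * t"] b(1) by simp
      then show "E t - k * g t * p t < 0" unfolding acc using c by (simp add: mult_pos_neg)
    qed
    have ct: "c * ((T - \<tau>) / c) = T - \<tau>" using c by simp
    show "E ((T - \<tau>) / c) - k * g ((T - \<tau>) / c) * p ((T - \<tau>) / c) = 0"
      unfolding acc ct using G(2)[of "T - \<tau>"] b(1,2,8) by simp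
    show "\<forall>t>(T - \<tau>) / c. 0 < E t - k * g t * p t"
    proof (intro allI impI)
      fix t assume "(T - \<tau>) / c < t"
      then have t: "T - \<tau> < c * t" using c by (simp add: field_simps)
      have "0 < Q (c * t) - k * G (c * t) * P (c * t)"
      proof (cases "c * t \<le> T")
        case True
        then show ?thesis using G(2)[of "c * t"] b(7)[of "T - c * t"] t b(2) by simp
      next
        case False
        then show ?thesis using G(3)[of "c * t - T"] q[of "c * t - T"] by simp
      qed
      then show "0 < E t - k * g t * p t" unfolding acc using c by simp
    qed
  qed
  then show thesis using that[OF c _ _ tail] T c by simp
qed

section \<open>Translation between profiles and solutions of the boundary value problem\<close>

text \<open>\<open>D\<close> selects a derivative; the selection is forced because no point of
  \<open>{0..}\<close> is isolated, the endpoint 0 included.\<close>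

lemma D_eqI:
  assumes "\<And>s. s \<ge> 0 \<Longrightarrow> f s = y s" "(y has_real_derivative z) (at t within {0..})" "t \<ge> 0"
  shows "(f has_vector_derivative z) (at t within {0..})" "D f t = z"
proof -
  have "(y has_vector_derivative z) (at t within {0..})"
    using assms(2) by (simp add: has_real_derivative_iff_has_vector_derivative)
  then show "(f has_vector_derivative z) (at t within {0..})"
    by (rule has_vector_derivative_transform[rotated 2]) (use assms in auto)
  moreover have "at t within {0..} \<noteq> bot"
    using islimpt_subset[of t "{t..t + 1}" "{0..}"] assms(3) by (auto simp: trivial_limit_within islimpt_Icc)
  ultimately show "D f t = z" unfolding D_def by (intro vector_derivative_within)
qed

lemma profile_imp_convex_concave:
  assumes profile: "profile k A g p E" and m: "m = - (2 * k + 1)"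
  defines "f \<equiv> restrict (\<lambda>t. - g t) {0..}"
  shows "convex_concave_solution m (- A) f" "\<And>t. t \<ge> 0 \<Longrightarrow> D f t = - p t"
    "\<And>t. t \<ge> 0 \<Longrightarrow> D (D f) t = - (E t - k * g t * p t)"
proof -
  have s: "sol k (3 * k + 1) g p E {0..}" using profile by (simp add: profile_def)
  note d = solD[OF s] and dq = acc_deriv[OF s]
  have f: "f t = - g t" if "t \<ge> 0" for t using that by (simp add: f_def)
  have D1: "(f has_vector_derivative - p t) (at t within {0..})" "D f t = - p t" if "t \<ge> 0" for t
    using D_eqI[OF f DERIV_minus[OF d(1)], of t] that by auto
  have D2: "(D f has_vector_derivative - (E t - k * g t * p t)) (at t within {0..})"
    "D (D f) t = - (E t - k * g t * p t)" if "t \<ge> 0" for t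
    using D_eqI[OF D1(2) DERIV_minus[OF d(2)], of t] that by auto
  have D3: "(D (D f) has_vector_derivative - (- k * g t * (E t - k * g t * p t) + (2 * k + 1) * (p t)\<^sup>2)) (at t within {0..})"
    "D (D (D f)) t = - (- k * g t * (E t - k * g t * p t) + (2 * k + 1) * (p t)\<^sup>2)" if "t \<ge> 0" for t
    using D_eqI[OF D2(2) DERIV_minus[OF dq], of t] that by auto
  show "D f t = - p t" "D (D f) t = - (E t - k * g t * p t)" if "t \<ge> 0" for t
    using D1(2) D2(2) that by auto
  have "three_times_differentiable f"
    unfolding three_times_differentiable_def differentiable_on_def
    using D1(1) D2(1) D3(1) by (auto intro: differentiableI_vector)
  moreover have "D (D (D f)) t + (m + 1) / 2 * f t * D (D f) t - m * (D f t)\<^sup>2 = 0" if "t \<ge> 0" for t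
    using that by (simp add: D1 D2 D3 f m field_simps)
  moreover have "(D f \<longlongrightarrow> 0) at_top"
  proof -
    have "((\<lambda>t. - p t) \<longlongrightarrow> 0) at_top" using profile tendsto_minus[of p 0 at_top] by (simp add: profile_def)
    moreover have "\<forall>\<^sub>F t in at_top. - p t = D f t"
      using eventually_ge_at_top[of 0] by eventually_elim (simp add: D1)
    ultimately show ?thesis by (rule Lim_transform_eventually)
  qed
  ultimately have "bvp_solution m (- A) f"
    using profile by (simp add: bvp_solution_def f D1 profile_def) (simp add: f_def)
  moreover obtain t0 where "t0 > 0" "\<forall>t\<in>{0..<t0}. E t - k * g t * p t < 0" "E t0 - k * g t0 * p t0 = 0"
    "\<forall>t>t0. 0 < E t - k * g t * p t"
    using profile unfolding profile_def by blast
  ultimately show "convex_concave_solution m (- A) f"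
    unfolding convex_concave_solution_def by (auto simp: D2 intro!: exI[of _ t0])
qed

text \<open>The last function is \<open>E = g'' + k g g'\<close> written in terms of
  \<open>f = - g\<close>.\<close>

lemma convex_concave_imp_profile:
  assumes c: "convex_concave_solution m a f" and m: "m = - (2 * k + 1)"
  shows "profile k (- a) (\<lambda>t. - f t) (\<lambda>t. - D f t) (\<lambda>t. - D (D f) t + k * f t * D f t)"
proof -
  have b: "bvp_solution m a f" using c by (simp add: convex_concave_solution_def)
  then have dd: "f differentiable_on {0..}" "D f differentiable_on {0..}" "D (D f) differentiable_on {0..}"
    and ode: "\<And>t. t \<ge> 0 \<Longrightarrow> D (D (D f)) t + (m + 1) / 2 * f t * D (D f) t - m * (D f t)\<^sup>2 = 0"
    by (auto simp: bvp_solution_def three_times_differentiable_def)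
  have d: "(y has_real_derivative D y t) (at t within {0..})" if "y differentiable_on {0..}" "t \<ge> 0" for y t
    using that by (simp add: D_def has_real_derivative_iff_has_vector_derivative differentiable_on_def
        vector_derivative_works[symmetric])
  have "sol k (3 * k + 1) (\<lambda>t. - f t) (\<lambda>t. - D f t) (\<lambda>t. - D (D f) t + k * f t * D f t) {0..}"
    unfolding sol_def
  proof (intro ballI conjI)
    fix t :: real assume "t \<in> {0..}"
    then have t: "t \<ge> 0" by simp
    note d1 = d[OF dd(1) t] and d2 = d[OF dd(2) t] and d3 = d[OF dd(3) t]
    show "((\<lambda>t. - f t) has_real_derivative - D f t) (at t within {0..})" by (rule DERIV_minus[OF d1])
    show "((\<lambda>t. - D f t) has_real_derivative - D (D f) t + k * f t * D f t - k * - f t * - D f t) (at t within {0..})"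
      using DERIV_minus[OF d2] by simp
    have "- D (D (D f)) t + k * (D f t * D f t + f t * D (D f) t) = (3 * k + 1) * (- D f t)\<^sup>2"
      using ode[OF t] by (simp add: m field_simps power2_eq_square)
    moreover have "((\<lambda>t. - D (D f) t + k * f t * D f t) has_real_derivative
        - D (D (D f)) t + k * (D f t * D f t + f t * D (D f) t)) (at t within {0..})"
      by (auto intro!: derivative_eq_intros d1 d2 d3 simp: algebra_simps)
    ultimately show "((\<lambda>t. - D (D f) t + k * f t * D f t) has_real_derivative (3 * k + 1) * (- D f t)\<^sup>2) (at t within {0..})"
      by simp
  qed
  moreover have "((\<lambda>t. - D f t) \<longlongrightarrow> 0) at_top"
    using b tendsto_minus[of "D f" 0 at_top] by (simp add: bvp_solution_def)
  moreover obtain t0 where "t0 > 0" "\<forall>t\<in>{0..<t0}. D (D f) t > 0" "D (D f) t0 = 0" "\<forall>t>t0. D (D f) t < 0"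
    using c unfolding convex_concave_solution_def by blast
  ultimately show ?thesis
    using b unfolding profile_def by (auto simp: bvp_solution_def intro!: exI[of _ t0])
qed

text \<open>All signs follow from the single sign change of \<open>g''\<close>. After
  \<open>t0\<close>, \<open>p\<close> increases strictly to 0, so it is negative and
  \<open>g\<close> decreases to \<open>l\<close>. Before \<open>t0\<close>, \<open>p\<close>
  decreases, so on any stretch of this phase \<open>g\<close> is smallest at an end.\<close>

lemma profile_signs:
  assumes k: "k > 0" and A: "A > 0" and c: "profile k A g p E" and l: "(g \<longlongrightarrow> l) at_top" "l \<ge> 0"
  obtains t0 where "t0 > 0" "\<And>t. 0 \<le> t \<Longrightarrow> t < t0 \<Longrightarrow> E t - k * g t * p t < 0"
    "\<And>t. t > t0 \<Longrightarrow> 0 < E t - k * g t * p t" "\<And>t. t \<ge> t0 \<Longrightarrow> p t < 0"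
    "\<And>t. t \<ge> t0 \<Longrightarrow> l \<le> g t" "\<And>t. t \<ge> t0 \<Longrightarrow> g t \<le> g t0" "\<And>t. t \<ge> 0 \<Longrightarrow> 0 < g t" "\<And>t. t \<ge> 0 \<Longrightarrow> E t \<le> 0"
proof -
  have s: "sol k (3 * k + 1) g p E {0..}" and i: "g 0 = A" and pl: "(p \<longlongrightarrow> 0) at_top"
    using c by (auto simp: profile_def)
  note d = solD[OF s]
  obtain t0 where t0: "t0 > 0" and q: "\<forall>t\<in>{0..<t0}. E t - k * g t * p t < 0"
    "\<forall>t>t0. 0 < E t - k * g t * p t"
    using c unfolding profile_def by blast
  have pinc: "p r < p t" if "t0 \<le> r" "r < t" for r t
    by (rule increasing_within[of r t "{0..}" _ "\<lambda>t. E t - k * g t * p t"])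
      (use that t0 q d in auto)
  have pneg: "p t < 0" if t: "t \<ge> t0" for t
  proof -
    have "p (t + 1) \<le> 0"
    proof (rule tendsto_lowerbound[OF pl])
      show "\<forall>\<^sub>F s in at_top. p (t + 1) \<le> p s"
        using eventually_gt_at_top[of "t + 1"] by eventually_elim (use pinc[of "t + 1"] t in force)
    qed simp
    moreover have "p t < p (t + 1)" using pinc[of t "t + 1"] t by simp
    ultimately show ?thesis by simp
  qed
  have gdec: "g t < g r" if "t0 \<le> r" "r < t" for r t
  proof -
    have "- g r < - g t"
      by (rule increasing_within[of r t "{0..}" _ "\<lambda>t. - p t"])
        (use that t0 pneg in \<open>auto intro!: DERIV_minus d\<close>)
    then show ?thesis by simp
  qed
  have gl: "l \<le> g t" if t: "t \<ge> t0" for t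
  proof (rule tendsto_upperbound[OF l(1)])
    show "\<forall>\<^sub>F s in at_top. g s \<le> g t"
      using eventually_gt_at_top[of t] by eventually_elim (use gdec[of t] t in force)
  qed simp
  have gpos1: "0 < g t" if t: "t \<ge> t0" for t
    using gl[of "t + 1"] gdec[of t "t + 1"] t l(2) by simp
  have gpos: "0 < g t" if t: "t \<ge> 0" for t
  proof (cases "t \<ge> t0")
    case True
    then show ?thesis by (rule gpos1)
  next
    case False
    have pdec: "p y \<le> p x" if "0 \<le> x" "x \<le> y" "y \<le> t0" for x y
    proof -
      have "- p x \<le> - p y"
      proof (rule nondecreasing_within[of x y "{0..}" _ "\<lambda>t. - (E t - k * g t * p t)"])
        show "((\<lambda>t. - p t) has_real_derivative - (E r - k * g r * p r)) (at r within {0..})" if "r \<in> {x..y}" for r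
          by (rule DERIV_minus[OF d(2)]) (use that \<open>0 \<le> x\<close> in auto)
        show "0 \<le> - (E r - k * g r * p r)" if "x < r" "r < y" for r
          using q(1)[rule_format, of r] that \<open>0 \<le> x\<close> \<open>y \<le> t0\<close> by auto
      qed (use that in auto)
      then show ?thesis by simp
    qed
    show ?thesis
    proof (cases "p t \<ge> 0")
      case True
      have "g 0 \<le> g t"
        by (rule nondecreasing_within[of 0 t "{0..}" _ p])
          (use t False order_trans[OF True pdec] d in auto)
      then show ?thesis using i A by simp
    next
      case neg: False
      have "- g t \<le> - g t0"
        by (rule nondecreasing_within[of t t0 "{0..}" _ "\<lambda>t. - p t"])
          (use t False order_trans[OF pdec[of t] less_imp_le, of _ 0] neg in \<open>auto intro!: DERIV_minus d\<close>)
      then show ?thesis using gpos1[of t0] by simp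
    qed
  qed
  \<comment> \<open>If \<open>E\<close> were positive once, it would stay above that value, and
    \<open>g'' = E - k g p \<ge> E\<close> would eventually make \<open>p\<close> positive.\<close>
  have E0: "E t \<le> 0" if t: "t \<ge> 0" for t
  proof (rule ccontr)
    assume "\<not> E t \<le> 0"
    then have Et: "E t > 0" by simp
    define r where "r = max t t0"
    have "E t \<le> E x" if "x \<ge> r" for x
      by (rule nondecreasing_within[of t x "{0..}" _ "\<lambda>t. (3 * k + 1) * (p t)\<^sup>2"])
        (use that t k d in \<open>auto simp: r_def\<close>)
    moreover have "k * g x * p x \<le> 0" if "x \<ge> r" for x
      using gpos[of x] pneg[of x] that k t by (simp add: r_def mult_nonneg_nonpos)
    ultimately have le: "- (E x - k * g x * p x) \<le> - E t" if "x \<ge> r" for x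
      using that by (smt (verit))
    have der: "((\<lambda>x. - p x) has_real_derivative - (E x - k * g x * p x)) (at x within {0..})" if "x \<ge> r" for x
      using that t by (intro DERIV_minus d) (auto simp: r_def)
    have "\<exists>x\<ge>r. - p x < 0"
      by (rule negative_slope_unbounded_below[OF der _ le Et]) (use t in \<open>auto simp: r_def\<close>)
    then obtain x where "x \<ge> r" "- p x < 0" by blast
    then show False using pneg[of x] by (simp add: r_def)
  qed
  have "g t \<le> g t0" if "t \<ge> t0" for t using gdec[of t0 t] that by (cases "t = t0") auto
  then show thesis using that[OF t0, of] q pneg gl gpos E0 by auto
qed

section \<open>The projected phase plane\<close>

lemma phase_deriv:
  assumes s: "sol k (3 * k + 1) g p E S" and t: "t \<in> S" and g: "g t > 0"
  defines "u \<equiv> \<lambda>t. p t / (g t)\<^sup>2" and "v \<equiv> \<lambda>t. (E t - k * g t * p t) / (g t) ^ 3"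
  shows "(u has_real_derivative g t * (v t - 2 * (u t)\<^sup>2)) (at t within S)"
    and "(v has_real_derivative g t * (- (k + 3 * u t) * v t + (2 * k + 1) * (u t)\<^sup>2)) (at t within S)"
proof -
  note d = solD[OF s t] and dq = acc_deriv[OF s t]
  have "(u has_real_derivative ((E t - k * g t * p t) * (g t)\<^sup>2 - p t * (2 * g t * p t)) / ((g t)\<^sup>2 * (g t)\<^sup>2)) (at t within S)"
    unfolding u_def using d g by (auto intro!: derivative_eq_intros)
  moreover have "((E t - k * g t * p t) * (g t)\<^sup>2 - p t * (2 * g t * p t)) / ((g t)\<^sup>2 * (g t)\<^sup>2) = g t * (v t - 2 * (u t)\<^sup>2)"
    using g by (simp add: u_def v_def divide_simps) (simp add: algebra_simps power_numeral_reduce)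
  ultimately show "(u has_real_derivative g t * (v t - 2 * (u t)\<^sup>2)) (at t within S)" by simp
  let ?q = "E t - k * g t * p t"
  have "((\<lambda>t. (g t) ^ 3) has_real_derivative 3 * (g t)\<^sup>2 * p t) (at t within S)"
    using d by (auto intro!: derivative_eq_intros)
  then have "(v has_real_derivative ((- k * g t * ?q + (2 * k + 1) * (p t)\<^sup>2) * (g t) ^ 3 - ?q * (3 * (g t)\<^sup>2 * p t)) / ((g t) ^ 3 * (g t) ^ 3)) (at t within S)"
    unfolding v_def by (rule DERIV_divide[OF dq]) (use g in auto)
  moreover have "((- k * g t * ?q + (2 * k + 1) * (p t)\<^sup>2) * (g t) ^ 3 - ?q * (3 * (g t)\<^sup>2 * p t)) / ((g t) ^ 3 * (g t) ^ 3)
     = g t * (- (k + 3 * u t) * v t + (2 * k + 1) * (u t)\<^sup>2)"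
    using g by (simp add: u_def v_def divide_simps) (simp add: algebra_simps power_numeral_reduce)
  ultimately show "(v has_real_derivative g t * (- (k + 3 * u t) * v t + (2 * k + 1) * (u t)\<^sup>2)) (at t within S)" by simp
qed

text \<open>
  With \<open>v\<close> and \<open>w\<close> the heights of two orbits over the same \<open>u\<close>, the left-hand side is, up to the
  factor \<open>g\<close>, the derivative of \<open>v - w\<close> along the first orbit.
\<close>

lemma phase_relation:
  fixes u v w k :: real
  assumes "w - 2 * u\<^sup>2 \<noteq> 0"
  shows "(- (k + 3 * u) * v + (2 * k + 1) * u\<^sup>2) - (- (k + 3 * u) * w + (2 * k + 1) * u\<^sup>2) * ((v - 2 * u\<^sup>2) / (w - 2 * u\<^sup>2))
    = - ((u\<^sup>2 - 6 * u ^ 3) / (w - 2 * u\<^sup>2)) * (v - w)"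
  using assms by (simp add: divide_simps) (simp add: algebra_simps power_numeral_reduce)

text \<open>Following both orbits back from the common point, the first reaches its start when the
  second is at time \<open>d\<close>. There \<open>u = 1 / A^2\<close>, just as at time 0, and
  \<open>p2 d > 0\<close> places \<open>d\<close> before the inflection, where \<open>u\<close>
  decreases strictly. Hence \<open>d = 0\<close>, and then \<open>c = 1\<close>.\<close>

lemma profile_match:
  assumes k: "k > 0" and A: "A > 0"
    and c1: "profile k A g1 p1 E1" and c2: "profile k A g2 p2 E2" and l2: "(g2 \<longlongrightarrow> l2) at_top" "l2 \<ge> 0"
    and t: "t1 \<ge> 0" "t2 \<ge> 0" and c: "c > 0" "c * t1 \<le> t2"
    and eq: "g1 t1 = c * g2 t2" "p1 t1 = c\<^sup>2 * p2 t2" "E1 t1 = c ^ 3 * E2 t2"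
  shows "E1 0 = E2 0"
proof -
  define d where "d = t2 - c * t1"
  have d: "d \<ge> 0" using c by (simp add: d_def)
  have s1: "sol k (3 * k + 1) g1 p1 E1 {0..}" and s2: "sol k (3 * k + 1) g2 p2 E2 {0..}"
    and i: "g1 0 = A" "g2 0 = A" "p1 0 = 1" "p2 0 = 1"
    using c1 c2 by (auto simp: profile_def)
  have "sol k (3 * k + 1) (\<lambda>t. c * g2 (c * t + d)) (\<lambda>t. c\<^sup>2 * p2 (c * t + d)) (\<lambda>t. c ^ 3 * E2 (c * t + d)) {0..t1}"
    by (rule sol_affine[OF s2]) (use c d in auto)
  from sol_unique_backward[OF sol_subset[OF s1] this t(1)] eq
  have e: "g1 0 = c * g2 d" "p1 0 = c\<^sup>2 * p2 d" "E1 0 = c ^ 3 * E2 d" by (auto simp: d_def)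
  obtain t0 where t0: "t0 > 0" "\<And>t. 0 \<le> t \<Longrightarrow> t < t0 \<Longrightarrow> E2 t - k * g2 t * p2 t < 0"
    "\<And>t. t > t0 \<Longrightarrow> 0 < E2 t - k * g2 t * p2 t" "\<And>t. t \<ge> t0 \<Longrightarrow> p2 t < 0" "\<And>t. t \<ge> 0 \<Longrightarrow> 0 < g2 t"
    by (rule profile_signs[OF k A c2 l2]) (rule that; assumption)
  have "p2 d > 0" using e(2) i(3) c by (metis zero_less_mult_pos zero_less_one zero_less_power)
  then have dt: "d < t0" using t0(4)[of d] by force
  have "d = 0"
  proof (rule ccontr)
    assume "d \<noteq> 0"
    then have dpos: "d > 0" using d by simp
    have "- (p2 0 / (g2 0)\<^sup>2) < - (p2 d / (g2 d)\<^sup>2)"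
    proof (rule increasing_within[of 0 d "{0..}" _ "\<lambda>t. - (g2 t * ((E2 t - k * g2 t * p2 t) / (g2 t) ^ 3 - 2 * (p2 t / (g2 t)\<^sup>2)\<^sup>2))"])
      show "((\<lambda>t. - (p2 t / (g2 t)\<^sup>2)) has_real_derivative
          - (g2 r * ((E2 r - k * g2 r * p2 r) / (g2 r) ^ 3 - 2 * (p2 r / (g2 r)\<^sup>2)\<^sup>2))) (at r within {0..})"
        if "r \<in> {0..d}" for r
        by (rule DERIV_minus[OF phase_deriv(1)[OF s2]]) (use that t0(5)[of r] in auto)
    next
      fix r assume r: "0 < r" "r < d"
      have g: "g2 r > 0" using t0(5)[of r] r by simp
      have "(E2 r - k * g2 r * p2 r) / (g2 r) ^ 3 < 0" using t0(2)[of r] r dt g by (intro divide_neg_pos) auto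
      then have "(E2 r - k * g2 r * p2 r) / (g2 r) ^ 3 - 2 * (p2 r / (g2 r)\<^sup>2)\<^sup>2 < 0"
        using zero_le_power2[of "p2 r / (g2 r)\<^sup>2"] by linarith
      then show "0 < - (g2 r * ((E2 r - k * g2 r * p2 r) / (g2 r) ^ 3 - 2 * (p2 r / (g2 r)\<^sup>2)\<^sup>2))"
        using g by (simp add: mult_pos_neg)
    qed (use dpos in auto)
    moreover have "p2 d / (g2 d)\<^sup>2 = p1 0 / (g1 0)\<^sup>2"
      unfolding e using c by (simp add: power_mult_distrib)
    ultimately show False using i by simp
  qed
  then have "c = 1" using e(1) i A by simp
  then show ?thesis using e \<open>d = 0\<close> by simp
qed

section \<open>Uniqueness of the separatrix\<close>

lemma has_real_derivative_local_inverse: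
  fixes f g :: "real \<Rightarrow> real"
  assumes "DERIV f x :> c" "c \<noteq> 0" "open S" "x \<in> S" "continuous_on S f" "\<And>z. z \<in> S \<Longrightarrow> g (f z) = z"
  shows "DERIV g (f x) :> inverse c"
  unfolding has_field_derivative_def
  by (rule has_derivative_inverse_strong[of S x f g, OF assms(3,4,5,6) assms(1)[unfolded has_field_derivative_def]])
    (use assms(2) in auto)

text \<open>The second orbit is the separatrix from time \<open>Ts\<close> on. Over equal
  \<open>u\<close> the height difference obeys the linear equation
  \<open>\<Delta>' = - g1 cf \<Delta>\<close> with \<open>cf \<le> C \<bar>u1\<bar>\<close>, and
  \<open>g1 \<bar>u1\<bar>\<close> is the derivative of \<open>- ln g1\<close>. As \<open>g1\<close>
  has a positive limit, the total damping is finite, so a nonzero \<open>\<Delta>\<close> could not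
  tend to 0.\<close>

lemma meets_separatrix:
  assumes k: "k > 0" and A: "A > 0"
    and c1: "profile k A g1 p1 E1" "(g1 \<longlongrightarrow> l1) at_top" "l1 > 0"
    and c2: "profile k A g2 p2 E2" "(g2 \<longlongrightarrow> l2) at_top" "l2 > 0"
    and Ts: "Ts \<ge> 0"
    and sep: "\<And>t. t \<ge> Ts \<Longrightarrow> p2 t < 0 \<and> 0 < g2 t * (E2 t - k * g2 t * p2 t) - 2 * (p2 t)\<^sup>2 \<and>
      - (k / 2) * g2 t * p2 t \<le> E2 t - k * g2 t * p2 t \<and> - p2 t \<le> beta k * (g2 t)\<^sup>2"
  obtains t1 t2 c where "t1 \<ge> 0" "t2 \<ge> 0" "c > 0"
    "g1 t1 = c * g2 t2" "p1 t1 = c\<^sup>2 * p2 t2" "E1 t1 = c ^ 3 * E2 t2"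
proof -
  have s1: "sol k (3 * k + 1) g1 p1 E1 {0..}" and s2: "sol k (3 * k + 1) g2 p2 E2 {0..}"
    and pl: "(p1 \<longlongrightarrow> 0) at_top" "(p2 \<longlongrightarrow> 0) at_top"
    using c1 c2 by (auto simp: profile_def)
  obtain t0 where t0: "t0 > 0" "\<And>t. t > t0 \<Longrightarrow> 0 < E1 t - k * g1 t * p1 t" "\<And>t. t \<ge> t0 \<Longrightarrow> p1 t < 0"
    "\<And>t. t \<ge> t0 \<Longrightarrow> l1 \<le> g1 t" "\<And>t. t \<ge> 0 \<Longrightarrow> 0 < g1 t" "\<And>t. t \<ge> 0 \<Longrightarrow> E1 t \<le> 0"
    by (rule profile_signs[OF k A c1(1,2) less_imp_le[OF c1(3)]]) (rule that; assumption)
  have g2: "0 < g2 t" "E2 t \<le> 0" if "t \<ge> 0" for t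
  proof -
    have "\<And>t. t \<ge> 0 \<Longrightarrow> 0 < g2 t" "\<And>t. t \<ge> 0 \<Longrightarrow> E2 t \<le> 0"
      by (rule profile_signs[OF k A c2(1,2) less_imp_le[OF c2(3)]], assumption)+
    then show "0 < g2 t" "E2 t \<le> 0" using that by auto
  qed
  define u1 where "u1 t = p1 t / (g1 t)\<^sup>2" for t
  define v1 where "v1 t = (E1 t - k * g1 t * p1 t) / (g1 t) ^ 3" for t
  define u2 where "u2 t = p2 t / (g2 t)\<^sup>2" for t
  define v2 where "v2 t = (E2 t - k * g2 t * p2 t) / (g2 t) ^ 3" for t
  have d1: "(u1 has_real_derivative g1 t * (v1 t - 2 * (u1 t)\<^sup>2)) (at t within {0..})"
    "(v1 has_real_derivative g1 t * (- (k + 3 * u1 t) * v1 t + (2 * k + 1) * (u1 t)\<^sup>2)) (at t within {0..})" if "t \<ge> 0" for t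
    using phase_deriv[OF s1, of t] t0(5)[OF that] that unfolding u1_def v1_def by auto
  have d2: "(u2 has_real_derivative g2 t * (v2 t - 2 * (u2 t)\<^sup>2)) (at t within {0..})"
    "(v2 has_real_derivative g2 t * (- (k + 3 * u2 t) * v2 t + (2 * k + 1) * (u2 t)\<^sup>2)) (at t within {0..})" if "t \<ge> 0" for t
    using phase_deriv[OF s2, of t] g2(1)[OF that] that unfolding u2_def v2_def by auto
  \<comment> \<open>\<open>E \<le> 0\<close> in phase coordinates: the orbit does not lie above the
    strong stable line.\<close>
  have vu: "(E - k * g * p) / g ^ 3 \<le> - k * (p / g\<^sup>2)" if "g > 0" "E \<le> 0" for g p E :: real
  proof -
    have "(E - k * g * p) / g ^ 3 \<le> (- k * g * p) / g ^ 3" using that by (intro divide_right_mono) auto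
    also have "\<dots> = - k * (p / g\<^sup>2)" using that by (simp add: power2_eq_square power3_eq_cube)
    finally show ?thesis .
  qed
  have u1l: "(u1 \<longlongrightarrow> 0) at_top"
    unfolding u1_def using pl(1) c1 by (auto intro!: tendsto_eq_intros)
  have u2l: "(u2 \<longlongrightarrow> 0) at_top"
    unfolding u2_def using pl(2) c2 by (auto intro!: tendsto_eq_intros)
  have b: "beta k < k / 10" by (rule beta_small[OF k])
  have f2: "u2 t < 0" "- u2 t < k / 10" "- (k / 2) * u2 t \<le> v2 t" "v2 t \<le> - k * u2 t" "0 < v2 t - 2 * (u2 t)\<^sup>2"
    if t: "t \<ge> Ts" for t
  proof -
    have g: "g2 t > 0" using g2(1)[of t] t Ts by simp
    note s = sep[OF t]
    show "u2 t < 0" using s g by (simp add: u2_def divide_neg_pos)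
    have "- p2 t / (g2 t)\<^sup>2 \<le> beta k" using s g by (subst pos_divide_le_eq) auto
    then have "- u2 t \<le> beta k" by (simp add: u2_def)
    then show "- u2 t < k / 10" using b by simp
    have "- (k / 2) * u2 t = (- (k / 2) * g2 t * p2 t) / (g2 t) ^ 3"
      using g by (simp add: u2_def power2_eq_square power3_eq_cube)
    also have "\<dots> \<le> v2 t" unfolding v2_def using s g by (intro divide_right_mono) auto
    finally show "- (k / 2) * u2 t \<le> v2 t" .
    show "v2 t \<le> - k * u2 t" unfolding v2_def u2_def by (rule vu[OF g]) (use g2(2)[of t] t Ts in simp)
    have "v2 t - 2 * (u2 t)\<^sup>2 = (g2 t * (E2 t - k * g2 t * p2 t) - 2 * (p2 t)\<^sup>2) / (g2 t) ^ 4"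
      using g by (simp add: u2_def v2_def divide_simps) (simp add: algebra_simps power_numeral_reduce)
    then show "0 < v2 t - 2 * (u2 t)\<^sup>2" using s g by simp
  qed
  have u2inc: "u2 r < u2 t" if "Ts \<le> r" "r < t" for r t
  proof (rule increasing_within[of r t "{0..}" u2 "\<lambda>t. g2 t * (v2 t - 2 * (u2 t)\<^sup>2)"])
    show "(u2 has_real_derivative g2 x * (v2 x - 2 * (u2 x)\<^sup>2)) (at x within {0..})" if "x \<in> {r..t}" for x
      by (rule d2(1)) (use that \<open>Ts \<le> r\<close> Ts in auto)
    show "0 < g2 x * (v2 x - 2 * (u2 x)\<^sup>2)" if "r < x" for x
      by (rule mult_pos_pos[OF g2(1) f2(5)]) (use that \<open>Ts \<le> r\<close> Ts in auto)
  qed (use that Ts in auto)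
  define S where "S = {Ts<..}"
  have inj: "inj_on u2 S"
    by (rule inj_onI) (metis S_def greaterThan_iff less_imp_le less_irrefl linorder_neqE u2inc)
  \<comment> \<open>Since \<open>u2\<close> increases strictly, the separatrix is a graph over
    \<open>u\<close>; \<open>\<psi>\<close> returns its time from \<open>u\<close>.\<close>
  define \<psi> where "\<psi> = inv_into S u2"
  have contu2: "continuous_on {0..} u2" by (rule DERIV_continuous_on[OF d2(1)]) auto
  have \<psi>: "\<psi> y \<in> S" "u2 (\<psi> y) = y" if y: "u2 Ts < y" "y < 0" for y
  proof -
    have "\<forall>\<^sub>F t in at_top. y < u2 t" using u2l y(2) by (rule order_tendstoD)
    then obtain t where t: "y < u2 t" "t > Ts"
      using eventually_happens[OF eventually_conj[OF _ eventually_gt_at_top[of Ts]]] by force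
    obtain x where x: "Ts \<le> x" "x \<le> t" "u2 x = y"
      using IVT'[of u2 Ts y t] y t continuous_on_subset[OF contu2, of "{Ts..t}"] Ts by force
    then have "x \<in> S" using y by (cases "x = Ts") (auto simp: S_def)
    then have "y \<in> u2 ` S" using x by blast
    then show "\<psi> y \<in> S" "u2 (\<psi> y) = y" unfolding \<psi>_def by (auto intro: inv_into_into f_inv_into_f)
  qed
  have "\<forall>\<^sub>F t in at_top. u2 Ts < u1 t"
    using u1l f2(1)[OF order_refl] by (rule order_tendstoD)
  then obtain N where N: "\<And>t. t \<ge> N \<Longrightarrow> u2 Ts < u1 t" by (auto simp: eventually_at_top_linorder)
  \<comment> \<open>From here on the first orbit is past its inflection and its \<open>u\<close>
    lies in the range \<open>(u2 Ts, 0)\<close> of the separatrix.\<close>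
  define T where "T = max N (t0 + 1)"
  have T: "T > 0" using t0(1) by (simp add: T_def)
  have f1: "u1 t < 0" "u2 Ts < u1 t" "0 \<le> v1 t" "v1 t \<le> - k * u1 t" "0 < g1 t" "l1 \<le> g1 t" if t: "t \<ge> T" for t
  proof -
    have tt: "t > t0" "t \<ge> N" "t \<ge> 0" using t t0(1) by (auto simp: T_def)
    show g: "0 < g1 t" using t0(5) tt by simp
    show "l1 \<le> g1 t" using t0(4) tt by simp
    show "u1 t < 0" using g t0(3)[of t] tt by (simp add: u1_def divide_neg_pos)
    show "u2 Ts < u1 t" using N tt by simp
    show "0 \<le> v1 t" using g t0(2)[of t] tt by (simp add: v1_def)
    show "v1 t \<le> - k * u1 t" unfolding v1_def u1_def by (rule vu[OF g]) (use t0(6) tt in simp)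
  qed
  \<comment> \<open>The time at which the separatrix passes over the value of \<open>u\<close> that
    the first orbit has at \<open>t\<close>; \<open>w\<close> below is its height there.\<close>
  define \<theta> where "\<theta> t = \<psi> (u1 t)" for t
  have \<theta>: "\<theta> t > Ts" "u2 (\<theta> t) = u1 t" if "t \<ge> T" for t
    using \<psi>[OF f1(2,1)[OF that]] by (auto simp: \<theta>_def S_def)
  define w where "w t = v2 (\<theta> t)" for t
  define \<Delta> where "\<Delta> t = v1 t - w t" for t
  define cf where "cf t = ((u1 t)\<^sup>2 - 6 * (u1 t) ^ 3) / (w t - 2 * (u1 t)\<^sup>2)" for t
  have D\<Delta>: "(\<Delta> has_real_derivative - (g1 t * cf t) * \<Delta> t) (at t within {0..})" if t: "t \<ge> T" for t
  proof -
    let ?x = "\<theta> t"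
    have x: "?x > Ts" "?x > 0" "u2 ?x = u1 t" using \<theta>[OF t] Ts by auto
    have at: "at ?x within {0..} = at ?x" by (rule at_within_interior) (use x in auto)
    have nz: "g2 ?x * (w t - 2 * (u1 t)\<^sup>2) \<noteq> 0"
      using g2(1)[of ?x] f2(5)[of ?x] x by (simp add: w_def)
    have "DERIV u2 ?x :> g2 ?x * (w t - 2 * (u1 t)\<^sup>2)"
      using d2(1)[of ?x] x unfolding at by (simp add: w_def)
    then have "DERIV \<psi> (u2 ?x) :> inverse (g2 ?x * (w t - 2 * (u1 t)\<^sup>2))"
    proof (rule has_real_derivative_local_inverse[OF _ nz])
      show "open S" "?x \<in> S" using x by (auto simp: S_def)
      show "continuous_on S u2" by (rule continuous_on_subset[OF contu2]) (use Ts in \<open>auto simp: S_def\<close>)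
      show "\<psi> (u2 z) = z" if "z \<in> S" for z unfolding \<psi>_def by (rule inv_into_f_f[OF inj that])
    qed
    then have "DERIV \<psi> (u1 t) :> inverse (g2 ?x * (w t - 2 * (u1 t)\<^sup>2))" using x by simp
    from DERIV_chain2[OF this d1(1)] t T
    have D\<theta>: "(\<theta> has_real_derivative inverse (g2 ?x * (w t - 2 * (u1 t)\<^sup>2)) * (g1 t * (v1 t - 2 * (u1 t)\<^sup>2))) (at t within {0..})"
      unfolding \<theta>_def by simp
    have "DERIV v2 ?x :> g2 ?x * (- (k + 3 * u1 t) * w t + (2 * k + 1) * (u1 t)\<^sup>2)"
      using d2(2)[of ?x] x unfolding at by (simp add: w_def)
    from DERIV_chain2[OF this D\<theta>]
    have "(w has_real_derivative g2 ?x * (- (k + 3 * u1 t) * w t + (2 * k + 1) * (u1 t)\<^sup>2) *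
       (inverse (g2 ?x * (w t - 2 * (u1 t)\<^sup>2)) * (g1 t * (v1 t - 2 * (u1 t)\<^sup>2)))) (at t within {0..})"
      unfolding w_def .
    moreover have "g2 ?x * (- (k + 3 * u1 t) * w t + (2 * k + 1) * (u1 t)\<^sup>2) *
       (inverse (g2 ?x * (w t - 2 * (u1 t)\<^sup>2)) * (g1 t * (v1 t - 2 * (u1 t)\<^sup>2)))
      = g1 t * ((- (k + 3 * u1 t) * w t + (2 * k + 1) * (u1 t)\<^sup>2) * ((v1 t - 2 * (u1 t)\<^sup>2) / (w t - 2 * (u1 t)\<^sup>2)))"
      using nz by (simp add: field_simps)
    ultimately have Dw: "(w has_real_derivative g1 t * ((- (k + 3 * u1 t) * w t + (2 * k + 1) * (u1 t)\<^sup>2) *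
       ((v1 t - 2 * (u1 t)\<^sup>2) / (w t - 2 * (u1 t)\<^sup>2)))) (at t within {0..})" by simp
    have "(\<Delta> has_real_derivative g1 t * (- (k + 3 * u1 t) * v1 t + (2 * k + 1) * (u1 t)\<^sup>2) -
       g1 t * ((- (k + 3 * u1 t) * w t + (2 * k + 1) * (u1 t)\<^sup>2) *
       ((v1 t - 2 * (u1 t)\<^sup>2) / (w t - 2 * (u1 t)\<^sup>2)))) (at t within {0..})"
      unfolding \<Delta>_def by (rule DERIV_diff[OF d1(2) Dw]) (use t T in simp)
    moreover have "w t - 2 * (u1 t)\<^sup>2 \<noteq> 0" using nz by simp
    from phase_relation[OF this, of k "v1 t"]
    have "g1 t * (- (k + 3 * u1 t) * v1 t + (2 * k + 1) * (u1 t)\<^sup>2) -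
       g1 t * ((- (k + 3 * u1 t) * w t + (2 * k + 1) * (u1 t)\<^sup>2) *
       ((v1 t - 2 * (u1 t)\<^sup>2) / (w t - 2 * (u1 t)\<^sup>2))) = g1 t * (- cf t * \<Delta> t)"
      by (simp only: right_diff_distrib[symmetric] cf_def \<Delta>_def)
    ultimately show ?thesis by (simp add: mult.assoc)
  qed
  \<comment> \<open>With \<open>x = - u1 < k / 10\<close>, the denominator of \<open>cf\<close> is
    at least \<open>(k / 2) x - 2 x^2 \<ge> (3 k / 10) x\<close>, and the numerator
    \<open>x^2 (1 + 6 x)\<close> is at most \<open>x^2 (1 + k)\<close>.\<close>
  define C where "C = 10 * (1 + k) / (3 * k)"
  have C: "C > 0" using k by (simp add: C_def)
  have cf: "cf t \<le> C * - u1 t" if t: "t \<ge> T" for t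
  proof -
    define x where "x = - u1 t"
    note F = f2[OF less_imp_le[OF \<theta>(1)[OF t]], unfolded \<theta>(2)[OF t]]
    have x: "0 < x" "x < k / 10" "k / 2 * x \<le> w t"
      using F(1,2,3) by (simp_all add: x_def w_def)
    have den: "3 * k / 10 * x \<le> w t - 2 * x\<^sup>2"
    proof -
      have "x\<^sup>2 \<le> k / 10 * x" unfolding power2_eq_square using x by (intro mult_right_mono) auto
      then show ?thesis using x(3) by (simp add: field_simps)
    qed
    have "cf t = x * (x * (1 + 6 * x)) / (w t - 2 * x\<^sup>2)"
      by (simp add: cf_def x_def power_numeral_reduce algebra_simps)
    also have "\<dots> \<le> x * (x * (1 + k)) / (3 * k / 10 * x)"
      using x den k by (intro frac_le mult_left_mono mult_nonneg_nonneg) auto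
    also have "\<dots> = C * x" using x k by (simp add: C_def field_simps)
    finally show ?thesis by (simp add: x_def)
  qed
  \<comment> \<open>\<open>\<Delta>\<^sup>2 g\<^sup>-\<^sup>2\<^sup>C\<close> is nondecreasing and tends to \<open>0\<close>.\<close>
  define W where "W t = (\<Delta> t)\<^sup>2 * exp (- (2 * C) * ln (g1 t))" for t
  have Wm: "W T \<le> W t" if t: "t \<ge> T" for t
  proof (rule nondecreasing_within[OF t, of "{0..}" W
      "\<lambda>t. 2 * ((\<Delta> t)\<^sup>2 * (- (g1 t * cf t) - C * (p1 t / g1 t))) * exp (- (2 * C) * ln (g1 t))"])
    show "{T..t} \<subseteq> {0..}" using T by auto
    fix r assume "r \<in> {T..t}"
    then have r: "r \<ge> T" "r \<ge> 0" using T by auto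
    from D\<Delta>[OF r(1)] solD(1)[OF s1, of r] f1(5)[OF r(1)] r show "(W has_real_derivative 2 * ((\<Delta> r)\<^sup>2 * (- (g1 r * cf r) - C * (p1 r / g1 r))) * exp (- (2 * C) * ln (g1 r))) (at r within {0..})"
      unfolding W_def by (auto intro!: derivative_eq_intros simp: algebra_simps power2_eq_square)
  next
    fix r assume "T < r"
    then have r: "r \<ge> T" by simp
    have "g1 r * cf r \<le> g1 r * (C * - u1 r)" using cf[OF r] f1(5)[OF r] by (intro mult_left_mono) auto
    also have "\<dots> = - C * (p1 r / g1 r)" using f1(5)[OF r] by (simp add: u1_def power2_eq_square)
    finally show "0 \<le> 2 * ((\<Delta> r)\<^sup>2 * (- (g1 r * cf r) - C * (p1 r / g1 r))) * exp (- (2 * C) * ln (g1 r))" by simp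
  qed
  \<comment> \<open>Both heights lie between 0 and \<open>- k u1\<close>, which bounds
    \<open>\<Delta>\<close>; the weight is bounded because \<open>g1 \<ge> l1 > 0\<close>.\<close>
  have Wl: "W t \<le> (k * u1 t)\<^sup>2 * exp (- (2 * C) * ln l1)" if t: "t \<ge> T" for t
  proof -
    have "0 \<le> w t" using f2(3)[of "\<theta> t"] \<theta>[OF t] f1(1)[OF t] k mult_nonneg_nonneg[of "k / 2" "- u1 t"]
      by (simp add: w_def)
    moreover have "w t \<le> - k * u1 t" using f2(4)[of "\<theta> t"] \<theta>[OF t] by (simp add: w_def)
    ultimately have "\<bar>\<Delta> t\<bar> \<le> \<bar>k * u1 t\<bar>" using f1(3,4)[OF t] by (simp add: \<Delta>_def)
    then have "(\<Delta> t)\<^sup>2 \<le> (k * u1 t)\<^sup>2" by (rule abs_le_square_iff[THEN iffD1])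
    moreover have "ln l1 \<le> ln (g1 t)" using f1(6)[OF t] c1(3) by simp
    ultimately show ?thesis unfolding W_def using C by (intro mult_mono) auto
  qed
  have "W T \<le> 0"
  proof (rule tendsto_lowerbound)
    show "((\<lambda>t. (k * u1 t)\<^sup>2 * exp (- (2 * C) * ln l1)) \<longlongrightarrow> 0) at_top"
      using u1l by (auto intro!: tendsto_eq_intros)
    show "\<forall>\<^sub>F t in at_top. W T \<le> (k * u1 t)\<^sup>2 * exp (- (2 * C) * ln l1)"
      using eventually_ge_at_top[of T] by eventually_elim (use order_trans[OF Wm Wl] in blast)
  qed simp
  then have "\<Delta> T = 0" by (simp add: W_def mult_le_0_iff)
  define t2 where "t2 = \<theta> T"
  have t2: "t2 \<ge> 0" "u2 t2 = u1 T" "v2 t2 = v1 T"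
    using \<theta>[OF order_refl] Ts \<open>\<Delta> T = 0\<close> by (auto simp: t2_def \<Delta>_def w_def)
  \<comment> \<open>Points with the same \<open>u\<close> and \<open>v\<close> differ by a scaling
    only, whose factor is the ratio of the values of \<open>g\<close>.\<close>
  define c where "c = g1 T / g2 t2"
  have g: "g1 T > 0" "g2 t2 > 0" using f1(5)[of T] g2(1)[OF t2(1)] by auto
  have e1: "p1 T = c\<^sup>2 * p2 t2" using t2(2) g by (simp add: u1_def u2_def c_def field_simps)
  have "E1 T - k * g1 T * p1 T = c ^ 3 * (E2 t2 - k * g2 t2 * p2 t2)"
    using t2(3) g by (simp add: v1_def v2_def c_def field_simps)
  moreover have "k * g1 T * p1 T = c ^ 3 * (k * g2 t2 * p2 t2)"
    unfolding e1 using g by (simp add: c_def power_numeral_reduce)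
  ultimately have e2: "E1 T = c ^ 3 * E2 t2" unfolding right_diff_distrib by linarith
  show thesis
    by (rule that[OF less_imp_le[OF T] t2(1) _ _ e1 e2]) (use g in \<open>simp_all add: c_def\<close>)
qed

text \<open>\<open>g 0\<close> and \<open>p 0\<close> are prescribed for a profile, so
  \<open>E 0\<close> is the only free initial value.\<close>

lemma profile_same_energy:
  assumes k: "k > 0" and c: "profile k A g1 p1 E1" "profile k A g2 p2 E2" "E1 0 = E2 0" and t: "t \<ge> 0"
  shows "g1 t = g2 t"
proof -
  have "sol k (3 * k + 1) g1 p1 E1 {0..t}" "sol k (3 * k + 1) g2 p2 E2 {0..t}"
    using c by (auto simp: profile_def intro: sol_subset)
  from sol_unique[OF this t] show ?thesis using c by (auto simp: profile_def)
qed

lemma profile_unique_positive_limit: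
  assumes k: "k > 0" and A: "A > 0"
    and c1: "profile k A g1 p1 E1" "(g1 \<longlongrightarrow> l1) at_top" "l1 > 0"
    and c2: "profile k A g2 p2 E2" "(g2 \<longlongrightarrow> l2) at_top" "l2 > 0"
    and Ts: "Ts \<ge> 0"
    and sep: "\<And>t. t \<ge> Ts \<Longrightarrow> p2 t < 0 \<and> 0 < g2 t * (E2 t - k * g2 t * p2 t) - 2 * (p2 t)\<^sup>2 \<and>
      - (k / 2) * g2 t * p2 t \<le> E2 t - k * g2 t * p2 t \<and> - p2 t \<le> beta k * (g2 t)\<^sup>2"
    and t: "t \<ge> 0"
  shows "g1 t = g2 t"
proof -
  obtain t1 t2 c where m: "t1 \<ge> 0" "t2 \<ge> 0" "c > 0"
    "g1 t1 = c * g2 t2" "p1 t1 = c\<^sup>2 * p2 t2" "E1 t1 = c ^ 3 * E2 t2"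
    by (rule meets_separatrix[OF k A c1 c2 Ts sep]) (assumption, (rule that; assumption))
  have "E1 0 = E2 0"
  proof (cases "c * t1 \<le> t2")
    case True
    show ?thesis
      by (rule profile_match[OF k A c1(1) c2(1,2) less_imp_le[OF c2(3)] m(1,2,3) True m(4,5,6)])
  next
    \<comment> \<open>Now the second orbit reaches its start first, so the roles are exchanged and
      the scaling factor becomes \<open>1 / c\<close>.\<close>
    case False
    have c': "1 / c > 0" "1 / c * t2 \<le> t1" using False m(3) by (auto simp: field_simps)
    have "E2 0 = E1 0"
      by (rule profile_match[OF k A c2(1) c1(1,2) less_imp_le[OF c1(3)] m(2,1) c'])
        (use m in \<open>auto simp: power_divide\<close>)
    then show ?thesis ..
  qed
  then show ?thesis by (rule profile_same_energy[OF k c1(1) c2(1) _ t])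
qed

theorem theorem2:
  fixes m a :: real
  assumes "m < -1" and "a < 0"
  shows "(\<exists>!f. convex_concave_solution m a f \<and> (\<exists>l<0. (f \<longlongrightarrow> l) at_top)) \<and>
         infinite {f. convex_concave_solution m a f \<and> (f \<longlongrightarrow> 0) at_top} \<and>
         (\<forall>f. convex_concave_solution m a f \<and> ((\<exists>l<0. (f \<longlongrightarrow> l) at_top) \<or> (f \<longlongrightarrow> 0) at_top) \<longrightarrow>
            (\<forall>t\<ge>0. f t < 0) \<and> bounded (f ` {0..}))"
proof (intro conjI)
  define k where "k = - (m + 1) / 2"
  define A where "A = - a"
  have k: "k > 0" and m: "m = - (2 * k + 1)" and A: "A > 0" and a: "a = - A"
    using assms by (auto simp: k_def A_def field_simps)
  \<comment> \<open>\<open>- d\<close> is the value of \<open>u\<close> from which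
    \<open>separatrix_solution\<close> and \<open>node_solution\<close> start.\<close>
  define d where "d = beta k / 2"
  have b: "beta k > 0" "beta k < k / 10" using beta_pos[OF k] beta_small[OF k] by auto
  have d: "0 < d" "d \<le> k / 2" using b by (auto simp: d_def)
  have tend: "(restrict (\<lambda>t. - g t) {0..} \<longlongrightarrow> - l) at_top" if "(g \<longlongrightarrow> l) at_top" for g :: "real \<Rightarrow> real" and l
  proof -
    have "\<forall>\<^sub>F t in at_top. - g t = restrict (\<lambda>t. - g t) {0..} t"
      using eventually_ge_at_top[of 0] by eventually_elim simp
    with tendsto_minus[OF that] show ?thesis by (rule Lim_transform_eventually)
  qed
  show "\<exists>!f. convex_concave_solution m a f \<and> (\<exists>l<0. (f \<longlongrightarrow> l) at_top)"
  proof -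
    obtain gf pf Ef lf where F: "sol k (3 * k + 1) gf pf Ef {0..}" "gf 0 = 1" "pf 0 = - (beta k / 2)" "Ef 0 < 0"
      "0 < Ef 0 + k * (beta k / 2)"
      "\<And>t. t \<ge> 0 \<Longrightarrow> (gf t, pf t, Ef t) \<in> core_region k \<and> pf t < 0 \<and> Ef t \<le> 0 \<and> - (k / 2) * gf t * pf t \<le> Ef t - k * gf t * pf t"
      "lf > 0" "(gf \<longlongrightarrow> lf) at_top" "(pf \<longlongrightarrow> 0) at_top"
      by (rule separatrix_solution[OF k]) (rule that; assumption)
    have q: "0 < Ef t - k * gf t * pf t" if "t \<ge> 0" for t using F(6)[OF that] core_region_acc_pos by blast
    obtain g p E c t1 where G: "c > 0" "t1 \<ge> 0" "profile k A g p E"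
      "\<And>s. s \<ge> 0 \<Longrightarrow> g (t1 + s) = c * gf (c * s) \<and> p (t1 + s) = c\<^sup>2 * pf (c * s) \<and> E (t1 + s) = c ^ 3 * Ef (c * s)"
      by (rule extend_to_profile[OF k A d F(1,2) F(3)[folded d_def] F(4) F(5)[folded d_def] q F(9)]) (assumption, (rule that; assumption))
    have gl: "(g \<longlongrightarrow> c * lf) at_top"
      by (rule tendsto_affine_rescale[OF _ G(1) F(8)]) (use G(4) in blast)
    have lp: "c * lf > 0" using G(1) F(7) by simp
    \<comment> \<open>The four conditions are homogeneous under scaling, of weights 2, 4, 3 and 2,
      so they carry over from the separatrix to the tail of the profile.\<close>
    have sep: "p t < 0 \<and> 0 < g t * (E t - k * g t * p t) - 2 * (p t)\<^sup>2 \<and>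
      - (k / 2) * g t * p t \<le> E t - k * g t * p t \<and> - p t \<le> beta k * (g t)\<^sup>2" if t: "t \<ge> t1" for t
    proof -
      define s where "s = c * (t - t1)"
      have s: "s \<ge> 0" using t G(1) by (simp add: s_def)
      have e: "g t = c * gf s" "p t = c\<^sup>2 * pf s" "E t = c ^ 3 * Ef s" using G(4)[of "t - t1"] t by (auto simp: s_def)
      have fs: "pf s < 0" "0 < gf s * (Ef s - k * gf s * pf s) - 2 * (pf s)\<^sup>2"
        "- (k / 2) * gf s * pf s \<le> Ef s - k * gf s * pf s" "- pf s \<le> beta k * (gf s)\<^sup>2"
        using F(6)[OF s] by (auto simp: core_region_iff)
      have "p t < 0" using fs(1) G(1) by (simp add: e mult_pos_neg)
      moreover have "g t * (E t - k * g t * p t) - 2 * (p t)\<^sup>2 = c ^ 4 * (gf s * (Ef s - k * gf s * pf s) - 2 * (pf s)\<^sup>2)"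
        by (simp add: e algebra_simps power_numeral_reduce)
      then have "0 < g t * (E t - k * g t * p t) - 2 * (p t)\<^sup>2" using fs(2) G(1) by simp
      moreover have "- (k / 2) * g t * p t \<le> E t - k * g t * p t"
        using mult_left_mono[OF fs(3), of "c ^ 3"] G(1) by (simp add: e algebra_simps power_numeral_reduce)
      moreover have "- p t \<le> beta k * (g t)\<^sup>2"
        using mult_left_mono[OF fs(4), of "c\<^sup>2"] G(1) by (simp add: e algebra_simps power_numeral_reduce)
      ultimately show ?thesis by blast
    qed
    show ?thesis
    proof (rule ex1I[of _ "restrict (\<lambda>t. - g t) {0..}"])
      show "convex_concave_solution m a (restrict (\<lambda>t. - g t) {0..}) \<and> (\<exists>l<0. (restrict (\<lambda>t. - g t) {0..} \<longlongrightarrow> l) at_top)"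
        using profile_imp_convex_concave(1)[OF G(3) m] tend[OF gl] lp unfolding a
        by (intro conjI exI[of _ "- (c * lf)"]) auto
      fix f assume f: "convex_concave_solution m a f \<and> (\<exists>l<0. (f \<longlongrightarrow> l) at_top)"
      then obtain l where l: "l < 0" "(f \<longlongrightarrow> l) at_top" by blast
      have cf: "profile k A (\<lambda>t. - f t) (\<lambda>t. - D f t) (\<lambda>t. - D (D f) t + k * f t * D f t)"
        using convex_concave_imp_profile[of m a f k] f m by (simp add: A_def)
      have fg: "- f t = g t" if "t \<ge> 0" for t
        by (rule profile_unique_positive_limit[OF k A cf tendsto_minus[OF l(2)] _ G(3) gl lp G(2) sep that]) (use l in auto)
      have "f \<in> extensional {0..}"
        using f by (simp add: convex_concave_solution_def bvp_solution_def)
      then show "f = restrict (\<lambda>t. - g t) {0..}"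
        by (rule extensionalityI[OF _ restrict_extensional]) (use fg in force)
    qed
  qed
  show "infinite {f. convex_concave_solution m a f \<and> (f \<longlongrightarrow> 0) at_top}"
  proof -
    define V where "V = {2 * d\<^sup>2<..<k / 2 * d}"
    \<comment> \<open>\<open>P v f\<close>: \<open>- f\<close> leaves the line \<open>u = - d\<close> for good at height \<open>v\<close>, so \<open>f\<close> determines \<open>v\<close>.\<close>
    define P where "P v f \<longleftrightarrow> (\<exists>t1\<ge>0. - D f t1 = - d * (f t1)\<^sup>2 \<and> - D (D f) t1 = v * (- f t1) ^ 3 \<and>
      (\<forall>t>t1. - D f t > - d * (f t)\<^sup>2)) \<and> (\<forall>t\<ge>0. f t < 0)" for v f
    have "\<exists>f. convex_concave_solution m a f \<and> (f \<longlongrightarrow> 0) at_top \<and> P v f" if v: "v \<in> V" for v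
    proof -
      have v': "2 * (beta k / 2)\<^sup>2 < v" "v < k / 2 * (beta k / 2)" using v by (auto simp: V_def d_def)
      obtain gf pf Ef where F: "sol k (3 * k + 1) gf pf Ef {0..}" "gf 0 = 1" "pf 0 = - (beta k / 2)" "Ef 0 = v - k * (beta k / 2)"
        "\<And>t. t \<ge> 0 \<Longrightarrow> (gf t, pf t, Ef t) \<in> node_region k" "(gf \<longlongrightarrow> 0) at_top" "(pf \<longlongrightarrow> 0) at_top"
        by (rule node_solution[OF k v']) (rule that; assumption)
      have co: "(gf t, pf t, Ef t) \<in> core_region k" if "t \<ge> 0" for t using F(5)[OF that] by (simp add: node_region_iff)
      have q: "0 < Ef t - k * gf t * pf t" if "t \<ge> 0" for t using co[OF that] core_region_acc_pos by blast
      have e0: "Ef 0 < 0" "0 < Ef 0 + k * d"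
        using node_region_signs(2)[OF k F(5)[OF order_refl]] F(4) v'(1) zero_le_power2[of "beta k / 2"]
        unfolding d_def by linarith+
      obtain g p E c t1 where G: "c > 0" "t1 \<ge> 0" "profile k A g p E"
        "\<And>s. s \<ge> 0 \<Longrightarrow> g (t1 + s) = c * gf (c * s) \<and> p (t1 + s) = c\<^sup>2 * pf (c * s) \<and> E (t1 + s) = c ^ 3 * Ef (c * s)"
        by (rule extend_to_profile[OF k A d F(1,2) F(3)[folded d_def] e0 q F(7)]) (assumption, (rule that; assumption))
      have gl: "(g \<longlongrightarrow> 0) at_top"
        using tendsto_affine_rescale[of g t1 c gf c 0, OF _ G(1) F(6)] G(4) by simp
      have gpos: "g t > 0" if "t \<ge> 0" for t
        by (rule profile_signs[OF k A G(3) gl order_refl]) (use that in blast)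
      define f where "f = restrict (\<lambda>t. - g t) {0..}"
      note L = profile_imp_convex_concave[OF G(3) m, folded f_def]
      have ft: "f t = - g t" if "t \<ge> 0" for t using that by (simp add: f_def)
      define u where "u t = pf t / (gf t)\<^sup>2" for t
      have gf: "gf t > 0" if "t \<ge> 0" for t using co[OF that] by (simp add: core_region_iff)
      \<comment> \<open>In the core region \<open>v > 2 u^2\<close> makes \<open>u\<close> increase,
        so the tail never returns to \<open>u = - d\<close>.\<close>
      have ui: "u 0 < u s" if "s > 0" for s
      proof (rule increasing_within[OF that, of "{0..}"])
        show "(u has_real_derivative gf t * ((Ef t - k * gf t * pf t) / (gf t) ^ 3 - 2 * (pf t / (gf t)\<^sup>2)\<^sup>2)) (at t within {0..})"
          if "t \<in> {0..s}" for t
          unfolding u_def using phase_deriv(1)[OF F(1), of t] gf that by simp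
        show "0 < gf t * ((Ef t - k * gf t * pf t) / (gf t) ^ 3 - 2 * (pf t / (gf t)\<^sup>2)\<^sup>2)" if "0 < t" for t
        proof -
          have g: "gf t > 0" using gf that by simp
          have "(Ef t - k * gf t * pf t) / (gf t) ^ 3 - 2 * (pf t / (gf t)\<^sup>2)\<^sup>2 =
            (gf t * (Ef t - k * gf t * pf t) - 2 * (pf t)\<^sup>2) / (gf t) ^ 4"
            using g by (simp add: divide_simps) (simp add: algebra_simps power_numeral_reduce)
          then show ?thesis using co[of t] that g by (simp add: core_region_iff)
        qed
      qed auto
      have "P v f"
        unfolding P_def
      proof (intro conjI exI[of _ t1] allI impI)
        have e: "g t1 = c" "p t1 = - (d * c\<^sup>2)" "E t1 = c ^ 3 * (v - k * d)"
          using G(4)[of 0] F(2,3,4) by (auto simp: d_def)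
        show "- D f t1 = - d * (f t1)\<^sup>2" using L(2)[OF G(2)] ft[OF G(2)] by (simp add: e)
        show "- D (D f) t1 = v * (- f t1) ^ 3" using L(3)[OF G(2)] ft[OF G(2)]
          by (simp add: e algebra_simps power_numeral_reduce)
        show "f t < 0" if "t \<ge> 0" for t using gpos[OF that] ft[OF that] by simp
        fix t assume t: "t > t1"
        define s where "s = c * (t - t1)"
        have s: "s > 0" using t G(1) by (simp add: s_def)
        have et: "g t = c * gf s" "p t = c\<^sup>2 * pf s" using G(4)[of "t - t1"] t by (auto simp: s_def)
        have "- d < u s" using ui[OF s] F(2,3) by (simp add: u_def d_def)
        then have "- d * (gf s)\<^sup>2 < pf s" using gf[of s] s by (simp add: u_def less_divide_eq)
        then have "c\<^sup>2 * (- d * (gf s)\<^sup>2) < c\<^sup>2 * pf s" using G(1) by (intro mult_strict_left_mono) auto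
        then show "- D f t > - d * (f t)\<^sup>2"
          using L(2)[of t] ft[of t] t G(2) by (simp add: et power_mult_distrib algebra_simps)
      qed (rule G(2))
      moreover have "(f \<longlongrightarrow> 0) at_top" using tend[OF gl] by (simp add: f_def)
      ultimately show ?thesis using L(1) by (auto simp: a)
    qed
    then obtain ff where ff: "\<And>v. v \<in> V \<Longrightarrow> convex_concave_solution m a (ff v) \<and> (ff v \<longlongrightarrow> 0) at_top \<and> P v (ff v)"
      by metis
    \<comment> \<open>There is only one last time with \<open>u = - d\<close>, and as
      \<open>f < 0\<close> there, \<open>v\<close> can be read off from the second
      derivative.\<close>
    have Puniq: "v = w" if P1: "P v f" and P2: "P w f" for v w f
    proof -
      obtain t where t: "t \<ge> 0" "- D f t = - d * (f t)\<^sup>2" "- D (D f) t = v * (- f t) ^ 3"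
        "\<And>r. r > t \<Longrightarrow> - D f r > - d * (f r)\<^sup>2" using P1 unfolding P_def by blast
      obtain s where s: "s \<ge> 0" "- D f s = - d * (f s)\<^sup>2" "- D (D f) s = w * (- f s) ^ 3"
        "\<And>r. r > s \<Longrightarrow> - D f r > - d * (f r)\<^sup>2" using P2 unfolding P_def by blast
      have "t = s" using t(4)[of s] s(4)[of t] t(2) s(2) by (metis less_irrefl linorder_neqE_linordered_idom)
      moreover have "f s < 0" using P1 s(1) by (simp add: P_def)
      ultimately show ?thesis using t(3) s(3) by simp
    qed
    have "inj_on ff V" by (rule inj_onI) (use ff Puniq in metis)
    moreover have "infinite V"
    proof -
      have "2 * d * d < k / 2 * d" using b d by (intro mult_strict_right_mono) (auto simp: d_def)
      then show ?thesis by (simp add: V_def power2_eq_square)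
    qed
    ultimately have "infinite (ff ` V)" using finite_image_iff by blast
    moreover have "ff ` V \<subseteq> {f. convex_concave_solution m a f \<and> (f \<longlongrightarrow> 0) at_top}" using ff by blast
    ultimately show ?thesis using finite_subset by blast
  qed
  show "\<forall>f. convex_concave_solution m a f \<and> ((\<exists>l<0. (f \<longlongrightarrow> l) at_top) \<or> (f \<longlongrightarrow> 0) at_top) \<longrightarrow>
            (\<forall>t\<ge>0. f t < 0) \<and> bounded (f ` {0..})"
  proof (intro allI impI)
    fix f assume f: "convex_concave_solution m a f \<and> ((\<exists>l<0. (f \<longlongrightarrow> l) at_top) \<or> (f \<longlongrightarrow> 0) at_top)"
    then obtain l where l: "l \<le> 0" "(f \<longlongrightarrow> l) at_top" by (auto intro: less_imp_le)
    have cf: "profile k A (\<lambda>t. - f t) (\<lambda>t. - D f t) (\<lambda>t. - D (D f) t + k * f t * D f t)"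
      using convex_concave_imp_profile[of m a f k] f m by (simp add: A_def)
    have l0: "0 \<le> - l" using l by simp
    obtain t0 where t0: "t0 > 0" "\<And>t. t \<ge> t0 \<Longrightarrow> - f t \<le> - f t0" "\<And>t. t \<ge> 0 \<Longrightarrow> 0 < - f t"
      by (rule profile_signs[OF k A cf tendsto_minus[OF l(2)] l0]) (rule that; assumption)
    have "continuous_on {0..t0} f"
      using continuous_on_minus[OF sol_continuous(1)[OF sol_subset[of k "3 * k + 1" _ _ _ "{0..}" "{0..t0}"]]] cf
      by (fastforce simp: profile_def)
    then have "bounded (f ` {0..t0})"
      by (intro compact_imp_bounded compact_continuous_image) auto
    moreover have "bounded (f ` {t0..})"
      by (rule bounded_subset[of "{f t0..0}"]) (use t0 in \<open>force simp: less_imp_le\<close>)+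
    moreover have "{0..} = {0..t0} \<union> {t0..}" using t0(1) by auto
    ultimately have "bounded (f ` {0..})" by (simp add: image_Un)
    moreover have "f t < 0" if "t \<ge> 0" for t using t0(3)[OF that] by simp
    ultimately show "(\<forall>t\<ge>0. f t < 0) \<and> bounded (f ` {0..})" by blast
  qed
qed

end
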